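(* Let $M$ be a closed orientable manifold of dimension $n=1$ or $n\ge3$, and let $\overline{\mathbb H}_*\Lambda=\mathbb H_*\Lambda/\chi(M)[pt]$ be reduced loop homology, with the loop product $\mu$, its unit $\eta$, and a coproduct $\lambda$ of degree $1-2n$ which extends the loop coproduct on $\mathbb H_*(\Lambda,\Lambda_0)$ and satisfies the unital infinitesimal relation $$\lambda\mu=(\mu\otimes 1)(1\otimes\lambda)+(1\otimes\mu)(\lambda\otimes 1)-(\mu\otimes\mu)(1\otimes\lambda\eta\otimes 1).$$ Then the coproduct $\lambda$ on $\overline{\mathbb H}_*\Lambda$ is determined by its values on the unit $\eta$ and on a set of generators of the algebra $(\overline{\mathbb H}_*\Lambda,\mu)$; that is, two such coproducts which agree on $\eta$ and on a set of algebra generators are equal. Moreover, the coproduct on $\overline{\mathbb H}_*\Lambda$ determines the loop coproduct on $\mathbb H_*(\Lambda,\Lambda_0)$.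
   Context: Coefficients are in a field. $\Lambda$ is the free loop space of $M$, $\Lambda_0\subset\Lambda$ the subspace of constant loops, $\mathbb H_*\Lambda=H_{*+n}\Lambda$, $\mathbb H_*(\Lambda,\Lambda_0)=H_{*+n}(\Lambda,\Lambda_0)$, $\chi(M)$ the Euler characteristic, $[pt]$ the class of a constant loop. The loop product (Chas–Sullivan) on $\mathbb H_*\Lambda$ has degree $0$, is obtained by intersecting families of loops along equal basepoints and concatenating, has the fundamental class of $M$ as unit, and descends to $\overline{\mathbb H}_*\Lambda$. The loop coproduct (Sullivan, Goresky–Hingston) on $\mathbb H_*(\Lambda,\Lambda_0)$ has degree $1-2n$ and is obtained by cutting loops $\gamma$ at times $s$ where $\gamma(s)=\gamma(0)$. The projection $\mathbb H_*\Lambda\to\mathbb H_*(\Lambda,\Lambda_0)$ factors through $\overline{\mathbb H}_*\Lambda$. "Extends" means that the projection $\overline{\mathbb H}_*\Lambda\to\mathbb H_*(\Lambda,\Lambda_0)$ is a map of coalgebras. Signs follow the Koszul rule $(f\otimes g)(a\otimes b)=(-1)^{|g||a|}f(a)\otimes g(b)$; $1$ denotes the identity map. *)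

theory Defs
  imports "HOL-Homology.Homology" "HOL-Analysis.Abstract_Topological_Spaces" "HOL-Algebra.Module" "HOL-Algebra.QuotRing"
begin

section \<open>Graded vector spaces\<close>

text \<open>
  A graded vector space over the field \<open>'k\<close> is a module record of HOL-Algebra together with its
  subspaces of homogeneous elements.  The multiplicative fields inherited from rings are unused.
\<close>

record ('k, 'v) gmodule = "('k, 'v) module" +
  homog :: "int \<Rightarrow> 'v set"

definition scale :: "'k::field \<Rightarrow> ('x \<Rightarrow>\<^sub>0 'k) \<Rightarrow> ('x \<Rightarrow>\<^sub>0 'k)" where
  "scale a c = Poly_Mapping.map ((*) a) c"

definition lin_ext :: "('x \<Rightarrow> ('y \<Rightarrow>\<^sub>0 'k)) \<Rightarrow> ('x \<Rightarrow>\<^sub>0 'k::field) \<Rightarrow> ('y \<Rightarrow>\<^sub>0 'k)" where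
  "lin_ext f c = (\<Sum>x\<in>Poly_Mapping.keys c. scale (Poly_Mapping.lookup c x) (f x))"

inductive_set kspan :: "('x \<Rightarrow>\<^sub>0 'k::field) set \<Rightarrow> ('x \<Rightarrow>\<^sub>0 'k) set" for S where
  kspan_zero: "0 \<in> kspan S"
| kspan_add: "r \<in> S \<Longrightarrow> c \<in> kspan S \<Longrightarrow> scale a r + c \<in> kspan S"

definition free_gmodule :: "'x set \<Rightarrow> ('x \<Rightarrow> int) \<Rightarrow> ('k::field, 'x \<Rightarrow>\<^sub>0 'k) gmodule" where
  "free_gmodule S d =
    \<lparr>carrier = {c. Poly_Mapping.keys c \<subseteq> S}, monoid.mult = undefined, one = undefined,
     zero = 0, add = (+), smult = scale,
     homog = (\<lambda>i. {c. Poly_Mapping.keys c \<subseteq> {x \<in> S. d x = i}})\<rparr>"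

definition sub_gmodule :: "('k, 'v) gmodule \<Rightarrow> 'v set \<Rightarrow> ('k, 'v) gmodule" where
  "sub_gmodule V Z = V\<lparr>carrier := Z, homog := (\<lambda>i. homog V i \<inter> Z)\<rparr>"

text \<open>Quotient by a graded subspace, with cosets as elements (compare \<^const>\<open>FactRing\<close>).\<close>

definition FactModule :: "('k, 'v) gmodule \<Rightarrow> 'v set \<Rightarrow> ('k, 'v set) gmodule" where
  "FactModule V W =
    \<lparr>carrier = a_rcosets\<^bsub>V\<^esub> W, monoid.mult = undefined, one = undefined,
     zero = W, add = set_add V,
     smult = (\<lambda>a A. \<Union>v\<in>A. W +>\<^bsub>V\<^esub> (a \<odot>\<^bsub>V\<^esub> v)),
     homog = (\<lambda>i. (\<lambda>v. W +>\<^bsub>V\<^esub> v) ` homog V i)\<rparr>"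

definition shift_gmodule :: "int \<Rightarrow> ('k, 'v) gmodule \<Rightarrow> ('k, 'v) gmodule" where
  "shift_gmodule n V = V\<lparr>homog := (\<lambda>i. homog V (i + n))\<rparr>"

definition glinear :: "('k, 'v) gmodule \<Rightarrow> ('k, 'w) gmodule \<Rightarrow> int \<Rightarrow> ('v \<Rightarrow> 'w) \<Rightarrow> bool" where
  "glinear V W d f \<longleftrightarrow>
     f \<in> carrier V \<rightarrow> carrier W \<and>
     (\<forall>u\<in>carrier V. \<forall>v\<in>carrier V. f (u \<oplus>\<^bsub>V\<^esub> v) = f u \<oplus>\<^bsub>W\<^esub> f v) \<and>
     (\<forall>a. \<forall>v\<in>carrier V. f (a \<odot>\<^bsub>V\<^esub> v) = a \<odot>\<^bsub>W\<^esub> f v) \<and>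
     (\<forall>i. f ` homog V i \<subseteq> homog W (i + d))"

text \<open>A (not necessarily associative) graded algebra structure: bilinear of degree 0.\<close>

definition gbilinear :: "('k, 'v) gmodule \<Rightarrow> ('v \<Rightarrow> 'v \<Rightarrow> 'v) \<Rightarrow> bool" where
  "gbilinear V m \<longleftrightarrow>
     (\<forall>u\<in>carrier V. \<forall>v\<in>carrier V. m u v \<in> carrier V) \<and>
     (\<forall>u\<in>carrier V. \<forall>v\<in>carrier V. \<forall>w\<in>carrier V.
        m (u \<oplus>\<^bsub>V\<^esub> v) w = m u w \<oplus>\<^bsub>V\<^esub> m v w \<and> m w (u \<oplus>\<^bsub>V\<^esub> v) = m w u \<oplus>\<^bsub>V\<^esub> m w v) \<and>
     (\<forall>a. \<forall>u\<in>carrier V. \<forall>v\<in>carrier V.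
        m (a \<odot>\<^bsub>V\<^esub> u) v = a \<odot>\<^bsub>V\<^esub> m u v \<and> m u (a \<odot>\<^bsub>V\<^esub> v) = a \<odot>\<^bsub>V\<^esub> m u v) \<and>
     (\<forall>i j. \<forall>u\<in>homog V i. \<forall>v\<in>homog V j. m u v \<in> homog V (i + j))"

text \<open>The unital subalgebra generated by a set \<open>S\<close>.\<close>

inductive_set alg_generated ::
  "('k, 'v) gmodule \<Rightarrow> ('v \<Rightarrow> 'v \<Rightarrow> 'v) \<Rightarrow> 'v \<Rightarrow> 'v set \<Rightarrow> 'v set"
  for A :: "('k, 'v) gmodule" and m :: "'v \<Rightarrow> 'v \<Rightarrow> 'v" and u :: 'v and S :: "'v set" where
  gen: "s \<in> S \<Longrightarrow> s \<in> alg_generated A m u S"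
| unit: "u \<in> alg_generated A m u S"
| add: "a \<in> alg_generated A m u S \<Longrightarrow> b \<in> alg_generated A m u S
        \<Longrightarrow> a \<oplus>\<^bsub>A\<^esub> b \<in> alg_generated A m u S"
| smult: "a \<in> alg_generated A m u S \<Longrightarrow> k \<odot>\<^bsub>A\<^esub> a \<in> alg_generated A m u S"
| mult: "a \<in> alg_generated A m u S \<Longrightarrow> b \<in> alg_generated A m u S
        \<Longrightarrow> m a b \<in> alg_generated A m u S"

definition has_dim :: "('k, 'v) gmodule \<Rightarrow> 'v set \<Rightarrow> nat \<Rightarrow> bool" where
  "has_dim V E d \<longleftrightarrow>
     (\<exists>S. S \<subseteq> E \<and> finite S \<and> card S = d \<and>
        (\<forall>v\<in>E. \<exists>!a. a \<in> extensional S \<and> v = (\<Oplus>\<^bsub>V\<^esub>s\<in>S. a s \<odot>\<^bsub>V\<^esub> s)))"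

section \<open>Tensor powers and the Koszul rule\<close>

definition ksign :: "int \<Rightarrow> 'k::field" where
  "ksign d = (if even d then 1 else - 1)"

text \<open>
  The \<open>p\<close>-th tensor power is spanned by the words \<open>v\<^sub>1 \<otimes> \<dots> \<otimes> v\<^sub>p\<close> of homogeneous elements, modulo
  multilinearity.  A letter \<open>(i, v)\<close> carries the degree \<open>i\<close> in which \<open>v\<close> is homogeneous.  Words make
  the tensor product strictly associative, and the 0-th power is the ground field.
\<close>

type_synonym ('k, 'v) tensor = "((int \<times> 'v) list \<Rightarrow>\<^sub>0 'k) set"

definition words :: "nat \<Rightarrow> ('k, 'v) gmodule \<Rightarrow> (int \<times> 'v) list set" where
  "words p A = {xs. length xs = p \<and> (\<forall>(i, v)\<in>set xs. v \<in> homog A i)}"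

definition wdeg :: "(int \<times> 'v) list \<Rightarrow> int" where
  "wdeg xs = sum_list (map fst xs)"

definition free_words :: "nat \<Rightarrow> ('k::field, 'v) gmodule \<Rightarrow> ('k, (int \<times> 'v) list \<Rightarrow>\<^sub>0 'k) gmodule" where
  "free_words p A = free_gmodule (words p A) wdeg"

definition multilin_rels :: "nat \<Rightarrow> ('k::field, 'v) gmodule \<Rightarrow> ((int \<times> 'v) list \<Rightarrow>\<^sub>0 'k) set" where
  "multilin_rels p A = kspan (
     {Poly_Mapping.single (xs @ (i, u \<oplus>\<^bsub>A\<^esub> v) # ys) 1
        - Poly_Mapping.single (xs @ (i, u) # ys) 1 - Poly_Mapping.single (xs @ (i, v) # ys) 1
      | xs ys i u v. xs @ (i, u) # ys \<in> words p A \<and> v \<in> homog A i} \<union>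
     {Poly_Mapping.single (xs @ (i, a \<odot>\<^bsub>A\<^esub> v) # ys) 1 - Poly_Mapping.single (xs @ (i, v) # ys) a
      | xs ys i a v. xs @ (i, v) # ys \<in> words p A})"

definition tpow :: "nat \<Rightarrow> ('k::field, 'v) gmodule \<Rightarrow> ('k, ('k, 'v) tensor) gmodule" where
  "tpow p A = FactModule (free_words p A) (multilin_rels p A)"

definition pure :: "nat \<Rightarrow> ('k::field, 'v) gmodule \<Rightarrow> (int \<times> 'v) list \<Rightarrow> ('k, 'v) tensor" where
  "pure p A xs = multilin_rels p A +>\<^bsub>free_words p A\<^esub> Poly_Mapping.single xs 1"

text \<open>
  As for \<^const>\<open>rcoset_mult\<close>, maps on cosets are given as the union of the results over all
  representatives; these results coincide.
\<close>

definition tconc :: "nat \<Rightarrow> nat \<Rightarrow> ('k::field, 'v) gmodule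
    \<Rightarrow> ('k, 'v) tensor \<Rightarrow> ('k, 'v) tensor \<Rightarrow> ('k, 'v) tensor" where
  "tconc p q A s t = (\<Union>c\<in>s. \<Union>d\<in>t. multilin_rels (p + q) A +>\<^bsub>free_words (p + q) A\<^esub>
     (\<Sum>xs\<in>Poly_Mapping.keys c. \<Sum>ys\<in>Poly_Mapping.keys d.
        Poly_Mapping.single (xs @ ys) (Poly_Mapping.lookup c xs * Poly_Mapping.lookup d ys)))"

text \<open>The linear map on a tensor power induced by a multilinear function on words.\<close>

definition tlift :: "('k::field, 'w set) gmodule \<Rightarrow> ((int \<times> 'v) list \<Rightarrow> 'w set)
    \<Rightarrow> ('k, 'v) tensor \<Rightarrow> 'w set" where
  "tlift W F t =
     (\<Union>c\<in>t. \<Oplus>\<^bsub>W\<^esub>xs\<in>Poly_Mapping.keys c. Poly_Mapping.lookup c xs \<odot>\<^bsub>W\<^esub> F xs)"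

text \<open>Homogeneous maps from the \<open>src\<close>-th tensor power to the \<open>tgt\<close>-th one.\<close>

record ('s, 't) tmap =
  src :: nat
  tgt :: nat
  tdeg :: int
  app :: "'s \<Rightarrow> 't"

definition tid :: "('s, 's) tmap" where
  "tid = \<lparr>src = 1, tgt = 1, tdeg = 0, app = (\<lambda>t. t)\<rparr>"

definition tcomp :: "('s, 't) tmap \<Rightarrow> ('r, 's) tmap \<Rightarrow> ('r, 't) tmap" where
  "tcomp g f = \<lparr>src = src f, tgt = tgt g, tdeg = tdeg g + tdeg f, app = app g \<circ> app f\<rparr>"

text \<open>\<open>(f \<otimes> g)(a \<otimes> b) = (-1)\<^sup>|\<^sup>g\<^sup>|\<^sup>|\<^sup>a\<^sup>| f(a) \<otimes> g(b)\<close>, where \<open>a\<close> consists of the first \<open>src f\<close> letters.\<close>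

definition ttensor :: "('k::field, 'v) gmodule \<Rightarrow> ('k, 'w) gmodule
    \<Rightarrow> (('k, 'v) tensor, ('k, 'w) tensor) tmap \<Rightarrow> (('k, 'v) tensor, ('k, 'w) tensor) tmap
    \<Rightarrow> (('k, 'v) tensor, ('k, 'w) tensor) tmap" where
  "ttensor A B f g =
     \<lparr>src = src f + src g, tgt = tgt f + tgt g, tdeg = tdeg f + tdeg g,
      app = tlift (tpow (tgt f + tgt g) B) (\<lambda>xs.
        ksign (tdeg g * wdeg (take (src f) xs)) \<odot>\<^bsub>tpow (tgt f + tgt g) B\<^esub>
        tconc (tgt f) (tgt g) B
          (app f (pure (src f) A (take (src f) xs)))
          (app g (pure (src g) A (drop (src f) xs))))\<rparr>"

definition tmap_of_linear :: "('k::field, 'w) gmodule \<Rightarrow> ('v \<Rightarrow> 'w)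
    \<Rightarrow> (('k, 'v) tensor, ('k, 'w) tensor) tmap" where
  "tmap_of_linear B f = \<lparr>src = 1, tgt = 1, tdeg = 0,
     app = tlift (tpow 1 B) (\<lambda>xs. pure 1 B [(fst (xs ! 0), f (snd (xs ! 0)))])\<rparr>"

definition tmap_of_unit :: "('k::field, 'v) gmodule \<Rightarrow> 'v
    \<Rightarrow> (('k, 'v) tensor, ('k, 'v) tensor) tmap" where
  "tmap_of_unit A u = \<lparr>src = 0, tgt = 1, tdeg = 0,
     app = tlift (tpow 1 A) (\<lambda>xs. pure 1 A [(0, u)])\<rparr>"

definition tmap_of_product :: "('k::field, 'v) gmodule \<Rightarrow> ('v \<Rightarrow> 'v \<Rightarrow> 'v)
    \<Rightarrow> (('k, 'v) tensor, ('k, 'v) tensor) tmap" where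
  "tmap_of_product A m = \<lparr>src = 2, tgt = 1, tdeg = 0,
     app = tlift (tpow 1 A) (\<lambda>xs. pure 1 A
       [(fst (xs ! 0) + fst (xs ! 1), m (snd (xs ! 0)) (snd (xs ! 1)))])\<rparr>"

definition tmap_of_coproduct :: "('k::field, 'v) gmodule \<Rightarrow> int \<Rightarrow> ('v \<Rightarrow> ('k, 'v) tensor)
    \<Rightarrow> (('k, 'v) tensor, ('k, 'v) tensor) tmap" where
  "tmap_of_coproduct A d l = \<lparr>src = 1, tgt = 2, tdeg = d,
     app = tlift (tpow 2 A) (\<lambda>xs. l (snd (xs ! 0)))\<rparr>"

definition unital_infinitesimal_relation :: "('k::field, 'v) gmodule \<Rightarrow> int
    \<Rightarrow> ('v \<Rightarrow> 'v \<Rightarrow> 'v) \<Rightarrow> 'v \<Rightarrow> ('v \<Rightarrow> ('k, 'v) tensor) \<Rightarrow> bool" where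
  "unital_infinitesimal_relation A d m u l \<longleftrightarrow>
    (let \<mu> = tmap_of_product A m; \<eta> = tmap_of_unit A u; \<Delta> = tmap_of_coproduct A d l;
         T = ttensor A A; I = tid
     in \<forall>t\<in>carrier (tpow 2 A).
          app (tcomp \<Delta> \<mu>) t =
            (app (tcomp (T \<mu> I) (T I \<Delta>)) t \<oplus>\<^bsub>tpow 2 A\<^esub> app (tcomp (T I \<mu>) (T \<Delta> I)) t)
            \<ominus>\<^bsub>tpow 2 A\<^esub> app (tcomp (T \<mu> \<mu>) (T (T I (tcomp \<Delta> \<eta>)) I)) t)"

text \<open>\<open>f\<close> is a map of coalgebras \<open>(A, l) \<rightarrow> (B, l')\<close>.\<close>

definition coalgebra_map :: "('k::field, 'v) gmodule \<Rightarrow> ('k, 'w) gmodule \<Rightarrow> ('v \<Rightarrow> 'w)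
    \<Rightarrow> ('v \<Rightarrow> ('k, 'v) tensor) \<Rightarrow> ('w \<Rightarrow> ('k, 'w) tensor) \<Rightarrow> bool" where
  "coalgebra_map A B f l l' \<longleftrightarrow>
     (\<forall>a\<in>carrier A.
        l' (f a) = app (ttensor A B (tmap_of_linear B f) (tmap_of_linear B f)) (l a))"

section \<open>Singular homology with field coefficients\<close>

text \<open>
  A chain may have components in several degrees; a simplex is tagged with its dimension because
  the library's simplices of different dimensions are functions of the same type.
\<close>

type_synonym ('k, 'a) kchain = "(nat \<times> ((nat \<Rightarrow> real) \<Rightarrow> 'a)) \<Rightarrow>\<^sub>0 'k"

definition kchains :: "'a topology \<Rightarrow> ('k::field, ('k, 'a) kchain) gmodule" where
  "kchains X = free_gmodule {(p, \<sigma>). singular_simplex p X \<sigma>} (\<lambda>(p, _). int p)"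

definition kboundary :: "('k::field, 'a) kchain \<Rightarrow> ('k, 'a) kchain" where
  "kboundary = lin_ext (\<lambda>(p, \<sigma>). if p = 0 then 0
     else \<Sum>i\<le>p. Poly_Mapping.single (p - 1, singular_face p i \<sigma>) ((- 1) ^ i))"

definition relcycles :: "'a topology \<Rightarrow> 'a set \<Rightarrow> ('k::field, 'a) kchain set" where
  "relcycles X A = {c \<in> carrier (kchains X). kboundary c \<in> carrier (kchains (subtopology X A))}"

definition relboundaries :: "'a topology \<Rightarrow> 'a set \<Rightarrow> ('k::field, 'a) kchain set" where
  "relboundaries X A = {kboundary d + a | d a.
     d \<in> carrier (kchains X) \<and> a \<in> carrier (kchains (subtopology X A))}"

definition khomology :: "'a topology \<Rightarrow> 'a set \<Rightarrow> ('k::field, ('k, 'a) kchain set) gmodule" where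
  "khomology X A = FactModule (sub_gmodule (kchains X) (relcycles X A)) (relboundaries X A)"

definition kclass :: "'a topology \<Rightarrow> 'a set \<Rightarrow> ('k::field, 'a) kchain \<Rightarrow> ('k, 'a) kchain set" where
  "kclass X A c = relboundaries X A +>\<^bsub>kchains X\<^esub> c"

definition kpush :: "('a \<Rightarrow> 'b) \<Rightarrow> ('k::field, 'a) kchain \<Rightarrow> ('k, 'b) kchain" where
  "kpush g = lin_ext (\<lambda>(p, \<sigma>). Poly_Mapping.single (p, simplex_map p g \<sigma>) 1)"

text \<open>
  Eilenberg--Zilber cross product.  A \<open>(p,q)\<close>-shuffle is given by the set \<open>S\<close> of the \<open>p\<close> steps, out
  of \<open>p + q\<close>, in which the lattice path from \<open>(0,0)\<close> to \<open>(p,q)\<close> moves in the first direction; the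
  affine map \<open>stair S m\<close> sends the \<open>k\<close>-th vertex to the vertex numbered by the steps in \<open>S\<close> before
  \<open>k\<close>.
\<close>

definition stair :: "nat set \<Rightarrow> nat \<Rightarrow> (nat \<Rightarrow> real) \<Rightarrow> nat \<Rightarrow> real" where
  "stair S m x = (\<lambda>i. \<Sum>k | k \<le> m \<and> card (S \<inter> {..<k}) = i. x k)"

definition cross_simplex :: "nat \<times> ((nat \<Rightarrow> real) \<Rightarrow> 'a) \<Rightarrow> nat \<times> ((nat \<Rightarrow> real) \<Rightarrow> 'b)
    \<Rightarrow> ('k::field, 'a \<times> 'b) kchain" where
  "cross_simplex = (\<lambda>(p, \<sigma>) (q, \<tau>). \<Sum>S | S \<subseteq> {..<p + q} \<and> card S = p.
     Poly_Mapping.single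
       (p + q, \<lambda>x\<in>standard_simplex (p + q).
          (\<sigma> (stair S (p + q) x), \<tau> (stair ({..<p + q} - S) (p + q) x)))
       ((- 1) ^ card {(i, j). i \<in> S \<and> j \<in> {..<p + q} - S \<and> j < i}))"

definition cross :: "('k::field, 'a) kchain \<Rightarrow> ('k, 'b) kchain \<Rightarrow> ('k, 'a \<times> 'b) kchain" where
  "cross c d = lin_ext (\<lambda>x. lin_ext (\<lambda>y. cross_simplex x y) d) c"

text \<open>
  Cap product with the pullback along \<open>e\<close> of an \<open>n\<close>-cochain \<open>\<phi>\<close>, evaluated on front faces:
  the simplex \<open>\<sigma>\<close> goes to \<open>\<phi>(e \<circ> \<sigma>|[v\<^sub>0,\<dots>,v\<^sub>n])\<close> times \<open>\<sigma>|[v\<^sub>n,\<dots>,v\<^sub>p]\<close>.  With this convention capping is an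
  operator of degree \<open>-n\<close> obeying the Koszul rule with respect to \<^const>\<open>cross\<close>.
\<close>

definition front_face :: "nat \<Rightarrow> ((nat \<Rightarrow> real) \<Rightarrow> 'a) \<Rightarrow> (nat \<Rightarrow> real) \<Rightarrow> 'a" where
  "front_face n \<sigma> = restrict \<sigma> (standard_simplex n)"

definition back_face :: "nat \<Rightarrow> nat \<Rightarrow> ((nat \<Rightarrow> real) \<Rightarrow> 'a) \<Rightarrow> (nat \<Rightarrow> real) \<Rightarrow> 'a" where
  "back_face n p \<sigma> = (\<lambda>x\<in>standard_simplex (p - n). \<sigma> (\<lambda>i. if i < n then 0 else x (i - n)))"

definition cap :: "nat \<Rightarrow> (((nat \<Rightarrow> real) \<Rightarrow> 'b) \<Rightarrow> 'k) \<Rightarrow> ('a \<Rightarrow> 'b)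
    \<Rightarrow> ('k::field, 'a) kchain \<Rightarrow> ('k, 'a) kchain" where
  "cap n \<phi> e = lin_ext (\<lambda>(p, \<sigma>). if p < n then 0
     else Poly_Mapping.single (p - n, back_face n p \<sigma>) (\<phi> (simplex_map n e (front_face n \<sigma>))))"

section \<open>Closed oriented manifolds\<close>

definition closed_manifold :: "'a topology \<Rightarrow> nat \<Rightarrow> bool" where
  "closed_manifold X n \<longleftrightarrow>
     compact_space X \<and> Hausdorff_space X \<and> second_countable X \<and>
     (\<forall>x\<in>topspace X. \<exists>U V. openin X U \<and> x \<in> U \<and> openin (Euclidean_space n) V \<and>
        subtopology X U homeomorphic_space subtopology (Euclidean_space n) V)"

text \<open>A locally consistent choice of generators of the local integral homology groups.\<close>

definition orientation :: "'a topology \<Rightarrow> nat \<Rightarrow> ('a \<Rightarrow> 'a chain set) \<Rightarrow> bool" where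
  "orientation X n \<omega> \<longleftrightarrow>
     (\<forall>x\<in>topspace X.
        \<omega> x \<in> carrier (relative_homology_group (int n) X (topspace X - {x})) \<and>
        carrier (relative_homology_group (int n) X (topspace X - {x})) =
          generate (relative_homology_group (int n) X (topspace X - {x})) {\<omega> x}) \<and>
     (\<forall>x\<in>topspace X. \<exists>U. openin X U \<and> x \<in> U \<and>
        (\<exists>\<alpha>\<in>carrier (relative_homology_group (int n) X (topspace X - U)).
           \<forall>y\<in>U. hom_induced (int n) X (topspace X - U) X (topspace X - {y}) id \<alpha> = \<omega> y))"

definition fundamental_cycle :: "'a topology \<Rightarrow> nat \<Rightarrow> ('a \<Rightarrow> 'a chain set) \<Rightarrow> 'a chain" where
  "fundamental_cycle X n \<omega> = (SOME c. singular_relcycle n X {} c \<and>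
     (\<forall>x\<in>topspace X. homologous_rel_set n X (topspace X - {x}) c = \<omega> x))"

definition kfundamental_cycle ::
    "'a topology \<Rightarrow> nat \<Rightarrow> ('a \<Rightarrow> 'a chain set) \<Rightarrow> ('k::field, 'a) kchain" where
  "kfundamental_cycle X n \<omega> = (let c = fundamental_cycle X n \<omega> in
     \<Sum>\<sigma>\<in>Poly_Mapping.keys c. Poly_Mapping.single (n, \<sigma>) (of_int (Poly_Mapping.lookup c \<sigma>)))"

definition euler_char :: "'a topology \<Rightarrow> nat \<Rightarrow> int" where
  "euler_char X n = (\<Sum>p\<le>n. (- 1) ^ p * int (THE d.
     has_dim (khomology X {} :: (rat, (rat, 'a) kchain set) gmodule)
       (homog (khomology X {} :: (rat, (rat, 'a) kchain set) gmodule) (int p)) d))"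

text \<open>
  Cocycles representing the Thom class in \<open>H\<^sup>n(M \<times> M, M \<times> M - \<Delta>)\<close>.  The normalisation is equivalent
  to \<open>\<tau> \<inter> [M \<times> M] = [\<Delta>]\<close> and determines the class.
\<close>

definition thom_cocycle :: "'a topology \<Rightarrow> nat \<Rightarrow> ('a \<Rightarrow> 'a chain set)
    \<Rightarrow> (((nat \<Rightarrow> real) \<Rightarrow> 'a \<times> 'a) \<Rightarrow> 'k::field) \<Rightarrow> bool" where
  "thom_cocycle X n \<omega> \<phi> \<longleftrightarrow>
     (\<forall>\<sigma>. singular_simplex n (subtopology (prod_topology X X) {(x, y). x \<noteq> y}) \<sigma> \<longrightarrow> \<phi> \<sigma> = 0) \<and>
     (\<forall>\<sigma>. singular_simplex (Suc n) (prod_topology X X) \<sigma>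
        \<longrightarrow> (\<Sum>i\<le>Suc n. (- 1) ^ i * \<phi> (singular_face (Suc n) i \<sigma>)) = 0) \<and>
     (\<forall>y\<in>topspace X. (let c = kpush (\<lambda>x. (x, y)) (kfundamental_cycle X n \<omega>) in
        \<Sum>(p, \<sigma>)\<in>Poly_Mapping.keys c. Poly_Mapping.lookup c (p, \<sigma>) * \<phi> \<sigma>) = 1)"

text \<open>
  A continuous choice of paths between nearby points (for a Riemannian metric: short geodesics),
  constant on the diagonal.  Any two choices agree up to homotopy near the diagonal, so the
  operations below do not depend on it.
\<close>

definition path_system :: "'a topology \<Rightarrow> ('a \<times> 'a) set \<Rightarrow> ('a \<times> 'a \<Rightarrow> real \<Rightarrow> 'a) \<Rightarrow> bool" where
  "path_system X U h \<longleftrightarrow>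
     openin (prod_topology X X) U \<and> (\<forall>x\<in>topspace X. (x, x) \<in> U) \<and>
     continuous_map (prod_topology (subtopology (prod_topology X X) U) (top_of_set {0..1})) X
       (\<lambda>(z, t). h z t) \<and>
     (\<forall>(x, y)\<in>U. h (x, y) 0 = x \<and> h (x, y) 1 = y) \<and>
     (\<forall>x\<in>topspace X. \<forall>t\<in>{0..1}. h (x, x) t = x)"

definition the_path_system :: "'a topology \<Rightarrow> ('a \<times> 'a) set \<times> ('a \<times> 'a \<Rightarrow> real \<Rightarrow> 'a)" where
  "the_path_system X = (SOME (U, h). path_system X U h)"

section \<open>The free loop space\<close>

definition loops :: "'a topology \<Rightarrow> (real \<Rightarrow> 'a) set" where
  "loops X = {\<gamma> \<in> extensional {0..1}. continuous_map (top_of_set {0..1}) X \<gamma> \<and> \<gamma> 0 = \<gamma> 1}"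

text \<open>The set of continuous loops with the compact-open topology.\<close>

definition loop_space :: "'a topology \<Rightarrow> (real \<Rightarrow> 'a) topology" where
  "loop_space X = topology_generated_by
     {{\<gamma> \<in> loops X. \<gamma> ` K \<subseteq> U} | K U. compact K \<and> K \<subseteq> {0..1} \<and> openin X U}"

definition const_loop :: "'a \<Rightarrow> real \<Rightarrow> 'a" where
  "const_loop x = (\<lambda>t\<in>{0..1}. x)"

definition const_loops :: "'a topology \<Rightarrow> (real \<Rightarrow> 'a) set" where
  "const_loops X = const_loop ` topspace X"

definition path_conc :: "(real \<Rightarrow> 'a) \<Rightarrow> (real \<Rightarrow> 'a) \<Rightarrow> real \<Rightarrow> 'a" where
  "path_conc \<gamma> \<delta> t = (if t \<le> 1 / 2 then \<gamma> (2 * t) else \<delta> (2 * t - 1))"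

definition path_rev :: "(real \<Rightarrow> 'a) \<Rightarrow> real \<Rightarrow> 'a" where
  "path_rev \<gamma> t = \<gamma> (1 - t)"

text \<open>Concatenation of loops with nearby base points: run \<open>\<gamma>\<close>, move to \<open>\<delta>(0)\<close>, run \<open>\<delta>\<close>, move back.\<close>

definition loop_conc :: "('a \<times> 'a \<Rightarrow> real \<Rightarrow> 'a) \<Rightarrow> (real \<Rightarrow> 'a) \<times> (real \<Rightarrow> 'a) \<Rightarrow> real \<Rightarrow> 'a" where
  "loop_conc h = (\<lambda>(\<gamma>, \<delta>).
     restrict (path_conc \<gamma> (path_conc (h (\<gamma> 0, \<delta> 0)) (path_conc \<delta> (path_rev (h (\<gamma> 0, \<delta> 0)))))) {0..1})"

text \<open>Cutting \<open>\<gamma>\<close> at a time \<open>s\<close> with \<open>\<gamma>(s)\<close> near \<open>\<gamma>(0)\<close>, both pieces being closed up by short paths.\<close>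

definition loop_cut :: "('a \<times> 'a \<Rightarrow> real \<Rightarrow> 'a) \<Rightarrow> real \<times> (real \<Rightarrow> 'a)
    \<Rightarrow> (real \<Rightarrow> 'a) \<times> (real \<Rightarrow> 'a)" where
  "loop_cut h = (\<lambda>(s, \<gamma>).
     (restrict (path_conc (\<lambda>t. \<gamma> (s * t)) (path_rev (h (\<gamma> 0, \<gamma> s)))) {0..1},
      restrict (path_conc (h (\<gamma> 0, \<gamma> s)) (\<lambda>t. \<gamma> (s + t * (1 - s)))) {0..1}))"

section \<open>Loop homology, product and coproduct\<close>

type_synonym ('k, 'a) loop_class = "('k, real \<Rightarrow> 'a) kchain set"

definition loop_homology :: "'a topology \<Rightarrow> nat
    \<Rightarrow> ('k::field, ('k, 'a) loop_class) gmodule" where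
  "loop_homology X n = shift_gmodule (int n) (khomology (loop_space X) {})"

definition rel_loop_homology :: "'a topology \<Rightarrow> nat
    \<Rightarrow> ('k::field, ('k, 'a) loop_class) gmodule" where
  "rel_loop_homology X n = shift_gmodule (int n) (khomology (loop_space X) (const_loops X))"

text \<open>
  Intersection with the diagonal followed by a map \<open>r\<close>, for \<open>e : P \<rightarrow> M \<times> M\<close> and a relative cycle \<open>z\<close>
  of \<open>(P, A)\<close>: represent \<open>z\<close> by a cycle \<open>z'\<close> that is small with respect to the open cover by
  \<open>e\<^sup>-\<^sup>1(U)\<close> and \<open>e\<^sup>-\<^sup>1(M \<times> M - \<Delta>)\<close>, cap it with the pulled back Thom class (which gives a relative
  cycle in \<open>e\<^sup>-\<^sup>1(U)\<close>) and apply \<open>r : (e\<^sup>-\<^sup>1(U), A) \<rightarrow> (Q, B)\<close>.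
\<close>

definition intersect_diagonal :: "'a topology \<Rightarrow> nat \<Rightarrow> ('a \<Rightarrow> 'a chain set)
    \<Rightarrow> 'p topology \<Rightarrow> 'p set \<Rightarrow> ('p \<Rightarrow> 'a \<times> 'a) \<Rightarrow> ('p \<Rightarrow> 'q) \<Rightarrow> 'q topology \<Rightarrow> 'q set
    \<Rightarrow> ('k::field, 'p) kchain \<Rightarrow> ('k, 'q) kchain set" where
  "intersect_diagonal X n \<omega> P A e r Q B z =
     (\<Union>z' \<in> {z' \<in> relcycles P A. z' - z \<in> relboundaries P A \<and>
           (\<exists>u v. z' = u + v \<and>
              u \<in> carrier (kchains (subtopology P {p. e p \<in> fst (the_path_system X)})) \<and>
              v \<in> carrier (kchains (subtopology P {p. fst (e p) \<noteq> snd (e p)})))}.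
        kclass Q B (kpush r (cap n (SOME \<phi>. thom_cocycle X n \<omega> \<phi>) e z')))"

text \<open>
  The sign \<open>(-1)\<^sup>n\<^sup>|\<^sup>a\<^sup>|\<close>, where \<open>|a| = p - n\<close> is the shifted degree, in the loop product
  and in the Koszul identification \<open>\<bbbH> \<otimes> \<bbbH> \<cong> H(\<Lambda> \<times> \<Lambda>)\<close> comes from moving the shift
  operator past \<open>a\<close>.
\<close>

definition shift_sign :: "nat \<Rightarrow> ('k::field, 'a) kchain \<Rightarrow> ('k, 'a) kchain" where
  "shift_sign n = lin_ext (\<lambda>(p, \<sigma>). Poly_Mapping.single (p, \<sigma>) (ksign (int n * (int p - int n))))"

definition loop_product :: "'a topology \<Rightarrow> nat \<Rightarrow> ('a \<Rightarrow> 'a chain set)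
    \<Rightarrow> ('k::field, 'a) loop_class \<Rightarrow> ('k, 'a) loop_class \<Rightarrow> ('k, 'a) loop_class" where
  "loop_product X n \<omega> a b = (\<Union>c\<in>a. \<Union>d\<in>b.
     intersect_diagonal X n \<omega>
       (prod_topology (loop_space X) (loop_space X)) {} (\<lambda>(\<gamma>, \<delta>). (\<gamma> 0, \<delta> 0))
       (loop_conc (snd (the_path_system X))) (loop_space X) {}
       (cross (shift_sign n c) d))"

definition loop_unit :: "'a topology \<Rightarrow> nat \<Rightarrow> ('a \<Rightarrow> 'a chain set) \<Rightarrow> ('k::field, 'a) loop_class" where
  "loop_unit X n \<omega> = kclass (loop_space X) {} (kpush const_loop (kfundamental_cycle X n \<omega>))"

definition loop_point :: "'a topology \<Rightarrow> 'a \<Rightarrow> ('k::field, 'a) loop_class" where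
  "loop_point X x0 = kclass (loop_space X) {}
     (Poly_Mapping.single (0, \<lambda>_\<in>standard_simplex 0. const_loop x0) 1)"

definition unit_interval_chain :: "('k::field, real) kchain" where
  "unit_interval_chain = Poly_Mapping.single (1, \<lambda>x\<in>standard_simplex 1. x 1) 1"

definition const_pairs :: "'a topology \<Rightarrow> ((real \<Rightarrow> 'a) \<times> (real \<Rightarrow> 'a)) set" where
  "const_pairs X = {(\<gamma>, \<delta>). \<gamma> \<in> const_loops X \<or> \<delta> \<in> const_loops X}"

text \<open>The coproduct before the Kuenneth isomorphism, with values in \<open>H(\<Lambda> \<times> \<Lambda>, \<Lambda>\<^sub>0 \<times> \<Lambda> \<union> \<Lambda> \<times> \<Lambda>\<^sub>0)\<close>.\<close>

definition cut_class :: "'a topology \<Rightarrow> nat \<Rightarrow> ('a \<Rightarrow> 'a chain set)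
    \<Rightarrow> ('k::field, 'a) loop_class \<Rightarrow> ('k, (real \<Rightarrow> 'a) \<times> (real \<Rightarrow> 'a)) kchain set" where
  "cut_class X n \<omega> a = (\<Union>c\<in>a.
     intersect_diagonal X n \<omega>
       (prod_topology (top_of_set {0..1}) (loop_space X))
       {(s, \<gamma>). s = 0 \<or> s = 1 \<or> \<gamma> \<in> const_loops X}
       (\<lambda>(s, \<gamma>). (\<gamma> 0, \<gamma> s))
       (loop_cut (snd (the_path_system X)))
       (prod_topology (loop_space X) (loop_space X)) (const_pairs X)
       (cross unit_interval_chain c))"

definition kunneth :: "'a topology \<Rightarrow> nat \<Rightarrow> ('k::field, ('k, 'a) loop_class) tensor
    \<Rightarrow> ('k, (real \<Rightarrow> 'a) \<times> (real \<Rightarrow> 'a)) kchain set" where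
  "kunneth X n =
     tlift (khomology (prod_topology (loop_space X) (loop_space X)) (const_pairs X))
       (\<lambda>xs. \<Union>c\<in>snd (xs ! 0). \<Union>d\<in>snd (xs ! 1).
          kclass (prod_topology (loop_space X) (loop_space X)) (const_pairs X)
            (cross (shift_sign n c) d))"

definition loop_coproduct :: "'a topology \<Rightarrow> nat \<Rightarrow> ('a \<Rightarrow> 'a chain set)
    \<Rightarrow> ('k::field, 'a) loop_class \<Rightarrow> ('k, ('k, 'a) loop_class) tensor" where
  "loop_coproduct X n \<omega> a =
     (THE t. t \<in> carrier (tpow 2 (rel_loop_homology X n)) \<and> kunneth X n t = cut_class X n \<omega> a)"

section \<open>Reduced loop homology\<close>

type_synonym ('k, 'a) reduced_loop_class = "('k, 'a) loop_class set"

text \<open>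
  The line \<open>\<chi>(M)[pt]\<close>; for connected \<open>M\<close> it does not depend on the point \<open>x0\<close>.
\<close>

definition euler_span :: "'a topology \<Rightarrow> nat \<Rightarrow> 'a \<Rightarrow> ('k::field, 'a) loop_class set" where
  "euler_span X n x0 = {a \<odot>\<^bsub>loop_homology X n\<^esub>
     (of_int (euler_char X n) \<odot>\<^bsub>loop_homology X n\<^esub> loop_point X x0) | a. True}"

definition reduced_loop_homology :: "'a topology \<Rightarrow> nat \<Rightarrow> 'a
    \<Rightarrow> ('k::field, ('k, 'a) reduced_loop_class) gmodule" where
  "reduced_loop_homology X n x0 = FactModule (loop_homology X n) (euler_span X n x0)"

definition reduce :: "'a topology \<Rightarrow> nat \<Rightarrow> 'a
    \<Rightarrow> ('k::field, 'a) loop_class \<Rightarrow> ('k, 'a) reduced_loop_class" where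
  "reduce X n x0 a = euler_span X n x0 +>\<^bsub>loop_homology X n\<^esub> a"

definition reduced_unit :: "'a topology \<Rightarrow> nat \<Rightarrow> ('a \<Rightarrow> 'a chain set) \<Rightarrow> 'a
    \<Rightarrow> ('k::field, 'a) reduced_loop_class" where
  "reduced_unit X n \<omega> x0 = reduce X n x0 (loop_unit X n \<omega>)"

text \<open>The factorisation through reduced homology of the projection to homology relative to \<open>\<Lambda>\<^sub>0\<close>.\<close>

definition reduced_proj :: "'a topology
    \<Rightarrow> ('k::field, 'a) reduced_loop_class \<Rightarrow> ('k, 'a) loop_class" where
  "reduced_proj X A = (\<Union>a\<in>A. \<Union>c\<in>a. kclass (loop_space X) (const_loops X) c)"

text \<open>\<open>m\<close> is the product to which the loop product descends.\<close>

definition reduced_loop_product :: "'a topology \<Rightarrow> nat \<Rightarrow> ('a \<Rightarrow> 'a chain set) \<Rightarrow> 'a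
    \<Rightarrow> (('k::field, 'a) reduced_loop_class \<Rightarrow> ('k, 'a) reduced_loop_class
        \<Rightarrow> ('k, 'a) reduced_loop_class) \<Rightarrow> bool" where
  "reduced_loop_product X n \<omega> x0 m \<longleftrightarrow>
     gbilinear (reduced_loop_homology X n x0) m \<and>
     (\<forall>a\<in>carrier (loop_homology X n). \<forall>b\<in>carrier (loop_homology X n).
        m (reduce X n x0 a) (reduce X n x0 b) = reduce X n x0 (loop_product X n \<omega> a b))"

definition reduced_loop_coproduct :: "'a topology \<Rightarrow> nat \<Rightarrow> ('a \<Rightarrow> 'a chain set) \<Rightarrow> 'a
    \<Rightarrow> (('k::field, 'a) reduced_loop_class \<Rightarrow> ('k, 'a) reduced_loop_class
        \<Rightarrow> ('k, 'a) reduced_loop_class)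
    \<Rightarrow> (('k, 'a) reduced_loop_class \<Rightarrow> ('k, ('k, 'a) reduced_loop_class) tensor) \<Rightarrow> bool" where
  "reduced_loop_coproduct X n \<omega> x0 m l \<longleftrightarrow>
     glinear (reduced_loop_homology X n x0) (tpow 2 (reduced_loop_homology X n x0))
       (1 - 2 * int n) l \<and>
     coalgebra_map (reduced_loop_homology X n x0) (rel_loop_homology X n) (reduced_proj X)
       l (loop_coproduct X n \<omega>) \<and>
     unital_infinitesimal_relation (reduced_loop_homology X n x0) (1 - 2 * int n)
       m (reduced_unit X n \<omega> x0) l"

end

theory Submission
  imports Defs
begin

text \<open>
  Let \<open>\<lambda>\<close> and \<open>\<lambda>'\<close> be two coproducts which agree on \<open>\<eta>\<close>.  In the difference of their infinitesimal
  relations the unital term cancels, and on \<open>a \<otimes> b\<close> the terms \<open>1 \<otimes> \<lambda>\<close> and \<open>\<lambda> \<otimes> 1\<close> only involve \<open>\<lambda>(b)\<close> and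
  \<open>\<lambda>(a)\<close>.  So the set where \<open>\<lambda> = \<lambda>'\<close> is a subspace closed under products.  The Koszul sign in
  \<open>(1 \<otimes> \<lambda>)(a \<otimes> b)\<close> depends on \<open>a\<close> alone, so this also holds for inhomogeneous \<open>a\<close> and \<open>b\<close>, after
  decomposing them into homogeneous components.

  For the second claim it suffices that \<open>H(\<Lambda>) \<rightarrow> H(\<Lambda>, \<Lambda>\<^sub>0)\<close> is surjective, which holds because \<open>\<Lambda>\<^sub>0\<close> is a
  retract of \<open>\<Lambda>\<close>.
\<close>

section \<open>Vector spaces as module records\<close>

text \<open>The obstacle is that the maps of the infinitesimal relation are given by unions over
  representatives and by values on words of homogeneous letters, while a, b and the generators in S
  may be inhomogeneous. Agreement of the two coproducts at b is therefore never split into agreement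
  at components of b. Instead a and b are written as values of formal sums c and e of one-letter
  words, their tensor is the class of \<open>conc c e\<close>, and the sum over the letters on which
  the coproduct acts is carried out before any comparison. What remains contains the coproduct only
  through its value at b, at a or at the unit.

  A second obstacle is the unit. It enters tensors as the letter \<open>(0, u)\<close>, which is a
  word only if u has degree 0, and its cycle comes from a choice operator. That its class lies in
  the reduced homology is read off from the assumption that S generates the whole carrier.\<close>

locale field_module = abelian_group V for V :: "('k::field, 'v) gmodule" (structure) +
  assumes smult_closed [simp, intro]: "v \<in> carrier V \<Longrightarrow> a \<odot> v \<in> carrier V"
    and smult_r_distr: "u \<in> carrier V \<Longrightarrow> v \<in> carrier V \<Longrightarrow> a \<odot> (u \<oplus> v) = a \<odot> u \<oplus> a \<odot> v"
    and smult_l_distr: "v \<in> carrier V \<Longrightarrow> (a + b) \<odot> v = a \<odot> v \<oplus> b \<odot> v"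
    and smult_smult: "v \<in> carrier V \<Longrightarrow> a \<odot> (b \<odot> v) = (a * b) \<odot> v"
    and smult_one [simp]: "v \<in> carrier V \<Longrightarrow> 1 \<odot> v = v"
begin

lemma smult_zero_left [simp]: "v \<in> carrier V \<Longrightarrow> 0 \<odot> v = \<zero>"
  using smult_l_distr [of v 0 0] by (metis add_0 add.l_cancel_one' smult_closed)

lemma smult_zero_right [simp]: "a \<odot> \<zero> = \<zero>"
  using smult_smult [of \<zero> a 0] by simp

lemma smult_uminus_one: "v \<in> carrier V \<Longrightarrow> (- 1) \<odot> v = \<ominus> v"
  using smult_l_distr [of v "- 1" 1] minus_equality [of "(- 1) \<odot> v" v] by simp

lemma smult_finsum:
  "f \<in> S \<rightarrow> carrier V \<Longrightarrow> a \<odot> (\<Oplus>x\<in>S. f x) = (\<Oplus>x\<in>S. a \<odot> f x)"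
proof (induction S rule: infinite_finite_induct)
  case (insert x S)
  then have "f x \<in> carrier V" "f \<in> S \<rightarrow> carrier V" by auto
  then show ?case using insert by (simp add: smult_r_distr Pi_iff)
qed (simp_all add: finsum_infinite)

end

definition ksubspace :: "('k::field, 'v) gmodule \<Rightarrow> 'v set \<Rightarrow> bool" where
  "ksubspace V W \<longleftrightarrow> W \<subseteq> carrier V \<and> \<zero>\<^bsub>V\<^esub> \<in> W \<and>
     (\<forall>u\<in>W. \<forall>v\<in>W. u \<oplus>\<^bsub>V\<^esub> v \<in> W) \<and> (\<forall>a. \<forall>v\<in>W. a \<odot>\<^bsub>V\<^esub> v \<in> W)"

text \<open>The degree condition of \<open>glinear\<close> is dropped because maps such as
  concatenation with a fixed inhomogeneous tensor are linear but have no degree.\<close>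

definition klinear :: "('k::field, 'v) gmodule \<Rightarrow> ('k, 'w) gmodule \<Rightarrow> ('v \<Rightarrow> 'w) \<Rightarrow> bool" where
  "klinear V W f \<longleftrightarrow> f \<in> carrier V \<rightarrow> carrier W \<and>
     (\<forall>u\<in>carrier V. \<forall>v\<in>carrier V. f (u \<oplus>\<^bsub>V\<^esub> v) = f u \<oplus>\<^bsub>W\<^esub> f v) \<and>
     (\<forall>a. \<forall>v\<in>carrier V. f (a \<odot>\<^bsub>V\<^esub> v) = a \<odot>\<^bsub>W\<^esub> f v)"

lemma ksubspaceD:
  assumes "ksubspace V W"
  shows "v \<in> W \<Longrightarrow> v \<in> carrier V" "\<zero>\<^bsub>V\<^esub> \<in> W"
    "u \<in> W \<Longrightarrow> v \<in> W \<Longrightarrow> u \<oplus>\<^bsub>V\<^esub> v \<in> W" "v \<in> W \<Longrightarrow> a \<odot>\<^bsub>V\<^esub> v \<in> W"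
  using assms by (auto simp: ksubspace_def)

lemma (in field_module) ksubspace_minus: "ksubspace V W \<Longrightarrow> v \<in> W \<Longrightarrow> \<ominus> v \<in> W"
  using ksubspaceD [of V W] smult_uminus_one [of v] by metis

lemma (in field_module) ksubspace_carrier: "ksubspace V (carrier V)"
  by (simp add: ksubspace_def)

section \<open>Cosets and quotient spaces\<close>

lemma mem_coset_iff: "x \<in> W +>\<^bsub>V\<^esub> v \<longleftrightarrow> (\<exists>w\<in>W. x = w \<oplus>\<^bsub>V\<^esub> v)"
  by (auto simp: a_r_coset_def')

context field_module
begin

lemma coset_self: "ksubspace V W \<Longrightarrow> v \<in> carrier V \<Longrightarrow> v \<in> W +> v"
  by (metis mem_coset_iff ksubspaceD(2) l_zero)

lemma coset_eqI:
  assumes W: "ksubspace V W" and v: "v \<in> carrier V" and u: "u \<in> W +> v"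
  shows "W +> u = W +> v"
proof -
  obtain w where w: "w \<in> W" "u = w \<oplus> v" using u unfolding mem_coset_iff by blast
  note wc = ksubspaceD(1) [OF W] and mw = ksubspace_minus [OF W w(1)]
  have "\<exists>w'\<in>W. x \<oplus> u = w' \<oplus> v" if "x \<in> W" for x
    using that w v wc ksubspaceD(3) [OF W that w(1)] by (metis a_assoc)
  moreover have "\<exists>w'\<in>W. x \<oplus> v = w' \<oplus> u" if "x \<in> W" for x
  proof
    show "x \<oplus> \<ominus> w \<in> W" using ksubspaceD(3) [OF W that mw] .
    show "x \<oplus> v = x \<oplus> \<ominus> w \<oplus> u"
      using wc [OF that] wc [OF w(1)] v w(2) by (simp add: a_assoc r_neg1)
  qed
  ultimately show ?thesis by (auto simp: mem_coset_iff set_eq_iff)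
qed

lemma coset_zero: "ksubspace V W \<Longrightarrow> W +> \<zero> = W"
  using ksubspaceD(1) [of V W] by (fastforce simp: mem_coset_iff set_eq_iff)

lemma coset_add:
  assumes W: "ksubspace V W" and u: "u \<in> carrier V" and v: "v \<in> carrier V"
  shows "(W +> u) <+> (W +> v) = W +> (u \<oplus> v)"
proof -
  note wc = ksubspaceD(1) [OF W]
  have "\<exists>w\<in>W. (x \<oplus> u) \<oplus> (y \<oplus> v) = w \<oplus> (u \<oplus> v)" if "x \<in> W" "y \<in> W" for x y
    using ksubspaceD(3) [OF W that] wc [OF that(1)] wc [OF that(2)] u v
    by (intro bexI [of _ "x \<oplus> y"]) (simp_all add: a_ac)
  moreover have "\<exists>x\<in>W. \<exists>y\<in>W. w \<oplus> (u \<oplus> v) = (x \<oplus> u) \<oplus> (y \<oplus> v)" if "w \<in> W" for w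
    using that ksubspaceD(2) [OF W] wc [OF that] u v
    by (intro bexI [of _ w] bexI [of _ \<zero>]) (simp_all add: a_ac)
  ultimately show ?thesis
    by (auto simp: set_add_def' a_r_coset_def')
qed

text \<open>Two representatives differ by some w in W, and a multiple of w stays in W. Hence the
  union that defines scalar multiplication in \<open>FactModule\<close> is a union of equal
  cosets.\<close>

lemma coset_smult:
  assumes W: "ksubspace V W" and v: "v \<in> carrier V"
  shows "(\<Union>x\<in>W +> v. W +> (a \<odot> x)) = W +> (a \<odot> v)"
proof -
  have "W +> (a \<odot> x) = W +> (a \<odot> v)" if x: "x \<in> W +> v" for x
  proof (rule coset_eqI [OF W smult_closed [OF v]])
    obtain w where w: "w \<in> W" "x = w \<oplus> v" using x unfolding mem_coset_iff by blast
    then have "a \<odot> x = a \<odot> w \<oplus> a \<odot> v" using v ksubspaceD(1) [OF W] by (simp add: smult_r_distr)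
    then show "a \<odot> x \<in> W +> (a \<odot> v)"
      using ksubspaceD(4) [OF W w(1)] by (auto simp: mem_coset_iff)
  qed
  then show ?thesis using coset_self [OF W v] by blast
qed

end

lemma FactModule_simps:
  "carrier (FactModule V W) = (\<lambda>v. W +>\<^bsub>V\<^esub> v) ` carrier V"
  "\<zero>\<^bsub>FactModule V W\<^esub> = W"
  "A \<oplus>\<^bsub>FactModule V W\<^esub> B = A <+>\<^bsub>V\<^esub> B"
  "a \<odot>\<^bsub>FactModule V W\<^esub> A = (\<Union>v\<in>A. W +>\<^bsub>V\<^esub> (a \<odot>\<^bsub>V\<^esub> v))"
  "homog (FactModule V W) i = (\<lambda>v. W +>\<^bsub>V\<^esub> v) ` homog V i"
  by (auto simp: FactModule_def A_RCOSETS_def')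

lemma sub_gmodule_simps [simp]:
  "carrier (sub_gmodule V Z) = Z" "\<zero>\<^bsub>sub_gmodule V Z\<^esub> = \<zero>\<^bsub>V\<^esub>"
  "u \<oplus>\<^bsub>sub_gmodule V Z\<^esub> v = u \<oplus>\<^bsub>V\<^esub> v" "a \<odot>\<^bsub>sub_gmodule V Z\<^esub> v = a \<odot>\<^bsub>V\<^esub> v"
  "homog (sub_gmodule V Z) i = homog V i \<inter> Z"
  "W +>\<^bsub>sub_gmodule V Z\<^esub> v = W +>\<^bsub>V\<^esub> v" "set_add (sub_gmodule V Z) = set_add V"
  by (auto simp: sub_gmodule_def a_r_coset_def' set_add_def' fun_eq_iff)

lemma field_moduleI:
  fixes V :: "('k::field, 'v) gmodule" (structure)
  assumes "\<zero> \<in> carrier V" "\<And>u v. u \<in> carrier V \<Longrightarrow> v \<in> carrier V \<Longrightarrow> u \<oplus> v \<in> carrier V"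
    "\<And>a v. v \<in> carrier V \<Longrightarrow> a \<odot> v \<in> carrier V"
    "\<And>u v w. u \<in> carrier V \<Longrightarrow> v \<in> carrier V \<Longrightarrow> w \<in> carrier V \<Longrightarrow> (u \<oplus> v) \<oplus> w = u \<oplus> (v \<oplus> w)"
    "\<And>u v. u \<in> carrier V \<Longrightarrow> v \<in> carrier V \<Longrightarrow> u \<oplus> v = v \<oplus> u"
    "\<And>v. v \<in> carrier V \<Longrightarrow> \<zero> \<oplus> v = v"
    "\<And>v. v \<in> carrier V \<Longrightarrow> (- 1) \<odot> v \<oplus> v = \<zero>"
    "\<And>a u v. u \<in> carrier V \<Longrightarrow> v \<in> carrier V \<Longrightarrow> a \<odot> (u \<oplus> v) = a \<odot> u \<oplus> a \<odot> v"
    "\<And>a b v. v \<in> carrier V \<Longrightarrow> (a + b) \<odot> v = a \<odot> v \<oplus> b \<odot> v"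
    "\<And>a b v. v \<in> carrier V \<Longrightarrow> a \<odot> (b \<odot> v) = (a * b) \<odot> v"
    "\<And>v. v \<in> carrier V \<Longrightarrow> 1 \<odot> v = v"
  shows "field_module V"
proof -
  have "\<exists>u\<in>carrier V. u \<oplus> v = \<zero>" if "v \<in> carrier V" for v
    using assms(3,7) that by blast
  then show ?thesis
    by (intro field_module.intro abelian_groupI field_module_axioms.intro assms)
qed

lemma (in field_module) field_module_sub_gmodule:
  assumes "ksubspace V Z"
  shows "field_module (sub_gmodule V Z)"
proof -
  note c = ksubspaceD(1) [OF assms]
  show ?thesis
    by (rule field_moduleI) (use ksubspaceD(2-) [OF assms] in
      \<open>simp_all add: c a_ac smult_r_distr smult_l_distr smult_smult smult_uminus_one r_neg\<close>)
qed

text \<open>The cosets are formed in V and indexed by the elements of Z. With Z the relative cycles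
  and W the relative boundaries this is homology.\<close>

lemma (in field_module) field_module_FactModule:
  assumes Z: "ksubspace V Z" and W: "ksubspace V W"
  shows "field_module (FactModule (sub_gmodule V Z) W)"
proof -
  note c = ksubspaceD(1) [OF Z]
  let ?Q = "FactModule (sub_gmodule V Z) W"
  have sm: "a \<odot>\<^bsub>?Q\<^esub> (W +> v) = W +> (a \<odot> v)" if "v \<in> Z" for a v
    using coset_smult [OF W c [OF that]] by (simp add: FactModule_simps)
  have ca: "carrier ?Q = (\<lambda>v. W +> v) ` Z" and ad: "A \<oplus>\<^bsub>?Q\<^esub> B = A <+> B" and ze: "\<zero>\<^bsub>?Q\<^esub> = W" for A B
    by (simp_all add: FactModule_simps)
  note s = ca ad ze sm coset_add [OF W] c ksubspaceD(3-4) [OF Z]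
  show ?thesis
  proof (rule field_moduleI)
    show "\<zero>\<^bsub>FactModule (sub_gmodule V Z) W\<^esub> \<in> carrier (FactModule (sub_gmodule V Z) W)"
      using ksubspaceD(2) [OF Z] coset_zero [OF W] by (force simp: FactModule_simps)
  qed (auto simp: s a_ac smult_r_distr smult_l_distr smult_smult coset_zero [OF W]
        smult_uminus_one r_neg coset_add [OF W zero_closed, unfolded coset_zero [OF W]])
qed

lemma (in field_module) klinear_coset:
  assumes "ksubspace V Z" "ksubspace V W"
  shows "klinear (sub_gmodule V Z) (FactModule (sub_gmodule V Z) W) (\<lambda>v. W +> v)"
  using assms ksubspaceD(1) [OF assms(1)]
  by (auto simp: klinear_def FactModule_simps coset_add coset_smult)

text \<open>The last axiom says that the carrier is spanned by homogeneous elements, as an induction rule.\<close>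

locale graded_module = field_module V for V :: "('k::field, 'v) gmodule" (structure) +
  assumes homog_carrier: "v \<in> homog V i \<Longrightarrow> v \<in> carrier V"
    and homog_add: "u \<in> homog V i \<Longrightarrow> v \<in> homog V i \<Longrightarrow> u \<oplus> v \<in> homog V i"
    and homog_smult: "v \<in> homog V i \<Longrightarrow> a \<odot> v \<in> homog V i"
    and homog_induct: "\<And>P v. v \<in> carrier V \<Longrightarrow> P \<zero> \<Longrightarrow> (\<And>i v. v \<in> homog V i \<Longrightarrow> P v) \<Longrightarrow>
      (\<And>u v. u \<in> carrier V \<Longrightarrow> v \<in> carrier V \<Longrightarrow> P u \<Longrightarrow> P v \<Longrightarrow> P (u \<oplus> v)) \<Longrightarrow> P v"

text \<open>Spanning by homogeneous elements descends along the surjective coset map for any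
  subspace W, whereas directness of the grading would require W to be homogeneous. This is why
  \<open>graded_module\<close> is phrased by an induction rule.\<close>

lemma (in field_module) graded_module_FactModule_sub:
  assumes Z: "ksubspace V Z" and W: "ksubspace V W" and g: "graded_module (sub_gmodule V Z)"
  shows "graded_module (FactModule (sub_gmodule V Z) W)" (is "graded_module ?Q")
proof -
  interpret Z: graded_module "sub_gmodule V Z" by fact
  note c = ksubspaceD(1) [OF Z]
  note s = FactModule_simps coset_add [OF W] coset_smult [OF W] c
  show ?thesis
  proof (intro graded_module.intro field_module_FactModule [OF Z W] graded_module_axioms.intro)
    show "A \<oplus>\<^bsub>?Q\<^esub> B \<in> homog ?Q i" if "A \<in> homog ?Q i" "B \<in> homog ?Q i" for A B i
      using that Z.homog_add [where i=i] by (auto simp: s)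
    show "a \<odot>\<^bsub>?Q\<^esub> A \<in> homog ?Q i" if "A \<in> homog ?Q i" for A i a
      using that Z.homog_smult [where i=i] by (auto simp: s)
    show "P A" if A: "A \<in> carrier ?Q" and P: "P \<zero>\<^bsub>?Q\<^esub>" "\<And>i A. A \<in> homog ?Q i \<Longrightarrow> P A"
      "\<And>A B. A \<in> carrier ?Q \<Longrightarrow> B \<in> carrier ?Q \<Longrightarrow> P A \<Longrightarrow> P B \<Longrightarrow> P (A \<oplus>\<^bsub>?Q\<^esub> B)" for P A
    proof -
      have "P (W +> v)" if "v \<in> carrier (sub_gmodule V Z)" for v
        using that
      proof (rule Z.homog_induct)
        show "P (W +> \<zero>\<^bsub>sub_gmodule V Z\<^esub>)" using P(1) coset_zero [OF W] by (simp add: s)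
        show "P (W +> v)" if "v \<in> homog (sub_gmodule V Z) i" for i v
          using that P(2) [of "W +> v" i] by (auto simp: s)
        show "P (W +> (u \<oplus>\<^bsub>sub_gmodule V Z\<^esub> v))"
          if "u \<in> carrier (sub_gmodule V Z)" "v \<in> carrier (sub_gmodule V Z)"
            "P (W +> u)" "P (W +> v)" for u v
          using P(3) [of "W +> u" "W +> v"] that by (auto simp: s)
      qed
      then show ?thesis using A by (auto simp: s)
    qed
  qed (auto simp: s)
qed

text \<open>Makes the quotient results, stated for a subspace Z, applicable to V itself.\<close>

lemma (in field_module) sub_gmodule_carrier:
  assumes "\<And>i. homog V i \<subseteq> carrier V"
  shows "sub_gmodule V (carrier V) = V"
  unfolding sub_gmodule_def by (rule gmodule.equality) (simp_all add: Int_absorb2 assms)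

lemma (in graded_module) graded_module_FactModule:
  assumes "ksubspace V W"
  shows "graded_module (FactModule V W)"
proof -
  have "sub_gmodule V (carrier V) = V"
    using homog_carrier by (intro sub_gmodule_carrier) blast
  then show ?thesis
    using graded_module_FactModule_sub [OF ksubspace_carrier assms] graded_module_axioms by simp
qed

lemma (in graded_module) graded_module_shift_gmodule: "graded_module (shift_gmodule n V)"
proof -
  have s: "carrier (shift_gmodule n V) = carrier V" "\<zero>\<^bsub>shift_gmodule n V\<^esub> = \<zero>"
    "u \<oplus>\<^bsub>shift_gmodule n V\<^esub> v = u \<oplus> v" "a \<odot>\<^bsub>shift_gmodule n V\<^esub> v = a \<odot> v"
    "homog (shift_gmodule n V) i = homog V (i + n)" for u v a i
    by (auto simp: shift_gmodule_def)
  have "field_module (shift_gmodule n V)"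
    by (rule field_moduleI)
      (simp_all add: s a_ac smult_r_distr smult_l_distr smult_smult smult_uminus_one r_neg)
  then show ?thesis
  proof (intro graded_module.intro graded_module_axioms.intro)
    show "P v" if "v \<in> carrier (shift_gmodule n V)" "P \<zero>\<^bsub>shift_gmodule n V\<^esub>"
      "\<And>i v. v \<in> homog (shift_gmodule n V) i \<Longrightarrow> P v"
      "\<And>u v. u \<in> carrier (shift_gmodule n V) \<Longrightarrow> v \<in> carrier (shift_gmodule n V) \<Longrightarrow> P u \<Longrightarrow> P v
         \<Longrightarrow> P (u \<oplus>\<^bsub>shift_gmodule n V\<^esub> v)" for P v
    proof (rule homog_induct [where P=P])
      \<comment> \<open>An element of degree i in V has degree i - n after the shift.\<close>
      show "P v" if "v \<in> homog V i" for v i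
        using that \<open>\<And>i v. v \<in> homog (shift_gmodule n V) i \<Longrightarrow> P v\<close> [of v "i - n"] by (simp add: s)
    qed (use that in \<open>auto simp: s\<close>)
  qed (auto simp: s intro: homog_carrier homog_add homog_smult)
qed

section \<open>Free vector spaces and linear extension\<close>

lemma lookup_scale [simp]: "Poly_Mapping.lookup (scale a c) x = a * Poly_Mapping.lookup c x"
  by (simp add: scale_def map.rep_eq when_def)

lemma scale_simps:
  "scale a (c + d) = scale a c + scale a d" "scale (a + b) c = scale a c + scale b c"
  "scale a (scale b c) = scale (a * b) c" "scale 1 c = c" "scale 0 c = 0" "scale a 0 = 0"
  "scale a (c - d) = scale a c - scale a d" "scale (- 1) c = - c"
  "scale a (Poly_Mapping.single x b) = Poly_Mapping.single x (a * b)"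
  by (rule poly_mapping_eqI; simp add: lookup_add lookup_minus lookup_single algebra_simps when_def)+

lemma scale_sum: "scale a (\<Sum>i\<in>I. f i) = (\<Sum>i\<in>I. scale a (f i))"
  by (induction I rule: infinite_finite_induct) (simp_all add: scale_simps)

lemma keys_scale: "Poly_Mapping.keys (scale a c) \<subseteq> Poly_Mapping.keys c"
  by (auto simp: in_keys_iff)

lemma keys_add_subset: "Poly_Mapping.keys c \<subseteq> S \<Longrightarrow> Poly_Mapping.keys d \<subseteq> S \<Longrightarrow> Poly_Mapping.keys (c + d) \<subseteq> S"
  using keys_add [of c d] by blast

lemma keys_scale_subset: "Poly_Mapping.keys c \<subseteq> S \<Longrightarrow> Poly_Mapping.keys (scale a c) \<subseteq> S"
  using keys_scale by fast

text \<open>An additive form of \<open>update_induct\<close>: since x is a fresh key, updating is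
  adding a one-term sum. All keys stay in S, where the functions being extended take values in the
  carrier.\<close>

lemma poly_mapping_span_induct [consumes 1, case_names zero add]:
  assumes "Poly_Mapping.keys c \<subseteq> S" and "P 0"
    and "\<And>x a c. x \<in> S \<Longrightarrow> Poly_Mapping.keys c \<subseteq> S \<Longrightarrow> P c \<Longrightarrow> P (Poly_Mapping.single x a + c)"
  shows "P c"
  using assms(1)
proof (induction c rule: update_induct)
  case (update c x a)
  have "Poly_Mapping.update x a c = Poly_Mapping.single x a + c"
    using update(1)
    by (intro poly_mapping_eqI)
      (auto simp: lookup_update lookup_add lookup_single when_def in_keys_iff)
  moreover have "Poly_Mapping.keys c \<subseteq> S" "x \<in> S"
    using update(2,4) by (auto simp: keys_update)
  ultimately show ?case using assms(3) update(3) by metis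
qed (use assms(2) in simp)

lemma free_gmodule_simps [simp]:
  "carrier (free_gmodule S d) = {c. Poly_Mapping.keys c \<subseteq> S}" "\<zero>\<^bsub>free_gmodule S d\<^esub> = 0"
  "u \<oplus>\<^bsub>free_gmodule S d\<^esub> v = u + v" "a \<odot>\<^bsub>free_gmodule S d\<^esub> v = scale a v"
  "homog (free_gmodule S d) i = {c. Poly_Mapping.keys c \<subseteq> {x \<in> S. d x = i}}"
  by (auto simp: free_gmodule_def)

lemma field_module_free_gmodule: "field_module (free_gmodule S d)"
  by (rule field_moduleI) (auto simp: scale_simps algebra_simps intro: keys_add_subset keys_scale_subset
      dest: subsetD [OF keys_add] subsetD [OF keys_scale])

text \<open>This is what \<open>tlift\<close> computes on a single representative. It is the
  analogue of \<open>lin_ext\<close> for a target whose addition is a record field rather than a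
  type class operation.\<close>

definition lsum :: "('k::field, 'v) gmodule \<Rightarrow> ('x \<Rightarrow> 'v) \<Rightarrow> ('x \<Rightarrow>\<^sub>0 'k) \<Rightarrow> 'v" where
  "lsum V F c = (\<Oplus>\<^bsub>V\<^esub>x\<in>Poly_Mapping.keys c. Poly_Mapping.lookup c x \<odot>\<^bsub>V\<^esub> F x)"

context field_module
begin

text \<open>Cancellation makes the keys of a sum unpredictable, so sums are compared over a common
  finite index set, the additional terms being zero.\<close>

lemma lsum_superset:
  assumes "finite T" "Poly_Mapping.keys c \<subseteq> T" "F \<in> T \<rightarrow> carrier V"
  shows "lsum V F c = (\<Oplus>x\<in>T. Poly_Mapping.lookup c x \<odot> F x)"
  unfolding lsum_def
  by (rule add.finprod_mono_neutral_cong_left) (use assms in \<open>auto simp: in_keys_iff Pi_iff\<close>)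

lemma lsum_zero [simp]: "lsum V F 0 = \<zero>"
  by (simp add: lsum_def)

lemma lsum_closed: "F \<in> S \<rightarrow> carrier V \<Longrightarrow> Poly_Mapping.keys c \<subseteq> S \<Longrightarrow> lsum V F c \<in> carrier V"
  by (auto simp: lsum_def intro!: finsum_closed)

lemma lsum_single: "F x \<in> carrier V \<Longrightarrow> lsum V F (Poly_Mapping.single x a) = a \<odot> F x"
  by (subst lsum_superset [of "{x}"]) (simp_all add: finsum_insert)

lemma lsum_add:
  assumes "F \<in> S \<rightarrow> carrier V" "Poly_Mapping.keys c \<subseteq> S" "Poly_Mapping.keys d \<subseteq> S"
  shows "lsum V F (c + d) = lsum V F c \<oplus> lsum V F d"
proof -
  let ?T = "Poly_Mapping.keys c \<union> Poly_Mapping.keys d"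
  have F: "F \<in> ?T \<rightarrow> carrier V" using assms by auto
  have "lsum V F (c + d) = (\<Oplus>x\<in>?T. Poly_Mapping.lookup (c + d) x \<odot> F x)"
    by (rule lsum_superset [OF _ keys_add F]) simp
  also have "\<dots> = (\<Oplus>x\<in>?T. Poly_Mapping.lookup c x \<odot> F x \<oplus> Poly_Mapping.lookup d x \<odot> F x)"
    using F by (intro finsum_cong') (auto simp: lookup_add smult_l_distr Pi_iff)
  also have "\<dots> = lsum V F c \<oplus> lsum V F d"
  proof (subst finsum_addf)
    show "(\<lambda>x. Poly_Mapping.lookup c x \<odot> F x) \<in> ?T \<rightarrow> carrier V"
      "(\<lambda>x. Poly_Mapping.lookup d x \<odot> F x) \<in> ?T \<rightarrow> carrier V"
      using F by (auto simp: Pi_iff)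
  qed (simp add: lsum_superset [OF _ _ F])
  finally show ?thesis .
qed

lemma lsum_scale:
  assumes "F \<in> S \<rightarrow> carrier V" "Poly_Mapping.keys c \<subseteq> S"
  shows "lsum V F (scale a c) = a \<odot> lsum V F c"
proof -
  have F: "F \<in> Poly_Mapping.keys c \<rightarrow> carrier V" using assms by auto
  have "lsum V F (scale a c) = (\<Oplus>x\<in>Poly_Mapping.keys c. a \<odot> (Poly_Mapping.lookup c x \<odot> F x))"
    using F by (subst lsum_superset [OF _ keys_scale])
      (auto intro!: finsum_cong' simp: smult_smult Pi_iff)
  also have "\<dots> = a \<odot> lsum V F c"
    using F unfolding lsum_def by (subst smult_finsum) auto
  finally show ?thesis .
qed

lemma klinear_lsum: "F \<in> S \<rightarrow> carrier V \<Longrightarrow> klinear (free_gmodule S d) V (lsum V F)"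
  by (auto simp: klinear_def intro: lsum_closed lsum_add lsum_scale)

lemma lsum_cong:
  assumes "\<And>x. x \<in> S \<Longrightarrow> F x = G x" "G \<in> S \<rightarrow> carrier V" "Poly_Mapping.keys c \<subseteq> S"
  shows "lsum V F c = lsum V G c"
  unfolding lsum_def using assms by (intro finsum_cong') auto

end

lemma klinear_zero:
  assumes "field_module V" "field_module W" "klinear V W h"
  shows "h \<zero>\<^bsub>V\<^esub> = \<zero>\<^bsub>W\<^esub>"
proof -
  interpret V: field_module V by fact
  interpret W: field_module W by fact
  have "h (0 \<odot>\<^bsub>V\<^esub> \<zero>\<^bsub>V\<^esub>) = 0 \<odot>\<^bsub>W\<^esub> h \<zero>\<^bsub>V\<^esub>" and "h \<zero>\<^bsub>V\<^esub> \<in> carrier W"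
    using assms(3) V.zero_closed unfolding klinear_def by blast+
  then show ?thesis using V.smult_zero_left V.zero_closed W.smult_zero_left by metis
qed

lemma lsum_klinear:
  assumes V: "field_module V" and W: "field_module W" and h: "klinear V W h"
    and F: "F \<in> S \<rightarrow> carrier V" and c: "Poly_Mapping.keys c \<subseteq> S"
  shows "h (lsum V F c) = lsum W (\<lambda>x. h (F x)) c"
  using c
proof (induction rule: poly_mapping_span_induct)
  case zero
  show ?case
    using klinear_zero [OF V W h] by (simp add: field_module.lsum_zero [OF V] field_module.lsum_zero [OF W])
next
  case (add x a c)
  have hF: "(\<lambda>x. h (F x)) \<in> S \<rightarrow> carrier W" using h F by (auto simp: klinear_def)
  have k: "Poly_Mapping.keys (Poly_Mapping.single x a) \<subseteq> S" using add by simp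
  have Fx: "F x \<in> carrier V" using F add by auto
  have "h (lsum V F (Poly_Mapping.single x a + c)) = h (a \<odot>\<^bsub>V\<^esub> F x \<oplus>\<^bsub>V\<^esub> lsum V F c)"
    using field_module.lsum_add [OF V F k add(2)] field_module.lsum_single [OF V, of F, OF Fx] by simp
  also have "\<dots> = a \<odot>\<^bsub>W\<^esub> h (F x) \<oplus>\<^bsub>W\<^esub> h (lsum V F c)"
    using h Fx field_module.lsum_closed [OF V F add(2)] field_module.smult_closed [OF V Fx] by (auto simp: klinear_def)
  also have "\<dots> = lsum W (\<lambda>x. h (F x)) (Poly_Mapping.single x a + c)"
    using field_module.lsum_add [OF W hF k add(2)] add(3) hF add(1)
    by (simp add: field_module.lsum_single [OF W] Pi_iff)
  finally show ?case .
qed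

section \<open>Linear extension between free vector spaces\<close>

lemma lookup_lin_ext:
  assumes "finite T" "Poly_Mapping.keys c \<subseteq> T"
  shows "Poly_Mapping.lookup (lin_ext f c) y =
    (\<Sum>x\<in>T. Poly_Mapping.lookup c x * Poly_Mapping.lookup (f x) y)"
  unfolding lin_ext_def lookup_sum lookup_scale
  by (rule sum.mono_neutral_left) (use assms in \<open>auto simp: in_keys_iff\<close>)

lemma lin_ext_add: "lin_ext f (c + d) = lin_ext f c + lin_ext f d"
proof (rule poly_mapping_eqI)
  fix y
  let ?T = "Poly_Mapping.keys c \<union> Poly_Mapping.keys d"
  show "Poly_Mapping.lookup (lin_ext f (c + d)) y = Poly_Mapping.lookup (lin_ext f c + lin_ext f d) y"
    using keys_add [of c d]
    by (simp add: lookup_add lookup_lin_ext [of ?T] distrib_right sum.distrib)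
qed

lemma lin_ext_scale: "lin_ext f (scale a c) = scale a (lin_ext f c)"
  by (rule poly_mapping_eqI)
    (simp add: lookup_lin_ext [of "Poly_Mapping.keys c"] keys_scale sum_distrib_left mult.assoc)

lemma lin_ext_zero [simp]: "lin_ext f 0 = 0"
  by (simp add: lin_ext_def)

lemma lin_ext_minus: "lin_ext f (c - d) = lin_ext f c - lin_ext f d"
  using lin_ext_add [of f c "scale (- 1) d"]
  by (simp only: lin_ext_scale) (simp add: scale_simps)

lemma lin_ext_single [simp]: "lin_ext f (Poly_Mapping.single x a) = scale a (f x)"
  by (simp add: lin_ext_def scale_simps)

lemma lin_ext_sum: "lin_ext f (\<Sum>i\<in>I. g i) = (\<Sum>i\<in>I. lin_ext f (g i))"
  by (induction I rule: infinite_finite_induct) (simp_all add: lin_ext_add)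

lemma lin_ext_fun_add: "lin_ext (\<lambda>x. f x + g x) c = lin_ext f c + lin_ext g c"
  by (simp add: lin_ext_def scale_simps sum.distrib)

lemma lin_ext_fun_scale: "lin_ext (\<lambda>x. scale a (f x)) c = scale a (lin_ext f c)"
  by (rule poly_mapping_eqI)
    (simp add: lookup_lin_ext [of "Poly_Mapping.keys c"] sum_distrib_left mult.left_commute)

lemma lin_ext_lin_ext: "lin_ext f (lin_ext g c) = lin_ext (\<lambda>x. lin_ext f (g x)) c"
proof -
  have "Poly_Mapping.keys c \<subseteq> UNIV" by simp
  then show ?thesis
    by (induction rule: poly_mapping_span_induct) (simp_all add: lin_ext_add lin_ext_scale)
qed

lemma keys_lin_ext:
  assumes "\<And>x. x \<in> Poly_Mapping.keys c \<Longrightarrow> Poly_Mapping.keys (f x) \<subseteq> T"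
  shows "Poly_Mapping.keys (lin_ext f c) \<subseteq> T"
  unfolding lin_ext_def
  by (rule order_trans [OF keys_sum]) (use assms keys_scale in fast)

section \<open>Linear spans in free vector spaces\<close>

lemma kspan_base: "r \<in> S \<Longrightarrow> r \<in> kspan S"
  using kspan_add [of r S 0 1] kspan_zero [of S] by (simp add: scale_simps)

lemma kspan_plus: "c \<in> kspan S \<Longrightarrow> d \<in> kspan S \<Longrightarrow> c + d \<in> kspan S"
  by (induction rule: kspan.induct) (simp_all add: add.assoc kspan.kspan_add)

lemma kspan_scale: "c \<in> kspan S \<Longrightarrow> scale a c \<in> kspan S"
  by (induction rule: kspan.induct) (simp_all add: scale_simps kspan.intros)

lemma ksubspace_kspan:
  assumes "\<And>r. r \<in> S \<Longrightarrow> Poly_Mapping.keys r \<subseteq> T"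
  shows "ksubspace (free_gmodule T d) (kspan S)"
proof -
  have "Poly_Mapping.keys c \<subseteq> T" if "c \<in> kspan S" for c
    using that
  proof induction
    case (kspan_add r c a)
    then show ?case by (simp add: keys_add_subset keys_scale_subset assms)
  qed simp
  then show ?thesis
    by (auto simp: ksubspace_def kspan_zero kspan_plus kspan_scale)
qed

text \<open>Serves to carry the relations of one tensor power into those of a longer one by
  concatenation with a fixed word.\<close>

lemma kspan_linear_image:
  assumes "\<And>c d. f (c + d) = f c + f d" "\<And>a c. f (scale a c) = scale a (f c)"
    and "\<And>r. r \<in> S \<Longrightarrow> f r \<in> kspan S'" and "c \<in> kspan S"
  shows "f c \<in> kspan S'"
  using assms(4)
proof induction
  case kspan_zero
  show ?case using assms(2) [of 0 0] by (simp add: scale_simps kspan.kspan_zero)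
qed (simp add: assms kspan_plus kspan_scale)

text \<open>The source of well-definedness on tensor powers: a linear extension that kills the
  generating relations is constant on classes.\<close>

lemma kspan_vanish:
  assumes V: "field_module V" and L: "klinear (free_gmodule T d) V L"
    and r: "\<And>r. r \<in> S \<Longrightarrow> Poly_Mapping.keys r \<subseteq> T \<and> L r = \<zero>\<^bsub>V\<^esub>" and c: "c \<in> kspan S"
  shows "L c = \<zero>\<^bsub>V\<^esub>"
  using c
proof induction
  case kspan_zero
  show ?case using klinear_zero [OF field_module_free_gmodule V L] by simp
next
  case (kspan_add s c)
  interpret field_module V by fact
  have "Poly_Mapping.keys c \<subseteq> T" "Poly_Mapping.keys s \<subseteq> T"
    using ksubspaceD(1) [OF ksubspace_kspan [of S T d] kspan_add(2)] r kspan_add(1) by auto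
  moreover from this have "Poly_Mapping.keys (scale a s) \<subseteq> T" for a
    by (intro keys_scale_subset)
  ultimately show ?case
    using L r [OF kspan_add(1)] kspan_add(3) by (simp add: klinear_def)
qed

section \<open>Tensor powers\<close>

declare One_nat_def [simp del]

section \<open>Linear maps and multilinear functions on words\<close>

lemma klinear_compose:
  "klinear U V f \<Longrightarrow> klinear V W g \<Longrightarrow> klinear U W (\<lambda>x. g (f x))"
  by (auto simp: klinear_def Pi_iff)

lemma klinear_smult:
  assumes "field_module W" "klinear V W f"
  shows "klinear V W (\<lambda>x. a \<odot>\<^bsub>W\<^esub> f x)"
proof -
  interpret field_module W by fact
  show ?thesis
    using assms(2) by (auto simp: klinear_def smult_r_distr smult_smult Pi_iff mult.commute)
qed

text \<open>The generating set inside \<open>multilin_rels\<close>, named so that statements about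
  relations can be reduced to it.\<close>

definition multilin_gens :: "nat \<Rightarrow> ('k::field, 'v) gmodule \<Rightarrow> ((int \<times> 'v) list \<Rightarrow>\<^sub>0 'k) set" where
  "multilin_gens p A =
     {Poly_Mapping.single (xs @ (i, u \<oplus>\<^bsub>A\<^esub> v) # ys) 1
        - Poly_Mapping.single (xs @ (i, u) # ys) 1 - Poly_Mapping.single (xs @ (i, v) # ys) 1
      | xs ys i u v. xs @ (i, u) # ys \<in> words p A \<and> v \<in> homog A i} \<union>
     {Poly_Mapping.single (xs @ (i, a \<odot>\<^bsub>A\<^esub> v) # ys) 1 - Poly_Mapping.single (xs @ (i, v) # ys) a
      | xs ys i a v. xs @ (i, v) # ys \<in> words p A}"

lemma multilin_rels_eq: "multilin_rels p A = kspan (multilin_gens p A)"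
  by (simp add: multilin_rels_def multilin_gens_def)

text \<open>The two conditions mirror the two families in \<open>multilin_gens\<close>; the degree
  tag of the varied letter is held fixed.\<close>

definition multilinear ::
    "nat \<Rightarrow> ('k::field, 'v) gmodule \<Rightarrow> ('k, 'w) gmodule \<Rightarrow> ((int \<times> 'v) list \<Rightarrow> 'w) \<Rightarrow> bool" where
  "multilinear p A W F \<longleftrightarrow> F \<in> words p A \<rightarrow> carrier W \<and>
     (\<forall>xs ys i u v. xs @ (i, u) # ys \<in> words p A \<and> v \<in> homog A i \<longrightarrow>
        F (xs @ (i, u \<oplus>\<^bsub>A\<^esub> v) # ys) = F (xs @ (i, u) # ys) \<oplus>\<^bsub>W\<^esub> F (xs @ (i, v) # ys)) \<and>
     (\<forall>xs ys i a v. xs @ (i, v) # ys \<in> words p A \<longrightarrow>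
        F (xs @ (i, a \<odot>\<^bsub>A\<^esub> v) # ys) = a \<odot>\<^bsub>W\<^esub> F (xs @ (i, v) # ys))"

lemma words_letter:
  "xs @ (i, u) # ys \<in> words p A \<Longrightarrow> v \<in> homog A i \<Longrightarrow> xs @ (i, v) # ys \<in> words p A"
  by (auto simp: words_def)

lemma words_append: "xs \<in> words p A \<Longrightarrow> ys \<in> words q A \<Longrightarrow> xs @ ys \<in> words (p + q) A"
  by (auto simp: words_def)

lemma words_1_iff: "xs \<in> words 1 A \<longleftrightarrow> (\<exists>i v. xs = [(i, v)] \<and> v \<in> homog A i)"
  by (auto simp: words_def length_Suc_conv One_nat_def)

lemma words_2_iff:
  "xs \<in> words 2 A \<longleftrightarrow> (\<exists>i u j v. xs = [(i, u), (j, v)] \<and> u \<in> homog A i \<and> v \<in> homog A j)"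
  by (auto simp: words_def length_Suc_conv numeral_2_eq_2)

lemma append_Cons_eq_1: "xs @ x # ys = [y] \<longleftrightarrow> xs = [] \<and> ys = [] \<and> x = y"
  by (cases xs) auto

lemma append_Cons_eq_2:
  "xs @ x # ys = [y, z] \<longleftrightarrow> xs = [] \<and> x = y \<and> ys = [z] \<or> xs = [y] \<and> x = z \<and> ys = []"
  by (cases xs) (auto simp: append_Cons_eq_1)

text \<open>Linearity in one slot. The maps to be evaluated have at most two letters as input, so
  checking each slot with the other letter fixed suffices.\<close>

definition letter_linear ::
    "('k::field, 'v) gmodule \<Rightarrow> ('k, 'w) gmodule \<Rightarrow> (int \<times> 'v \<Rightarrow> 'w) \<Rightarrow> bool" where
  "letter_linear A W G \<longleftrightarrow>
     (\<forall>i. \<forall>u\<in>homog A i. G (i, u) \<in> carrier W \<and>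
        (\<forall>v\<in>homog A i. G (i, u \<oplus>\<^bsub>A\<^esub> v) = G (i, u) \<oplus>\<^bsub>W\<^esub> G (i, v)) \<and>
        (\<forall>a. G (i, a \<odot>\<^bsub>A\<^esub> u) = a \<odot>\<^bsub>W\<^esub> G (i, u)))"

lemma multilinear_1: "letter_linear A W G \<Longrightarrow> multilinear 1 A W (\<lambda>xs. G (xs ! 0))"
  by (auto simp: multilinear_def letter_linear_def words_1_iff append_Cons_eq_1)

lemma multilinear_2:
  assumes "\<And>i v. v \<in> homog A i \<Longrightarrow> letter_linear A W (\<lambda>x. G x (i, v))"
    and "\<And>i v. v \<in> homog A i \<Longrightarrow> letter_linear A W (G (i, v))"
  shows "multilinear 2 A W (\<lambda>xs. G (xs ! 0) (xs ! 1))"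
  using assms unfolding multilinear_def letter_linear_def
  by (auto simp: words_2_iff append_Cons_eq_2)

section \<open>Concatenation of formal sums of words\<close>

lemma keys_diff_subset: "Poly_Mapping.keys c \<subseteq> S \<Longrightarrow> Poly_Mapping.keys d \<subseteq> S \<Longrightarrow> Poly_Mapping.keys (c - d) \<subseteq> S"
  using keys_diff [of c d] by blast

text \<open>The product of the free associative algebra on the letters, of which
  \<open>tconc\<close> is the descent to classes. Composing two linear extensions makes both
  distributive laws immediate.\<close>

definition conc :: "('x list \<Rightarrow>\<^sub>0 'k::field) \<Rightarrow> ('x list \<Rightarrow>\<^sub>0 'k) \<Rightarrow> ('x list \<Rightarrow>\<^sub>0 'k)" where
  "conc c d = lin_ext (\<lambda>xs. lin_ext (\<lambda>ys. Poly_Mapping.single (xs @ ys) 1) d) c"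

lemma conc_add_left: "conc (c + c') d = conc c d + conc c' d"
  and conc_scale_left: "conc (scale a c) d = scale a (conc c d)"
  and conc_minus_left: "conc (c - c') d = conc c d - conc c' d"
  by (simp_all add: conc_def lin_ext_add lin_ext_scale lin_ext_minus)

lemma conc_add_right: "conc c (d + d') = conc c d + conc c d'"
  and conc_scale_right: "conc c (scale a d) = scale a (conc c d)"
  by (simp_all add: conc_def lin_ext_add lin_ext_scale lin_ext_fun_add lin_ext_fun_scale)

lemma conc_zero [simp]: "conc 0 d = 0" "conc c 0 = 0"
  using conc_scale_right [of c 0 0] by (simp_all add: conc_def scale_simps)

lemma conc_minus_right: "conc c (d - d') = conc c d - conc c d'"
  using conc_add_right [of c d "scale (- 1) d'"]
  by (simp only: conc_scale_right) (simp add: scale_simps)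

lemma conc_single: "conc (Poly_Mapping.single xs a) (Poly_Mapping.single ys b) = Poly_Mapping.single (xs @ ys) (a * b)"
  by (simp add: conc_def scale_simps)

lemma keys_conc:
  assumes "Poly_Mapping.keys c \<subseteq> words p A" "Poly_Mapping.keys d \<subseteq> words q A"
  shows "Poly_Mapping.keys (conc c d) \<subseteq> words (p + q) A"
  unfolding conc_def
  by (intro keys_lin_ext) (use assms in \<open>auto intro: words_append\<close>)

lemma conc_eq_sum:
  "conc c d = (\<Sum>xs\<in>Poly_Mapping.keys c. \<Sum>ys\<in>Poly_Mapping.keys d.
     Poly_Mapping.single (xs @ ys) (Poly_Mapping.lookup c xs * Poly_Mapping.lookup d ys))"
  by (simp add: conc_def lin_ext_def scale_sum scale_simps)

section \<open>Classes of formal sums in tensor powers\<close>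

abbreviation tclass :: "nat \<Rightarrow> ('k::field, 'v) gmodule \<Rightarrow> ((int \<times> 'v) list \<Rightarrow>\<^sub>0 'k) \<Rightarrow> ('k, 'v) tensor" where
  "tclass p A c \<equiv> multilin_rels p A +>\<^bsub>free_words p A\<^esub> c"

lemma pure_eq_tclass: "pure p A xs = tclass p A (Poly_Mapping.single xs 1)"
  by (simp add: pure_def)

lemma field_module_free_words: "field_module (free_words p A)"
  by (simp add: free_words_def field_module_free_gmodule)

lemma carrier_free_words: "carrier (free_words p A) = {c. Poly_Mapping.keys c \<subseteq> words p A}"
  by (simp add: free_words_def)

lemma free_words_simps [simp]:
  "\<zero>\<^bsub>free_words p A\<^esub> = 0" "u \<oplus>\<^bsub>free_words p A\<^esub> v = u + v" "a \<odot>\<^bsub>free_words p A\<^esub> v = scale a v"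
  by (simp_all add: free_words_def)

context graded_module
begin

lemma words_add: "xs @ (i, u) # ys \<in> words p V \<Longrightarrow> v \<in> homog V i \<Longrightarrow> xs @ (i, u \<oplus> v) # ys \<in> words p V"
  and words_smult: "xs @ (i, v) # ys \<in> words p V \<Longrightarrow> xs @ (i, a \<odot> v) # ys \<in> words p V"
  by (auto simp: words_def homog_add homog_smult)

lemma keys_multilin_gens: "r \<in> multilin_gens p V \<Longrightarrow> Poly_Mapping.keys r \<subseteq> words p V"
  unfolding multilin_gens_def
proof (elim UnE CollectE exE conjE)
  fix xs ys :: "(int \<times> 'v) list" and i u v
  assume *: "xs @ (i, u) # ys \<in> words p V" "v \<in> homog V i"
    and r: "r = Poly_Mapping.single (xs @ (i, u \<oplus> v) # ys) 1
        - Poly_Mapping.single (xs @ (i, u) # ys) 1 - Poly_Mapping.single (xs @ (i, v) # ys) 1"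
  note words_letter [OF *] words_add [OF *]
  then show ?thesis
    unfolding r by (intro keys_diff_subset) (use * in simp_all)
next
  fix xs ys :: "(int \<times> 'v) list" and i a v
  assume *: "xs @ (i, v) # ys \<in> words p V"
    and r: "r = Poly_Mapping.single (xs @ (i, a \<odot> v) # ys) 1 - Poly_Mapping.single (xs @ (i, v) # ys) a"
  note words_smult [OF *, of a]
  then show ?thesis
    unfolding r by (intro keys_diff_subset) (use * in simp_all)
qed

lemma ksubspace_multilin_rels: "ksubspace (free_words p V) (multilin_rels p V)"
  unfolding multilin_rels_eq free_words_def
  by (intro ksubspace_kspan keys_multilin_gens)

lemma keys_multilin_rels: "r \<in> multilin_rels p V \<Longrightarrow> Poly_Mapping.keys r \<subseteq> words p V"
  using ksubspaceD(1) [OF ksubspace_multilin_rels] by (simp add: carrier_free_words)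

lemma tpow_eq: "tpow p V = FactModule (sub_gmodule (free_words p V) (carrier (free_words p V))) (multilin_rels p V)"
proof -
  have "sub_gmodule (free_words p V) (carrier (free_words p V)) = free_words p V"
    by (rule field_module.sub_gmodule_carrier [OF field_module_free_words]) (auto simp: free_words_def)
  then show ?thesis by (simp add: tpow_def)
qed

lemma field_module_tpow: "field_module (tpow p V)"
  unfolding tpow_eq
  by (intro field_module.field_module_FactModule field_module_free_words ksubspace_multilin_rels field_module.ksubspace_carrier)

lemma carrier_tpow: "carrier (tpow p V) = tclass p V ` {c. Poly_Mapping.keys c \<subseteq> words p V}"
  by (simp add: tpow_def FactModule_simps carrier_free_words)

lemma klinear_tclass: "klinear (free_words p V) (tpow p V) (tclass p V)"
  using field_module.klinear_coset [OF field_module_free_words field_module.ksubspace_carrier [OF field_module_free_words] ksubspace_multilin_rels, of p]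
  unfolding tpow_eq [symmetric]
  by (simp add: klinear_def)

lemma tclass_closed: "Poly_Mapping.keys c \<subseteq> words p V \<Longrightarrow> tclass p V c \<in> carrier (tpow p V)"
  by (auto simp: carrier_tpow)

lemma tclass_add: "Poly_Mapping.keys c \<subseteq> words p V \<Longrightarrow> Poly_Mapping.keys d \<subseteq> words p V \<Longrightarrow>
    tclass p V (c + d) = tclass p V c \<oplus>\<^bsub>tpow p V\<^esub> tclass p V d"
  and tclass_scale: "Poly_Mapping.keys c \<subseteq> words p V \<Longrightarrow>
    tclass p V (scale a c) = a \<odot>\<^bsub>tpow p V\<^esub> tclass p V c"
  using klinear_tclass [of p] by (simp_all add: klinear_def carrier_free_words)

lemma tclass_eqI:
  assumes "Poly_Mapping.keys d \<subseteq> words p V" "c - d \<in> multilin_rels p V"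
  shows "tclass p V c = tclass p V d"
proof (rule field_module.coset_eqI [OF field_module_free_words ksubspace_multilin_rels])
  show "c \<in> tclass p V d"
    using assms(2) by (auto simp: mem_coset_iff intro!: bexI [of _ "c - d"])
qed (use assms(1) in \<open>simp add: carrier_free_words\<close>)

lemma pure_closed: "xs \<in> words p V \<Longrightarrow> pure p V xs \<in> carrier (tpow p V)"
  by (simp add: pure_eq_tclass tclass_closed)

text \<open>In both equations the difference of the two sides, taken before passing to classes, is a
  generator of the relations.\<close>

lemma multilinear_pure: "multilinear p V (tpow p V) (pure p V)"
  unfolding multilinear_def
proof (intro conjI allI impI)
  show "pure p V \<in> words p V \<rightarrow> carrier (tpow p V)" by (simp add: pure_closed)
next
  fix xs ys :: "(int \<times> 'v) list" and i u v
  assume *: "xs @ (i, u) # ys \<in> words p V \<and> v \<in> homog V i"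
  let ?s = "\<lambda>w. Poly_Mapping.single (xs @ (i, w) # ys) (1::'k)"
  have w: "xs @ (i, u) # ys \<in> words p V" "xs @ (i, v) # ys \<in> words p V" using * words_letter [of xs i u ys p V v] by auto
  have "?s (u \<oplus> v) - ?s u - ?s v \<in> multilin_gens p V"
    using * by (auto simp: multilin_gens_def)
  then have "tclass p V (?s (u \<oplus> v)) = tclass p V (?s u + ?s v)"
    using w by (intro tclass_eqI) (simp_all add: multilin_rels_eq diff_diff_eq
        kspan_base keys_add_subset)
  then show "pure p V (xs @ (i, u \<oplus> v) # ys) = pure p V (xs @ (i, u) # ys) \<oplus>\<^bsub>tpow p V\<^esub> pure p V (xs @ (i, v) # ys)"
    using w by (simp add: pure_eq_tclass tclass_add)
next
  fix xs ys :: "(int \<times> 'v) list" and i a v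
  assume *: "xs @ (i, v) # ys \<in> words p V"
  let ?s = "\<lambda>w. Poly_Mapping.single (xs @ (i, w) # ys)"
  have "?s (a \<odot> v) 1 - ?s v a \<in> multilin_gens p V"
    using * by (auto simp: multilin_gens_def)
  then have "tclass p V (?s (a \<odot> v) 1) = tclass p V (scale a (?s v 1))"
    using * by (intro tclass_eqI) (simp_all add: multilin_rels_eq scale_simps kspan_base)
  then show "pure p V (xs @ (i, a \<odot> v) # ys) = a \<odot>\<^bsub>tpow p V\<^esub> pure p V (xs @ (i, v) # ys)"
    using * by (simp add: pure_eq_tclass tclass_scale)
qed

lemma lsum_multilin_gens:
  assumes W: "field_module W" and F: "multilinear p V W F" and r: "r \<in> multilin_gens p V"
  shows "lsum W F r = \<zero>\<^bsub>W\<^esub>"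
proof -
  interpret W: field_module W by fact
  have Fc: "F \<in> words p V \<rightarrow> carrier W" using F by (simp add: multilinear_def)
  note L = W.klinear_lsum [OF Fc, of wdeg, folded free_words_def]
  have diff: "lsum W F (c - d) = lsum W F c \<ominus>\<^bsub>W\<^esub> lsum W F d"
    if "Poly_Mapping.keys c \<subseteq> words p V" "Poly_Mapping.keys d \<subseteq> words p V" for c d
  proof -
    have e: "c - d = c + scale (- 1) d" by (simp add: scale_simps)
    show ?thesis
      unfolding e
      using W.lsum_add [OF Fc that(1) keys_scale_subset [OF that(2)], of "- 1"]
        W.lsum_scale [OF Fc that(2)] W.lsum_closed [OF Fc that(2)]
      by (simp add: W.smult_uminus_one W.minus_eq)
  qed
  show ?thesis
    using r unfolding multilin_gens_def
  proof (elim UnE CollectE exE conjE)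
    fix xs ys :: "(int \<times> 'v) list" and i u v
    let ?s = "\<lambda>w. Poly_Mapping.single (xs @ (i, w) # ys) (1::'k)"
    assume *: "xs @ (i, u) # ys \<in> words p V" "v \<in> homog V i" and r: "r = ?s (u \<oplus> v) - ?s u - ?s v"
    note w = *(1) words_letter [OF *] words_add [OF *]
    then have c: "F (xs @ (i, u) # ys) \<in> carrier W" "F (xs @ (i, v) # ys) \<in> carrier W"
      "F (xs @ (i, u \<oplus> v) # ys) \<in> carrier W"
      using Fc by auto
    have "lsum W F r = F (xs @ (i, u \<oplus> v) # ys) \<ominus>\<^bsub>W\<^esub> F (xs @ (i, u) # ys) \<ominus>\<^bsub>W\<^esub> F (xs @ (i, v) # ys)"
      unfolding r using w c by (subst diff; (intro keys_diff_subset)?) (simp_all add: diff W.lsum_single)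
    also have "\<dots> = \<zero>\<^bsub>W\<^esub>"
    proof -
      have "F (xs @ (i, u \<oplus> v) # ys) = F (xs @ (i, u) # ys) \<oplus>\<^bsub>W\<^esub> F (xs @ (i, v) # ys)"
        using F * unfolding multilinear_def by blast
      moreover have "x \<oplus>\<^bsub>W\<^esub> y \<ominus>\<^bsub>W\<^esub> x \<ominus>\<^bsub>W\<^esub> y = \<zero>\<^bsub>W\<^esub>" if "x \<in> carrier W" "y \<in> carrier W" for x y
        using that W.a_assoc [of "x \<oplus>\<^bsub>W\<^esub> y" "\<ominus>\<^bsub>W\<^esub> x" "\<ominus>\<^bsub>W\<^esub> y"]
        by (simp add: W.minus_eq W.minus_add [symmetric] W.r_neg)
      ultimately show ?thesis using c by simp
    qed
    finally show ?thesis .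
  next
    fix xs ys :: "(int \<times> 'v) list" and i a v
    let ?s = "\<lambda>w. Poly_Mapping.single (xs @ (i, w) # ys)"
    assume *: "xs @ (i, v) # ys \<in> words p V" and r: "r = ?s (a \<odot> v) 1 - ?s v a"
    note w = words_smult [OF *, of a]
    then have c: "F (xs @ (i, v) # ys) \<in> carrier W" "F (xs @ (i, a \<odot> v) # ys) \<in> carrier W"
      using Fc * by auto
    then show ?thesis
      unfolding r using w * F
      by (subst diff) (auto simp: W.lsum_single multilinear_def W.minus_eq W.r_neg)
  qed
qed

text \<open>\<open>lsum W F\<close> kills every relation, so all representatives r + c contribute
  the same set to the union in \<open>tlift\<close>.\<close>

lemma tlift_tclass:
  assumes W: "field_module W" and F: "multilinear p V W F" and c: "Poly_Mapping.keys c \<subseteq> words p V"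
  shows "tlift W F (tclass p V c) = lsum W F c"
proof -
  interpret W: field_module W by fact
  have Fc: "F \<in> words p V \<rightarrow> carrier W" using F by (simp add: multilinear_def)
  have "lsum W F (r + c) = lsum W F c" if r: "r \<in> multilin_rels p V" for r
  proof -
    have "lsum W F r = \<zero>\<^bsub>W\<^esub>"
    proof (rule kspan_vanish [OF W W.klinear_lsum [OF Fc, of wdeg]])
      show "Poly_Mapping.keys s \<subseteq> words p V \<and> lsum W F s = \<zero>\<^bsub>W\<^esub>" if "s \<in> multilin_gens p V" for s
        using keys_multilin_gens [OF that] lsum_multilin_gens [OF W F that] ..
    qed (use r in \<open>simp add: multilin_rels_eq\<close>)
    then show ?thesis
      using W.lsum_add [OF Fc keys_multilin_rels [OF r] c] W.lsum_closed [OF Fc c] by simp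
  qed
  then have "(\<Union>r\<in>multilin_rels p V. lsum W F (r + c)) = (\<Union>r\<in>multilin_rels p V. lsum W F c)"
    by (intro SUP_cong) simp_all
  moreover have "tlift W F (tclass p V c) = (\<Union>r\<in>multilin_rels p V. lsum W F (r + c))"
    by (simp add: tlift_def lsum_def a_r_coset_def')
  \<comment> \<open>A union of equal sets is their common value only over a nonempty index set;
    otherwise it would be empty.\<close>
  moreover have "multilin_rels p V \<noteq> {}"
    using kspan_zero unfolding multilin_rels_eq by blast
  ultimately show ?thesis
    by (simp only: UN_constant if_False)
qed

text \<open>Appending a word lengthens only the part behind the varied letter, so the result has
  again the form of a generator.\<close>

lemma conc_multilin_gens_left:
  assumes r: "r \<in> multilin_gens p V" and ys: "ys \<in> words q V"
  shows "conc r (Poly_Mapping.single ys 1) \<in> multilin_gens (p + q) V"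
  using r [unfolded multilin_gens_def]
proof (elim UnE CollectE exE conjE)
  fix xs zs :: "(int \<times> 'v) list" and i u v
  let ?s = "\<lambda>w. Poly_Mapping.single (xs @ (i, w) # zs) (1::'k)"
  let ?t = "\<lambda>w. Poly_Mapping.single (xs @ (i, w) # zs @ ys) (1::'k)"
  assume "xs @ (i, u) # zs \<in> words p V" "v \<in> homog V i" "r = ?s (u \<oplus> v) - ?s u - ?s v"
  moreover from this have "xs @ (i, u) # zs @ ys \<in> words (p + q) V"
    using words_append [OF _ ys] by fastforce
  moreover have "conc (?s (u \<oplus> v) - ?s u - ?s v) (Poly_Mapping.single ys 1) = ?t (u \<oplus> v) - ?t u - ?t v"
    by (simp add: conc_minus_left conc_single)
  ultimately show ?thesis
    unfolding multilin_gens_def by blast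
next
  fix xs zs :: "(int \<times> 'v) list" and i a v
  let ?s = "\<lambda>w. Poly_Mapping.single (xs @ (i, w) # zs)"
  let ?t = "\<lambda>w. Poly_Mapping.single (xs @ (i, w) # zs @ ys)"
  assume "xs @ (i, v) # zs \<in> words p V" "r = ?s (a \<odot> v) 1 - ?s v a"
  moreover from this have "xs @ (i, v) # zs @ ys \<in> words (p + q) V"
    using words_append [OF _ ys] by fastforce
  moreover have "conc (?s (a \<odot> v) 1 - ?s v a) (Poly_Mapping.single ys 1) = ?t (a \<odot> v) 1 - ?t v a"
    by (simp add: conc_minus_left conc_single)
  ultimately show ?thesis
    unfolding multilin_gens_def by blast
qed

lemma conc_multilin_gens_right:
  assumes r: "r \<in> multilin_gens q V" and xs: "xs \<in> words p V"
  shows "conc (Poly_Mapping.single xs 1) r \<in> multilin_gens (p + q) V"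
  using r [unfolded multilin_gens_def]
proof (elim UnE CollectE exE conjE)
  fix ys zs :: "(int \<times> 'v) list" and i u v
  let ?s = "\<lambda>w. Poly_Mapping.single (ys @ (i, w) # zs) (1::'k)"
  let ?t = "\<lambda>w. Poly_Mapping.single ((xs @ ys) @ (i, w) # zs) (1::'k)"
  assume "ys @ (i, u) # zs \<in> words q V" "v \<in> homog V i" "r = ?s (u \<oplus> v) - ?s u - ?s v"
  moreover from this have "(xs @ ys) @ (i, u) # zs \<in> words (p + q) V"
    using words_append [OF xs] by fastforce
  moreover have "conc (Poly_Mapping.single xs 1) (?s (u \<oplus> v) - ?s u - ?s v) = ?t (u \<oplus> v) - ?t u - ?t v"
    by (simp add: conc_minus_right conc_single)
  ultimately show ?thesis
    unfolding multilin_gens_def by blast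
next
  fix ys zs :: "(int \<times> 'v) list" and i a v
  let ?s = "\<lambda>w. Poly_Mapping.single (ys @ (i, w) # zs)"
  let ?t = "\<lambda>w. Poly_Mapping.single ((xs @ ys) @ (i, w) # zs)"
  assume "ys @ (i, v) # zs \<in> words q V" "r = ?s (a \<odot> v) 1 - ?s v a"
  moreover from this have "(xs @ ys) @ (i, v) # zs \<in> words (p + q) V"
    using words_append [OF xs] by fastforce
  moreover have "conc (Poly_Mapping.single xs 1) (?s (a \<odot> v) 1 - ?s v a) = ?t (a \<odot> v) 1 - ?t v a"
    by (simp add: conc_minus_right conc_single)
  ultimately show ?thesis
    unfolding multilin_gens_def by blast
qed

text \<open>Half of the fact that the relations form a two-sided ideal under concatenation.
  Bilinearity reduces it to a generator against a word: the outer induction splits d, the span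
  argument splits r.\<close>

lemma conc_multilin_rels_left:
  assumes r: "r \<in> multilin_rels p V" and d: "Poly_Mapping.keys d \<subseteq> words q V"
  shows "conc r d \<in> multilin_rels (p + q) V"
  using d
proof (induction rule: poly_mapping_span_induct)
  case (add ys a d)
  have "conc r (Poly_Mapping.single ys 1) \<in> multilin_rels (p + q) V"
    unfolding multilin_rels_eq
    by (rule kspan_linear_image
        [where f = "\<lambda>r. conc r (Poly_Mapping.single ys 1)", OF conc_add_left conc_scale_left _ r [unfolded multilin_rels_eq]])
      (intro kspan_base conc_multilin_gens_left add(1))
  then have "scale a (conc r (Poly_Mapping.single ys 1)) \<in> multilin_rels (p + q) V"
    by (simp add: multilin_rels_eq kspan_scale)
  then show ?case
    using add(3) unfolding conc_scale_right [symmetric]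
    by (simp add: conc_add_right multilin_rels_eq kspan_plus scale_simps)
qed (simp add: multilin_rels_eq kspan_zero)

lemma conc_multilin_rels_right:
  assumes r: "r \<in> multilin_rels q V" and c: "Poly_Mapping.keys c \<subseteq> words p V"
  shows "conc c r \<in> multilin_rels (p + q) V"
  using c
proof (induction rule: poly_mapping_span_induct)
  case (add xs a c)
  have "conc (Poly_Mapping.single xs 1) r \<in> multilin_rels (p + q) V"
    unfolding multilin_rels_eq
    by (rule kspan_linear_image
        [where f = "conc (Poly_Mapping.single xs 1)", OF conc_add_right conc_scale_right _ r [unfolded multilin_rels_eq]])
      (intro kspan_base conc_multilin_gens_right add(1))
  then have "scale a (conc (Poly_Mapping.single xs 1) r) \<in> multilin_rels (p + q) V"
    by (simp add: multilin_rels_eq kspan_scale)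
  then show ?case
    using add(3) unfolding conc_scale_left [symmetric]
    by (simp add: conc_add_left multilin_rels_eq kspan_plus scale_simps)
qed (simp add: multilin_rels_eq kspan_zero)

lemma tconc_tclass:
  assumes c: "Poly_Mapping.keys c \<subseteq> words p V" and d: "Poly_Mapping.keys d \<subseteq> words q V"
  shows "tconc p q V (tclass p V c) (tclass q V d) = tclass (p + q) V (conc c d)"
proof -
  have "tclass (p + q) V (conc (r + c) (s + d)) = tclass (p + q) V (conc c d)"
    if r: "r \<in> multilin_rels p V" and s: "s \<in> multilin_rels q V" for r s
  proof (rule tclass_eqI [OF keys_conc [OF c d]])
    have "Poly_Mapping.keys (s + d) \<subseteq> words q V" using keys_multilin_rels [OF s] d by (rule keys_add_subset)
    \<comment> \<open>Replacing c, d by r + c, s + d changes the concatenation by exactly this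
      sum.\<close>
    then have "conc r (s + d) + conc c s \<in> multilin_rels (p + q) V"
      using conc_multilin_rels_left [OF r] conc_multilin_rels_right [OF s c]
      by (simp add: multilin_rels_eq kspan_plus)
    then show "conc (r + c) (s + d) - conc c d \<in> multilin_rels (p + q) V"
      by (simp add: conc_add_left conc_add_right algebra_simps)
  qed
  moreover have "tconc p q V (tclass p V c) (tclass q V d) =
      (\<Union>r\<in>multilin_rels p V. \<Union>s\<in>multilin_rels q V. tclass (p + q) V (conc (r + c) (s + d)))"
    by (simp add: tconc_def conc_eq_sum a_r_coset_def')
  moreover have "multilin_rels p V \<noteq> {}" "multilin_rels q V \<noteq> {}"
    using kspan_zero unfolding multilin_rels_eq by blast+
  ultimately show ?thesis by (simp cong: SUP_cong)
qed

lemma klinear_tconc_right: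
  assumes "s \<in> carrier (tpow p V)"
  shows "klinear (tpow q V) (tpow (p + q) V) (tconc p q V s)"
  unfolding klinear_def carrier_tpow [of q]
  using assms
  by (auto simp: carrier_tpow [of p] tconc_tclass tclass_add [symmetric] tclass_scale [symmetric]
      keys_conc conc_add_right conc_scale_right keys_add_subset keys_scale_subset tclass_closed)

lemma klinear_tconc_left:
  assumes "t \<in> carrier (tpow q V)"
  shows "klinear (tpow p V) (tpow (p + q) V) (\<lambda>s. tconc p q V s t)"
  unfolding klinear_def carrier_tpow [of p]
  using assms
  by (auto simp: carrier_tpow [of q] tconc_tclass tclass_add [symmetric] tclass_scale [symmetric]
      keys_conc conc_add_left conc_scale_left keys_add_subset keys_scale_subset tclass_closed)

end

section \<open>Infinitesimal coproducts\<close>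

lemma glinear_imp_klinear: "glinear V W d f \<Longrightarrow> klinear V W f"
  by (auto simp: glinear_def klinear_def)

text \<open>A Fubini rule. Form (1), with the sum over the second factor inside, is suited to 1
  \<otimes> \<lambda>, where the coproduct acts on the second factor; form (2) is suited to
  \<lambda> \<otimes> 1.\<close>

lemma (in field_module) lsum_conc:
  fixes c d :: "(int \<times> 'w) list \<Rightarrow>\<^sub>0 'k"
  assumes F: "F \<in> words (p + q) A \<rightarrow> carrier V"
    and c: "Poly_Mapping.keys c \<subseteq> words p A" and d: "Poly_Mapping.keys d \<subseteq> words q A"
  shows "lsum V F (conc c d) = lsum V (\<lambda>xs. lsum V (\<lambda>ys. F (xs @ ys)) d) c"
    and "lsum V F (conc c d) = lsum V (\<lambda>ys. lsum V (\<lambda>xs. F (xs @ ys)) c) d"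
proof -
  have F': "F (xs @ ys) \<in> carrier V" if "xs \<in> words p A" "ys \<in> words q A" for xs ys
    using F words_append [OF that] by auto
  note kl = klinear_lsum [OF F, of wdeg]
  note vs = field_module_free_gmodule field_module_axioms
  note dist = lsum_klinear [OF field_module_free_gmodule field_module_axioms kl]
  let ?W = "free_gmodule (words (p + q) A) wdeg"
  \<comment> \<open>Writing the concatenation itself as an \<open>lsum\<close> in the free space
    lets the linear map \<open>lsum V F\<close> be moved inside by
    \<open>lsum_klinear\<close>.\<close>
  have lin_left: "conc c d = lsum ?W (\<lambda>xs. conc (Poly_Mapping.single xs 1) d) c"
    if "Poly_Mapping.keys c \<subseteq> words p A" "Poly_Mapping.keys d \<subseteq> words q A" for c d :: "(int \<times> 'w) list \<Rightarrow>\<^sub>0 'k"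
    using that(1)
  proof (induction rule: poly_mapping_span_induct)
    case zero
    show ?case using field_module.lsum_zero [OF field_module_free_gmodule, of "words (p + q) A" wdeg] by simp
  next
    case (add x a c)
    let ?G = "\<lambda>xs. conc (Poly_Mapping.single xs 1) d"
    have G: "?G \<in> words p A \<rightarrow> carrier ?W"
      using that(2) by (simp add: keys_conc)
    show ?case
      using field_module.lsum_add [OF field_module_free_gmodule G _ add(2), of "Poly_Mapping.single x a"] add
        field_module.lsum_single [OF field_module_free_gmodule, of ?G x "words (p + q) A" wdeg a] G
      by (simp add: conc_add_left conc_scale_left [symmetric] scale_simps Pi_iff)
  qed
  have lin_right: "conc c d = lsum ?W (\<lambda>ys. conc c (Poly_Mapping.single ys 1)) d"
    if "Poly_Mapping.keys c \<subseteq> words p A" "Poly_Mapping.keys d \<subseteq> words q A" for c d :: "(int \<times> 'w) list \<Rightarrow>\<^sub>0 'k"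
    using that(2)
  proof (induction rule: poly_mapping_span_induct)
    case zero
    show ?case using field_module.lsum_zero [OF field_module_free_gmodule, of "words (p + q) A" wdeg] by simp
  next
    case (add y a d)
    let ?G = "\<lambda>ys. conc c (Poly_Mapping.single ys 1)"
    have G: "?G \<in> words q A \<rightarrow> carrier ?W"
      using that(1) by (simp add: keys_conc)
    show ?case
      using field_module.lsum_add [OF field_module_free_gmodule G _ add(2), of "Poly_Mapping.single y a"] add
        field_module.lsum_single [OF field_module_free_gmodule, of ?G y "words (p + q) A" wdeg a] G
      by (simp add: conc_add_right conc_scale_right [symmetric] scale_simps Pi_iff)
  qed
  have L: "lsum V F (conc c d) = lsum V (\<lambda>xs. lsum V F (conc (Poly_Mapping.single xs 1) d)) c"
    if "Poly_Mapping.keys c \<subseteq> words p A" "Poly_Mapping.keys d \<subseteq> words q A" for c d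
    unfolding lin_left [OF that]
    by (rule dist [OF _ that(1)]) (use that in \<open>simp add: keys_conc\<close>)
  have R: "lsum V F (conc c d) = lsum V (\<lambda>ys. lsum V F (conc c (Poly_Mapping.single ys 1))) d"
    if "Poly_Mapping.keys c \<subseteq> words p A" "Poly_Mapping.keys d \<subseteq> words q A" for c d
    unfolding lin_right [OF that]
    by (rule dist [OF _ that(2)]) (use that in \<open>simp add: keys_conc\<close>)
  have s: "Poly_Mapping.keys (Poly_Mapping.single xs (1::'k)) \<subseteq> words p A" if "xs \<in> words p A" for p xs
    using that by simp
  have ss: "lsum V F (conc (Poly_Mapping.single xs 1) (Poly_Mapping.single ys 1)) = F (xs @ ys)"
    if "xs \<in> words p A" "ys \<in> words q A" for xs ys
    using F' [OF that] by (simp add: conc_single lsum_single)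
  show "lsum V F (conc c d) = lsum V (\<lambda>xs. lsum V (\<lambda>ys. F (xs @ ys)) d) c"
    unfolding L [OF c d]
  proof (rule lsum_cong [OF _ _ c])
    show "lsum V F (conc (Poly_Mapping.single xs 1) d) = lsum V (\<lambda>ys. F (xs @ ys)) d"
      if "xs \<in> words p A" for xs
      unfolding R [OF s [OF that] d]
      by (rule lsum_cong [OF _ _ d]) (simp_all add: ss that F')
  qed (auto intro!: lsum_closed [OF _ d] F')
  show "lsum V F (conc c d) = lsum V (\<lambda>ys. lsum V (\<lambda>xs. F (xs @ ys)) c) d"
    unfolding R [OF c d]
  proof (rule lsum_cong [OF _ _ d])
    show "lsum V F (conc c (Poly_Mapping.single ys 1)) = lsum V (\<lambda>xs. F (xs @ ys)) c"
      if "ys \<in> words q A" for ys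
      unfolding L [OF c s [OF that]]
      by (rule lsum_cong [OF _ _ c]) (simp_all add: ss that F')
  qed (auto intro!: lsum_closed [OF _ c] F')
qed

text \<open>Letters are homogeneous, so an arbitrary element of V enters a tensor power as a formal
  sum of one-letter words with this value.\<close>

definition eval_word :: "('k::field, 'v) gmodule \<Rightarrow> ((int \<times> 'v) list \<Rightarrow>\<^sub>0 'k) \<Rightarrow> 'v" where
  "eval_word V c = lsum V (\<lambda>xs. snd (xs ! 0)) c"

lemma tmap_of_coproduct_simps:
  "src (tmap_of_coproduct A d l) = 1" "tgt (tmap_of_coproduct A d l) = 2" "tdeg (tmap_of_coproduct A d l) = d"
  by (simp_all add: tmap_of_coproduct_def)

lemma tmap_of_unit_simps:
  "src (tmap_of_unit A u) = 0" "tgt (tmap_of_unit A u) = 1" "tdeg (tmap_of_unit A u) = 0"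
  by (simp_all add: tmap_of_unit_def)

lemma tcomp_simps:
  "src (tcomp g f) = src f" "tgt (tcomp g f) = tgt g" "tdeg (tcomp g f) = tdeg g + tdeg f"
  "app (tcomp g f) t = app g (app f t)"
  by (simp_all add: tcomp_def)

lemma take_drop_word: "take 1 (x # xs) = [x]" "drop 1 (x # xs) = xs"
  by (simp_all add: One_nat_def)

lemma nth_word: "(x # xs) ! 0 = x" "(x # y # xs) ! 1 = y"
  by (simp_all add: One_nat_def)

lemma wdeg_single: "wdeg [x] = fst x"
  by (simp add: wdeg_def)

lemma ksign_zero: "ksign 0 = 1"
  by (simp add: ksign_def)

section \<open>One-letter words and linearity in a single letter\<close>

context graded_module
begin

text \<open>The function inside \<open>ttensor\<close> is written with \<open>take\<close>,
  \<open>drop\<close> and pure tensors. This replaces it by its simplified form on actual words, for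
  which multilinearity can be verified slot by slot.\<close>

lemma tlift_tclass_cong:
  assumes W: "field_module W" and F: "multilinear p V W F" and H: "\<And>xs. xs \<in> words p V \<Longrightarrow> H xs = F xs"
    and c: "Poly_Mapping.keys c \<subseteq> words p V"
  shows "tlift W H (tclass p V c) = lsum W F c"
proof -
  have Fc: "F \<in> words p V \<rightarrow> carrier W" using F by (simp add: multilinear_def)
  have "multilinear p V W H"
    unfolding multilinear_def
  proof (intro conjI allI impI)
    show "H \<in> words p V \<rightarrow> carrier W" using Fc H by auto
    show "H (xs @ (i, u \<oplus> v) # ys) = H (xs @ (i, u) # ys) \<oplus>\<^bsub>W\<^esub> H (xs @ (i, v) # ys)"
      if "xs @ (i, u) # ys \<in> words p V \<and> v \<in> homog V i" for xs ys i u v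
    proof -
      note w = that [THEN conjunct1] that [THEN conjunct2]
      show ?thesis
        using F w unfolding multilinear_def H [OF w(1)] H [OF words_letter [OF w]] H [OF words_add [OF w]] by blast
    qed
    show "H (xs @ (i, a \<odot> v) # ys) = a \<odot>\<^bsub>W\<^esub> H (xs @ (i, v) # ys)"
      if "xs @ (i, v) # ys \<in> words p V" for xs ys i a v
      using F that unfolding multilinear_def H [OF that] H [OF words_smult [OF that]] by blast
  qed
  then show ?thesis
    using field_module.lsum_cong [OF W H Fc c] by (simp add: tlift_tclass [OF W _ c])
qed

lemma snd_nth_closed: "(\<lambda>xs. snd (xs ! 0)) \<in> words 1 V \<rightarrow> carrier V"
  using homog_carrier by (fastforce simp: words_1_iff)

text \<open>A homogeneous element is the value of a single one-letter word, and homogeneous elements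
  span. This is the decomposition into homogeneous components in the uniqueness argument.\<close>

lemma eval_word_surj:
  assumes "v \<in> carrier V"
  shows "\<exists>c. Poly_Mapping.keys c \<subseteq> words 1 V \<and> eval_word V c = v"
  using assms
proof (rule homog_induct)
  show "\<exists>c. Poly_Mapping.keys c \<subseteq> words 1 V \<and> eval_word V c = \<zero>"
    by (intro exI [of _ 0]) (simp add: eval_word_def)
  show "\<exists>c. Poly_Mapping.keys c \<subseteq> words 1 V \<and> eval_word V c = v" if "v \<in> homog V i" for i v
    using that homog_carrier [OF that]
    by (intro exI [of _ "Poly_Mapping.single [(i, v)] 1"]) (simp add: eval_word_def lsum_single words_1_iff)
  show "\<exists>c. Poly_Mapping.keys c \<subseteq> words 1 V \<and> eval_word V c = u \<oplus> v"
    if "\<exists>c. Poly_Mapping.keys c \<subseteq> words 1 V \<and> eval_word V c = u"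
      "\<exists>c. Poly_Mapping.keys c \<subseteq> words 1 V \<and> eval_word V c = v" for u v
    using that lsum_add [OF snd_nth_closed] keys_add_subset unfolding eval_word_def by blast
qed

lemma eval_word_closed: "Poly_Mapping.keys c \<subseteq> words 1 V \<Longrightarrow> eval_word V c \<in> carrier V"
  unfolding eval_word_def by (rule lsum_closed [OF snd_nth_closed])

lemma letter_linear_pure: "letter_linear V (tpow 1 V) (\<lambda>x. pure 1 V [x])"
  using multilinear_pure [of 1]
  unfolding multilinear_def letter_linear_def
  by (auto simp: words_1_iff append_Cons_eq_1 Pi_iff)

text \<open>The Koszul sign depends only on the degree tag, which is the same for letters that are
  added; within one degree it is a constant scalar.\<close>

lemma letter_linear_tensor_left:
  assumes t: "t \<in> carrier (tpow q V)"
  shows "letter_linear V (tpow (1 + q) V) (\<lambda>x. ksign (d * fst x) \<odot>\<^bsub>tpow (1 + q) V\<^esub> tconc 1 q V (pure 1 V [x]) t)"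
  using letter_linear_pure klinear_smult [OF field_module_tpow klinear_tconc_left [OF t, of 1]]
  unfolding letter_linear_def klinear_def Pi_iff by simp

lemma letter_linear_klinear:
  assumes "letter_linear V W G" "klinear W U h"
  shows "letter_linear V U (\<lambda>x. h (G x))"
  using assms unfolding letter_linear_def klinear_def Pi_iff by simp

lemma letter_linear_snd: "letter_linear V V snd"
  by (simp add: letter_linear_def homog_carrier)

end

section \<open>Evaluation of the structure maps of an algebra on words\<close>

locale graded_algebra = graded_module V for V :: "('k::field, 'v) gmodule" (structure) +
  fixes m :: "'v \<Rightarrow> 'v \<Rightarrow> 'v"
  assumes gbilinear: "gbilinear V m"
begin

lemma klinear_mult: "u \<in> carrier V \<Longrightarrow> klinear V V (m u)" "u \<in> carrier V \<Longrightarrow> klinear V V (\<lambda>v. m v u)"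
  using gbilinear by (auto simp: gbilinear_def klinear_def)

lemma mult_closed: "u \<in> carrier V \<Longrightarrow> v \<in> carrier V \<Longrightarrow> m u v \<in> carrier V"
  using gbilinear by (simp add: gbilinear_def)

lemma lsum_mult_conc:
  assumes c: "Poly_Mapping.keys c \<subseteq> words 1 V" and d: "Poly_Mapping.keys d \<subseteq> words 1 V"
  shows "lsum V (\<lambda>xs. m (snd (xs ! 0)) (snd (xs ! 1))) (conc c d) = m (eval_word V c) (eval_word V d)"
proof -
  let ?F = "\<lambda>xs. m (snd (xs ! 0)) (snd (xs ! 1))"
  have F: "?F \<in> words (1 + 1) V \<rightarrow> carrier V"
    by (auto simp: words_2_iff mult_closed homog_carrier)
  have "lsum V ?F (conc c d) = lsum V (\<lambda>xs. lsum V (\<lambda>ys. ?F (xs @ ys)) d) c"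
    by (rule lsum_conc(1) [OF F c d])
  also have "\<dots> = lsum V (\<lambda>xs. m (snd (xs ! 0)) (eval_word V d)) c"
  proof (rule lsum_cong [OF _ _ c])
    fix xs assume xs: "xs \<in> words 1 V"
    then have s: "snd (xs ! 0) \<in> carrier V" using snd_nth_closed by auto
    have "lsum V (\<lambda>ys. ?F (xs @ ys)) d = lsum V (\<lambda>ys. m (snd (xs ! 0)) (snd (ys ! 0))) d"
      using xs s
      by (intro lsum_cong [OF _ _ d]) (auto simp: words_1_iff mult_closed homog_carrier)
    then show "lsum V (\<lambda>ys. ?F (xs @ ys)) d = m (snd (xs ! 0)) (eval_word V d)"
      unfolding eval_word_def
      by (simp add: lsum_klinear [OF field_module_axioms field_module_axioms klinear_mult(1) [OF s] snd_nth_closed d])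
  qed (auto simp: words_1_iff homog_carrier mult_closed eval_word_closed [OF d])
  also have "\<dots> = m (eval_word V c) (eval_word V d)"
    unfolding eval_word_def [of _ c]
    by (simp add: lsum_klinear [OF field_module_axioms field_module_axioms klinear_mult(2) [OF eval_word_closed [OF d]] snd_nth_closed c])
  finally show ?thesis .
qed

lemma app_coproduct:
  assumes l: "klinear V (tpow 2 V) l" and c: "Poly_Mapping.keys c \<subseteq> words 1 V"
  shows "app (tmap_of_coproduct V d l) (tclass 1 V c) = l (eval_word V c)"
proof -
  have "multilinear 1 V (tpow 2 V) (\<lambda>xs. l (snd (xs ! 0)))"
    using multilinear_1 [OF letter_linear_klinear [OF letter_linear_snd l]] by simp
  then have "app (tmap_of_coproduct V d l) (tclass 1 V c) = lsum (tpow 2 V) (\<lambda>xs. l (snd (xs ! 0))) c"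
    unfolding tmap_of_coproduct_def by (simp add: tlift_tclass [OF field_module_tpow] c)
  then show ?thesis
    unfolding eval_word_def
    by (simp add: lsum_klinear [OF field_module_axioms field_module_tpow l snd_nth_closed c])
qed

lemma app_coproduct_pure:
  assumes "klinear V (tpow 2 V) l" and "v \<in> homog V i"
  shows "app (tmap_of_coproduct V d l) (pure 1 V [(i, v)]) = l v"
  using app_coproduct [OF assms(1), of "Poly_Mapping.single [(i, v)] 1" d] assms(2)
  by (simp add: pure_eq_tclass words_1_iff eval_word_def lsum_single homog_carrier)

text \<open>The coproduct of a class in \<open>tpow 1 V\<close> is computed from a representative,
  so the product is needed with an explicit one: e multiplies the two letters of every word in c and
  adds their degree tags.\<close>

lemma app_product:
  assumes c: "Poly_Mapping.keys c \<subseteq> words 2 V"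
  shows "\<exists>e. Poly_Mapping.keys e \<subseteq> words 1 V \<and> app (tmap_of_product V m) (tclass 2 V c) = tclass 1 V e \<and>
    eval_word V e = lsum V (\<lambda>xs. m (snd (xs ! 0)) (snd (xs ! 1))) c"
proof -
  let ?x = "\<lambda>x y. (fst x + fst y, m (snd x) (snd y))"
  let ?s = "\<lambda>xs. Poly_Mapping.single [?x (xs ! 0) (xs ! 1)] (1::'k)"
  let ?e = "lsum (free_words 1 V) ?s c"
  have h: "m u v \<in> homog V (i + j)" if "u \<in> homog V i" "v \<in> homog V j" for u v i j
    using gbilinear that by (simp add: gbilinear_def)
  have s: "?s \<in> words 2 V \<rightarrow> carrier (free_words 1 V)"
    by (auto simp: words_2_iff words_1_iff carrier_free_words h)
  have "letter_linear V (tpow 1 V) (\<lambda>x. pure 1 V [?x x (j, v)])"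
    "letter_linear V (tpow 1 V) (\<lambda>x. pure 1 V [?x (j, v) x])" if "v \<in> homog V j" for j v
    using letter_linear_pure klinear_mult [OF homog_carrier [OF that]] h that homog_carrier
    by (auto simp: letter_linear_def klinear_def)
  then have "multilinear 2 V (tpow 1 V) (\<lambda>xs. pure 1 V [?x (xs ! 0) (xs ! 1)])"
    by (rule multilinear_2 [where G = "\<lambda>x y. pure 1 V [?x x y]"])
  then have "app (tmap_of_product V m) (tclass 2 V c) = lsum (tpow 1 V) (\<lambda>xs. pure 1 V [?x (xs ! 0) (xs ! 1)]) c"
    unfolding tmap_of_product_def by (simp add: tlift_tclass [OF field_module_tpow] c)
  also have "\<dots> = tclass 1 V ?e"
    unfolding pure_eq_tclass
    by (rule lsum_klinear [OF field_module_free_words field_module_tpow klinear_tclass s c, symmetric])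
  finally have 1: "app (tmap_of_product V m) (tclass 2 V c) = tclass 1 V ?e" .
  have "eval_word V ?e = lsum V (\<lambda>xs. eval_word V (?s xs)) c"
    unfolding eval_word_def
    by (rule lsum_klinear [OF field_module_free_words field_module_axioms _ s c])
      (simp add: free_words_def klinear_lsum [OF snd_nth_closed])
  also have "\<dots> = lsum V (\<lambda>xs. m (snd (xs ! 0)) (snd (xs ! 1))) c"
    by (rule lsum_cong [OF _ _ c])
      (auto simp: words_2_iff eval_word_def homog_carrier lsum_single mult_closed)
  finally show ?thesis
    using 1 field_module.lsum_closed [OF field_module_free_words s c] by (auto simp: carrier_free_words)
qed

lemma app_coproduct_product:
  assumes l: "klinear V (tpow 2 V) l"
    and c: "Poly_Mapping.keys c \<subseteq> words 1 V" and e: "Poly_Mapping.keys e \<subseteq> words 1 V"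
  shows "app (tcomp (tmap_of_coproduct V d l) (tmap_of_product V m)) (tclass 2 V (conc c e))
    = l (m (eval_word V c) (eval_word V e))"
proof -
  have "Poly_Mapping.keys (conc c e) \<subseteq> words 2 V"
    using keys_conc [OF c e] by simp
  from app_product [OF this] show ?thesis
    using app_coproduct [OF l] by (auto simp: tcomp_def lsum_mult_conc [OF c e, simplified])
qed

text \<open>The sign involves the first letter alone, so the sum over the letters of e can be done
  first, and linearity of l and of \<open>tconc\<close> collects them into
  \<open>eval_word V e\<close>. Thus l occurs only through one value, even if that element is
  inhomogeneous.\<close>

lemma app_id_tensor_coproduct:
  assumes l: "klinear V (tpow 2 V) l"
    and c: "Poly_Mapping.keys c \<subseteq> words 1 V" and e: "Poly_Mapping.keys e \<subseteq> words 1 V"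
  shows "app (ttensor V V tid (tmap_of_coproduct V d l)) (tclass 2 V (conc c e)) =
    lsum (tpow 3 V) (\<lambda>xs. ksign (d * fst (xs ! 0)) \<odot>\<^bsub>tpow 3 V\<^esub> tconc 1 2 V (pure 1 V xs) (l (eval_word V e))) c"
proof -
  interpret T: field_module "tpow 3 V" by (rule field_module_tpow)
  have lc: "l v \<in> carrier (tpow 2 V)" if "v \<in> carrier V" for v
    using l that by (auto simp: klinear_def)
  let ?G = "\<lambda>(x :: int \<times> 'v) (y :: int \<times> 'v). ksign (d * fst x) \<odot>\<^bsub>tpow 3 V\<^esub> tconc 1 2 V (pure 1 V [x]) (l (snd y))"
  let ?F = "\<lambda>xs. ?G (xs ! 0) (xs ! 1)"
  have left: "letter_linear V (tpow 3 V) (\<lambda>x. ?G x (j, v))" if "v \<in> homog V j" for j v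
    using letter_linear_tensor_left [OF lc [OF homog_carrier [OF that]], of d] by simp
  have kl: "klinear V (tpow 3 V) (\<lambda>v. ksign (d * i) \<odot>\<^bsub>tpow 3 V\<^esub> tconc 1 2 V (pure 1 V [(i, u)]) (l v))"
    if "u \<in> homog V i" for i u
  proof (rule klinear_compose [OF l])
    show "klinear (tpow 2 V) (tpow 3 V) (\<lambda>t. ksign (d * i) \<odot>\<^bsub>tpow 3 V\<^esub> tconc 1 2 V (pure 1 V [(i, u)]) t)"
      using klinear_smult [OF field_module_tpow klinear_tconc_right [OF pure_closed [of "[(i, u)]" 1], of 2]] that
      by (simp add: words_1_iff)
  qed
  have right: "letter_linear V (tpow 3 V) (?G (i, u))" if "u \<in> homog V i" for i u
    using letter_linear_klinear [OF letter_linear_snd kl [OF that]] by simp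
  have ml: "multilinear 2 V (tpow 3 V) ?F"
    by (rule multilinear_2 [OF left right])
  then have F: "?F \<in> words 2 V \<rightarrow> carrier (tpow 3 V)" by (simp add: multilinear_def)
  have k: "Poly_Mapping.keys (conc c e) \<subseteq> words 2 V" using keys_conc [OF c e] by simp
  have "app (ttensor V V tid (tmap_of_coproduct V d l)) (tclass 2 V (conc c e)) = lsum (tpow 3 V) ?F (conc c e)"
    unfolding ttensor_def
    by (simp add: tid_def tmap_of_coproduct_simps, rule tlift_tclass_cong [OF field_module_tpow ml _ k])
      (auto simp only: words_2_iff take_drop_word wdeg_single nth_word app_coproduct_pure [OF l] fst_conv snd_conv)
  also have "\<dots> = lsum (tpow 3 V) (\<lambda>xs. lsum (tpow 3 V) (\<lambda>ys. ?F (xs @ ys)) e) c"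
    using F by (intro T.lsum_conc(1) [OF _ c e]) simp
  also have "\<dots> = lsum (tpow 3 V) (\<lambda>xs. ksign (d * fst (xs ! 0)) \<odot>\<^bsub>tpow 3 V\<^esub> tconc 1 2 V (pure 1 V xs) (l (eval_word V e))) c"
  proof (rule T.lsum_cong [OF _ _ c])
    fix xs assume "xs \<in> words 1 V"
    then obtain i u where xs: "xs = [(i, u)]" and u: "u \<in> homog V i" by (auto simp: words_1_iff)
    have "lsum (tpow 3 V) (\<lambda>ys. ?F (xs @ ys)) e = lsum (tpow 3 V) (\<lambda>ys. ?G (i, u) (ys ! 0)) e"
      unfolding xs by simp
    \<comment> \<open>The tag 0 is a dummy: \<open>?G\<close> reads only the second component of its
      second argument.\<close>
    also have "\<dots> = ?G (i, u) (0, eval_word V e)"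
      using lsum_klinear [OF field_module_axioms field_module_tpow kl [OF u] snd_nth_closed e] by (simp add: eval_word_def)
    finally show "lsum (tpow 3 V) (\<lambda>ys. ?F (xs @ ys)) e =
        ksign (d * fst (xs ! 0)) \<odot>\<^bsub>tpow 3 V\<^esub> tconc 1 2 V (pure 1 V xs) (l (eval_word V e))"
      by (simp add: xs)
  next
    show "(\<lambda>xs. ksign (d * fst (xs ! 0)) \<odot>\<^bsub>tpow 3 V\<^esub> tconc 1 2 V (pure 1 V xs) (l (eval_word V e)))
        \<in> words 1 V \<rightarrow> carrier (tpow 3 V)"
      using kl eval_word_closed [OF e] by (auto simp: words_1_iff klinear_def Pi_iff)
  qed
  finally show ?thesis .
qed

text \<open>Here the right factor is the identity, of degree 0, so there is no sign, and the letters
  of c are the ones collected first.\<close>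

lemma app_coproduct_tensor_id:
  assumes l: "klinear V (tpow 2 V) l"
    and c: "Poly_Mapping.keys c \<subseteq> words 1 V" and e: "Poly_Mapping.keys e \<subseteq> words 1 V"
  shows "app (ttensor V V (tmap_of_coproduct V d l) tid) (tclass 2 V (conc c e)) =
    lsum (tpow 3 V) (\<lambda>ys. tconc 2 1 V (l (eval_word V c)) (pure 1 V ys)) e"
proof -
  interpret T: field_module "tpow 3 V" by (rule field_module_tpow)
  have lc: "l v \<in> carrier (tpow 2 V)" if "v \<in> carrier V" for v
    using l that by (auto simp: klinear_def)
  let ?G = "\<lambda>(x :: int \<times> 'v) (y :: int \<times> 'v). tconc 2 1 V (l (snd x)) (pure 1 V [y])"
  let ?F = "\<lambda>xs. ?G (xs ! 0) (xs ! 1)"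
  have kl: "klinear V (tpow 3 V) (\<lambda>u. tconc 2 1 V (l u) (pure 1 V [(j, v)]))"
    if "v \<in> homog V j" for j v
  proof (rule klinear_compose [OF l])
    show "klinear (tpow 2 V) (tpow 3 V) (\<lambda>t. tconc 2 1 V t (pure 1 V [(j, v)]))"
      using klinear_tconc_left [OF pure_closed [of "[(j, v)]" 1], of 2] that
      by (simp add: words_1_iff)
  qed
  have left: "letter_linear V (tpow 3 V) (\<lambda>x. ?G x (j, v))" if "v \<in> homog V j" for j v
    using letter_linear_klinear [OF letter_linear_snd kl [OF that]] by simp
  have kr: "klinear (tpow 1 V) (tpow 3 V) (tconc 2 1 V (l u))" if "u \<in> carrier V" for u
    using klinear_tconc_right [OF lc [OF that], of 1] by simp
  have right: "letter_linear V (tpow 3 V) (?G (i, u))" if "u \<in> homog V i" for i u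
    using letter_linear_klinear [OF letter_linear_pure kr [OF homog_carrier [OF that]]] by simp
  have ml: "multilinear 2 V (tpow 3 V) ?F"
    by (rule multilinear_2 [OF left right])
  then have F: "?F \<in> words 2 V \<rightarrow> carrier (tpow 3 V)" by (simp add: multilinear_def)
  have k: "Poly_Mapping.keys (conc c e) \<subseteq> words 2 V" using keys_conc [OF c e] by simp
  have "app (ttensor V V (tmap_of_coproduct V d l) tid) (tclass 2 V (conc c e)) = lsum (tpow 3 V) ?F (conc c e)"
    unfolding ttensor_def
  proof (simp add: tid_def tmap_of_coproduct_simps, rule tlift_tclass_cong [OF field_module_tpow ml _ k])
    fix xs assume xs: "xs \<in> words 2 V"
    then have "?F xs \<in> carrier (tpow 3 V)" using F by blast
    then show "ksign 0 \<odot>\<^bsub>tpow 3 V\<^esub> tconc 2 1 V (app (tmap_of_coproduct V d l) (pure 1 V (take 1 xs))) (pure 1 V (drop 1 xs)) = ?F xs"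
      using xs by (auto simp only: words_2_iff take_drop_word nth_word app_coproduct_pure [OF l] fst_conv snd_conv
        ksign_zero T.smult_one)
  qed
  also have "\<dots> = lsum (tpow 3 V) (\<lambda>ys. lsum (tpow 3 V) (\<lambda>xs. ?F (xs @ ys)) c) e"
    using F by (intro T.lsum_conc(2) [OF _ c e]) simp
  also have "\<dots> = lsum (tpow 3 V) (\<lambda>ys. tconc 2 1 V (l (eval_word V c)) (pure 1 V ys)) e"
  proof (rule T.lsum_cong [OF _ _ e])
    fix ys assume "ys \<in> words 1 V"
    then obtain j v where ys: "ys = [(j, v)]" and v: "v \<in> homog V j" by (auto simp: words_1_iff)
    \<comment> \<open>The tag of the first letter may be set to 0 because \<open>?G\<close> ignores
      it; this leaves a function of the element alone, to which linearity applies.\<close>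
    have "?F (xs @ ys) = ?G (0, snd (xs ! 0)) (j, v)" if "xs \<in> words 1 V" for xs
      using that unfolding ys by (auto simp: words_1_iff)
    then have "lsum (tpow 3 V) (\<lambda>xs. ?F (xs @ ys)) c = lsum (tpow 3 V) (\<lambda>xs. ?G (0, snd (xs ! 0)) (j, v)) c"
      using kl [OF v] by (intro T.lsum_cong [OF _ _ c]) (auto simp: words_1_iff klinear_def homog_carrier Pi_iff)
    also have "\<dots> = ?G (0, eval_word V c) (j, v)"
      using lsum_klinear [OF field_module_axioms field_module_tpow kl [OF v] snd_nth_closed c] by (simp add: eval_word_def)
    finally show "lsum (tpow 3 V) (\<lambda>xs. ?F (xs @ ys)) c = tconc 2 1 V (l (eval_word V c)) (pure 1 V ys)"
      by (simp add: ys)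
  next
    show "(\<lambda>ys. tconc 2 1 V (l (eval_word V c)) (pure 1 V ys)) \<in> words 1 V \<rightarrow> carrier (tpow 3 V)"
      using kr [OF eval_word_closed [OF c]] pure_closed by (auto simp: klinear_def Pi_iff)
  qed
  finally show ?thesis .
qed

text \<open>The source of \<lambda>\<eta> is the ground field, spanned by the empty word. The degree
  hypothesis makes \<open>(0, u)\<close> an admissible letter.\<close>

lemma app_coproduct_unit:
  assumes l: "klinear V (tpow 2 V) l" and u: "u \<in> homog V 0"
  shows "app (tcomp (tmap_of_coproduct V d l) (tmap_of_unit V u)) (pure 0 V []) = l u"
proof -
  interpret T: field_module "tpow 1 V" by (rule field_module_tpow)
  have p: "pure 1 V [(0, u)] \<in> carrier (tpow 1 V)"
    using u by (intro pure_closed) (simp add: words_1_iff)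
  then have "multilinear 0 V (tpow 1 V) (\<lambda>xs. pure 1 V [(0, u)])"
    by (simp add: multilinear_def words_def)
  then have "app (tmap_of_unit V u) (pure 0 V []) = pure 1 V [(0, u)]"
    unfolding tmap_of_unit_def pure_eq_tclass [of 0]
    using tlift_tclass [OF field_module_tpow, of 0 1 "\<lambda>xs. pure 1 V [(0, u)]" "Poly_Mapping.single [] 1"] p
    by (simp add: words_def T.lsum_single)
  then show ?thesis
    using app_coproduct_pure [OF l u] by (simp add: tcomp_def)
qed

text \<open>Since \<lambda>\<eta> consumes no letter, 1 \<otimes> \<lambda>\<eta> acts on one-letter
  words, appending \<lambda>(\<eta>) with the sign of moving \<lambda> past the letter.\<close>

lemma app_id_tensor_coproduct_unit:
  assumes l: "klinear V (tpow 2 V) l" and u: "u \<in> homog V 0" and v: "v \<in> homog V i"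
  shows "app (ttensor V V tid (tcomp (tmap_of_coproduct V d l) (tmap_of_unit V u))) (pure 1 V [(i, v)])
    = ksign (d * i) \<odot>\<^bsub>tpow 3 V\<^esub> tconc 1 2 V (pure 1 V [(i, v)]) (l u)"
proof -
  interpret T: field_module "tpow 3 V" by (rule field_module_tpow)
  let ?G = "\<lambda>x. ksign (d * fst x) \<odot>\<^bsub>tpow 3 V\<^esub> tconc 1 2 V (pure 1 V [x]) (l u)"
  have "l u \<in> carrier (tpow 2 V)" using l homog_carrier [OF u] by (auto simp: klinear_def)
  then have G: "letter_linear V (tpow 3 V) ?G"
    using letter_linear_tensor_left [of "l u" 2 d] by simp
  then have c: "?G (i, v) \<in> carrier (tpow 3 V)" using v by (simp add: letter_linear_def)
  have k: "Poly_Mapping.keys (Poly_Mapping.single [(i, v)] (1::'k)) \<subseteq> words 1 V" using v by (simp add: words_1_iff)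
  have "app (ttensor V V tid (tcomp (tmap_of_coproduct V d l) (tmap_of_unit V u))) (pure 1 V [(i, v)])
     = lsum (tpow 3 V) (\<lambda>xs. ?G (xs ! 0)) (Poly_Mapping.single [(i, v)] 1)"
    unfolding ttensor_def pure_eq_tclass [of 1 V "[(i, v)]"]
    by (simp add: tid_def tcomp_simps(1-3) tmap_of_unit_simps tmap_of_coproduct_simps,
        rule tlift_tclass_cong [OF field_module_tpow multilinear_1 [OF G] _ k])
      (auto simp only: words_1_iff take_drop_word wdeg_single nth_word app_coproduct_unit [OF l u] fst_conv snd_conv)
  then show ?thesis using c by (simp add: T.lsum_single)
qed

text \<open>The map inserts \<lambda>(\<eta>) between the two letters. No letters have to be
  collected to isolate \<open>l u\<close>, so c can be any formal sum of two-letter words.\<close>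

lemma app_id_tensor_coproduct_unit_tensor_id:
  assumes l: "klinear V (tpow 2 V) l" and u: "u \<in> homog V 0" and c: "Poly_Mapping.keys c \<subseteq> words 2 V"
  shows "app (ttensor V V (ttensor V V tid (tcomp (tmap_of_coproduct V d l) (tmap_of_unit V u))) tid) (tclass 2 V c)
    = lsum (tpow 4 V) (\<lambda>xs. tconc 3 1 V
        (ksign (d * fst (xs ! 0)) \<odot>\<^bsub>tpow 3 V\<^esub> tconc 1 2 V (pure 1 V [xs ! 0]) (l u)) (pure 1 V [xs ! 1])) c"
proof -
  interpret T: field_module "tpow 4 V" by (rule field_module_tpow)
  let ?g = "\<lambda>x. ksign (d * fst x) \<odot>\<^bsub>tpow 3 V\<^esub> tconc 1 2 V (pure 1 V [x]) (l u)"
  let ?G = "\<lambda>(x :: int \<times> 'v) (y :: int \<times> 'v). tconc 3 1 V (?g x) (pure 1 V [y])"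
  let ?F = "\<lambda>xs. ?G (xs ! 0) (xs ! 1)"
  have "l u \<in> carrier (tpow 2 V)" using l homog_carrier [OF u] by (auto simp: klinear_def)
  then have g: "letter_linear V (tpow 3 V) ?g"
    using letter_linear_tensor_left [of "l u" 2 d] by simp
  have left: "letter_linear V (tpow 4 V) (\<lambda>x. ?G x (j, v))" if "v \<in> homog V j" for j v
    using letter_linear_klinear [OF g klinear_tconc_left [OF pure_closed [of "[(j, v)]" 1]]] that
    by (simp add: words_1_iff)
  have right: "letter_linear V (tpow 4 V) (?G (i, v))" if "v \<in> homog V i" for i v
    using letter_linear_klinear [OF letter_linear_pure klinear_tconc_right [of "?g (i, v)" 3 1]] g that
    by (simp add: letter_linear_def)
  have ml: "multilinear 2 V (tpow 4 V) ?F"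
    by (rule multilinear_2 [OF left right])
  then have F: "?F \<in> words 2 V \<rightarrow> carrier (tpow 4 V)" by (simp add: multilinear_def)
  let ?f = "ttensor V V tid (tcomp (tmap_of_coproduct V d l) (tmap_of_unit V u))"
  have f: "src ?f = 1" "tgt ?f = 3"
    by (simp_all add: ttensor_def tid_def tcomp_simps(1-3) tmap_of_unit_simps tmap_of_coproduct_simps)
  \<comment> \<open>Only the outer \<open>ttensor\<close> is unfolded; the inner one stays intact
    for its value on one-letter words, already known.\<close>
  have e: "app (ttensor V V ?f tid) = tlift (tpow 4 V) (\<lambda>xs. ksign 0 \<odot>\<^bsub>tpow 4 V\<^esub>
      tconc 3 1 V (app ?f (pure 1 V (take 1 xs))) (pure 1 V (drop 1 xs)))"
    unfolding ttensor_def [of V V ?f] by (simp add: f, simp add: tid_def)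
  show ?thesis
    unfolding e
  proof (rule tlift_tclass_cong [OF field_module_tpow ml _ c])
    fix xs assume xs: "xs \<in> words 2 V"
    then have "?F xs \<in> carrier (tpow 4 V)" using F by blast
    then show "ksign 0 \<odot>\<^bsub>tpow 4 V\<^esub> tconc 3 1 V (app ?f (pure 1 V (take 1 xs))) (pure 1 V (drop 1 xs)) = ?F xs"
      using xs by (auto simp only: words_2_iff take_drop_word nth_word app_id_tensor_coproduct_unit [OF l u]
        fst_conv snd_conv ksign_zero T.smult_one)
  qed
qed

text \<open>On the right of the relation the coproduct sits only in the inner maps. Once these agree
  on the class of \<open>conc c e\<close>, the outer products are applied to equal tensors, while
  the left sides are the two values at \<open>m a b\<close>.\<close>

lemma infinitesimal_coproduct_mult_eq:
  assumes l: "klinear V (tpow 2 V) l" "unital_infinitesimal_relation V d m u l"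
    and l': "klinear V (tpow 2 V) l'" "unital_infinitesimal_relation V d m u l'"
    and u: "u \<in> homog V 0" "l u = l' u"
    and a: "a \<in> carrier V" "l a = l' a" and b: "b \<in> carrier V" "l b = l' b"
  shows "l (m a b) = l' (m a b)"
proof -
  obtain c e where c: "Poly_Mapping.keys c \<subseteq> words 1 V" "eval_word V c = a"
    and e: "Poly_Mapping.keys e \<subseteq> words 1 V" "eval_word V e = b"
    using eval_word_surj a(1) b(1) by metis
  let ?t = "tclass 2 V (conc c e)"
  have k: "Poly_Mapping.keys (conc c e) \<subseteq> words 2 V"
    using keys_conc [OF c(1) e(1)] by simp
  have t: "?t \<in> carrier (tpow 2 V)" by (rule tclass_closed [OF k])
  have "app (ttensor V V tid (tmap_of_coproduct V d l)) ?t = app (ttensor V V tid (tmap_of_coproduct V d l')) ?t"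
    using app_id_tensor_coproduct [OF l(1) c(1) e(1)] app_id_tensor_coproduct [OF l'(1) c(1) e(1)] e(2) b(2) by simp
  moreover have "app (ttensor V V (tmap_of_coproduct V d l) tid) ?t = app (ttensor V V (tmap_of_coproduct V d l') tid) ?t"
    using app_coproduct_tensor_id [OF l(1) c(1) e(1)] app_coproduct_tensor_id [OF l'(1) c(1) e(1)] c(2) a(2) by simp
  moreover have "app (ttensor V V (ttensor V V tid (tcomp (tmap_of_coproduct V d l) (tmap_of_unit V u))) tid) ?t
      = app (ttensor V V (ttensor V V tid (tcomp (tmap_of_coproduct V d l') (tmap_of_unit V u))) tid) ?t"
    using app_id_tensor_coproduct_unit_tensor_id [OF l(1) u(1) k] app_id_tensor_coproduct_unit_tensor_id [OF l'(1) u(1) k] u(2) by simp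
  ultimately have "app (tcomp (tmap_of_coproduct V d l) (tmap_of_product V m)) ?t
      = app (tcomp (tmap_of_coproduct V d l') (tmap_of_product V m)) ?t"
    using l(2) l'(2) t unfolding unital_infinitesimal_relation_def Let_def
    by (simp add: tcomp_simps)
  then show ?thesis
    using app_coproduct_product [OF l(1) c(1) e(1)] app_coproduct_product [OF l'(1) c(1) e(1)] c(2) e(2) by simp
qed

theorem infinitesimal_coproduct_unique:
  assumes l: "klinear V (tpow 2 V) l" "unital_infinitesimal_relation V d m u l"
    and l': "klinear V (tpow 2 V) l'" "unital_infinitesimal_relation V d m u l'"
    and u: "u \<in> homog V 0" "l u = l' u"
    and S: "S \<subseteq> carrier V" "\<And>s. s \<in> S \<Longrightarrow> l s = l' s"
    and a: "a \<in> alg_generated V m u S"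
  shows "l a = l' a"
proof -
  \<comment> \<open>Membership in the carrier is carried along because linearity of l and l' is
    available only there.\<close>
  have "a \<in> carrier V \<and> l a = l' a"
    using a
  proof induction
    case (add a b)
    then show ?case using l(1) l'(1) by (simp add: klinear_def)
  next
    case (smult a k)
    then show ?case using l(1) l'(1) by (simp add: klinear_def)
  next
    case (mult a b)
    then show ?case using infinitesimal_coproduct_mult_eq [OF l l' u] mult_closed by simp
  qed (use S u homog_carrier in auto)
  then show ?thesis ..
qed

end

section \<open>Singular chains\<close>

definition simplex_boundary :: "nat \<times> ((nat \<Rightarrow> real) \<Rightarrow> 'a) \<Rightarrow> ('k::field, 'a) kchain" where
  "simplex_boundary = (\<lambda>(p, \<sigma>). if p = 0 then 0
     else \<Sum>i\<le>p. Poly_Mapping.single (p - 1, singular_face p i \<sigma>) ((- 1) ^ i))"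

lemma kboundary_eq: "kboundary = lin_ext simplex_boundary"
  by (simp add: kboundary_def simplex_boundary_def)

lemma kboundary_simps:
  "kboundary (c + d) = kboundary c + kboundary d" "kboundary (c - d) = kboundary c - kboundary d"
  "kboundary (scale a c) = scale a (kboundary c)" "kboundary 0 = 0"
  by (simp_all add: kboundary_eq lin_ext_add lin_ext_minus lin_ext_scale)

text \<open>Chains may mix dimensions; this projection extracts their homogeneous components. Given
  as a linear extension, it can be composed with the boundary on simplices.\<close>

definition dim_part :: "nat \<Rightarrow> ('k::field, 'a) kchain \<Rightarrow> ('k, 'a) kchain" where
  "dim_part q = lin_ext (\<lambda>x. if fst x = q then Poly_Mapping.single x 1 else 0)"

lemma lookup_dim_part: "Poly_Mapping.lookup (dim_part q c) x = (if fst x = q then Poly_Mapping.lookup c x else 0)"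
proof -
  have t: "Poly_Mapping.lookup c y * Poly_Mapping.lookup (if fst y = q then Poly_Mapping.single y 1 else 0) x =
      (if y = x then (if fst x = q then Poly_Mapping.lookup c x else 0) else 0)" for y
    by (simp add: lookup_single when_def)
  have "Poly_Mapping.lookup (dim_part q c) x = (\<Sum>y\<in>insert x (Poly_Mapping.keys c).
      if y = x then (if fst x = q then Poly_Mapping.lookup c x else 0) else 0)"
    unfolding dim_part_def
    by (subst lookup_lin_ext [of "insert x (Poly_Mapping.keys c)"]) (auto simp: t)
  then show ?thesis by (simp add: sum.delta)
qed

lemma dim_part_add: "dim_part q (c + d) = dim_part q c + dim_part q d"
  by (simp add: dim_part_def lin_ext_add)

lemma keys_dim_part: "Poly_Mapping.keys (dim_part q c) = {x \<in> Poly_Mapping.keys c. fst x = q}"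
  by (auto simp: in_keys_iff lookup_dim_part split: if_splits)

lemma dim_part_eq_self: "Poly_Mapping.keys c \<subseteq> {x. fst x = q} \<Longrightarrow> dim_part q c = c"
  by (rule poly_mapping_eqI) (auto simp: lookup_dim_part in_keys_iff)

lemma sum_dim_part: "(\<Sum>q\<in>fst ` Poly_Mapping.keys c. dim_part q c) = c"
proof (rule poly_mapping_eqI)
  fix x
  have "(\<Sum>q\<in>fst ` Poly_Mapping.keys c. Poly_Mapping.lookup (dim_part q c) x)
      = (if fst x \<in> fst ` Poly_Mapping.keys c then Poly_Mapping.lookup c x else 0)"
    unfolding lookup_dim_part by (simp add: sum.delta eq_commute)
  also have "\<dots> = Poly_Mapping.lookup c x"
    by (auto simp: in_keys_iff image_iff)
  finally show "Poly_Mapping.lookup (\<Sum>q\<in>fst ` Poly_Mapping.keys c. dim_part q c) x = Poly_Mapping.lookup c x"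
    by (simp add: lookup_sum)
qed

lemma keys_simplex_boundary:
  "Poly_Mapping.keys (simplex_boundary (p, \<sigma>)) \<subseteq> (if p = 0 then {} else (\<lambda>i. (p - 1, singular_face p i \<sigma>)) ` {..p})"
  using keys_sum [of "\<lambda>i. Poly_Mapping.single (p - 1, singular_face p i \<sigma>) ((- 1) ^ i)" "{..p}"]
  by (auto simp: simplex_boundary_def split: if_splits)

lemma dim_part_simplex_boundary:
  "dim_part q (simplex_boundary x) = (if fst x = Suc q then simplex_boundary x else 0)"
proof (cases x)
  case (Pair p \<sigma>)
  show ?thesis
  proof (cases "p = Suc q")
    case True
    have "dim_part q (simplex_boundary (p, \<sigma>)) = simplex_boundary (p, \<sigma>)"
      by (rule dim_part_eq_self, rule order_trans [OF keys_simplex_boundary]) (auto simp: True)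
    then show ?thesis by (simp add: Pair True)
  next
    case False
    have "Poly_Mapping.keys (dim_part q (simplex_boundary (p, \<sigma>))) = {}"
      using keys_simplex_boundary [of p \<sigma>] False unfolding keys_dim_part
      by (auto split: if_splits)
    then show ?thesis using False by (simp add: Pair)
  qed
qed

lemma dim_part_kboundary: "dim_part q (kboundary c) = kboundary (dim_part (Suc q) c)"
proof -
  have "dim_part q (kboundary c) = lin_ext (\<lambda>x. dim_part q (simplex_boundary x)) c"
    unfolding kboundary_eq by (simp add: dim_part_def lin_ext_lin_ext)
  also have "\<dots> = lin_ext (\<lambda>x. kboundary (if fst x = Suc q then Poly_Mapping.single x 1 else 0)) c"
    by (rule arg_cong [where f = "\<lambda>f. lin_ext f c"])
      (simp add: fun_eq_iff dim_part_simplex_boundary kboundary_eq scale_simps)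
  also have "\<dots> = kboundary (dim_part (Suc q) c)"
    unfolding kboundary_eq by (simp add: dim_part_def lin_ext_lin_ext)
  finally show ?thesis .
qed

text \<open>Complements the commutation rule for \<open>dim_part\<close> and
  \<open>kboundary\<close>, whose index \<open>Suc q\<close> never reaches dimension 0.\<close>

lemma kboundary_dim_part_0: "kboundary (dim_part 0 c) = 0"
proof -
  have "kboundary (dim_part 0 c) = lin_ext (\<lambda>x. kboundary (if fst x = 0 then Poly_Mapping.single x 1 else 0)) c"
    unfolding kboundary_eq by (simp add: dim_part_def lin_ext_lin_ext)
  also have "\<dots> = lin_ext (\<lambda>x. 0) c"
    by (rule arg_cong [where f = "\<lambda>f. lin_ext f c"])
      (auto simp: fun_eq_iff kboundary_eq simplex_boundary_def scale_simps)
  finally show ?thesis by (simp add: lin_ext_def scale_simps)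
qed

section \<open>Relative cycles and relative boundaries\<close>

lemma mem_kchains_iff:
  "c \<in> carrier (kchains X) \<longleftrightarrow> Poly_Mapping.keys c \<subseteq> {(p, \<sigma>). singular_simplex p X \<sigma>}"
  by (simp add: kchains_def)

lemma field_module_kchains: "field_module (kchains X)"
  by (simp add: kchains_def field_module_free_gmodule)

lemma kchains_simps [simp]:
  "\<zero>\<^bsub>kchains X\<^esub> = 0" "u \<oplus>\<^bsub>kchains X\<^esub> v = u + v" "a \<odot>\<^bsub>kchains X\<^esub> v = scale a v"
  by (simp_all add: kchains_def)

lemma kchains_closed:
  "0 \<in> carrier (kchains X)"
  "c \<in> carrier (kchains X) \<Longrightarrow> d \<in> carrier (kchains X) \<Longrightarrow> c + d \<in> carrier (kchains X)"
  "c \<in> carrier (kchains X) \<Longrightarrow> d \<in> carrier (kchains X) \<Longrightarrow> c - d \<in> carrier (kchains X)"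
  "c \<in> carrier (kchains X) \<Longrightarrow> scale a c \<in> carrier (kchains X)"
  "c \<in> carrier (kchains X) \<Longrightarrow> dim_part q c \<in> carrier (kchains X)"
  unfolding mem_kchains_iff
  by (auto intro: keys_add_subset keys_diff_subset keys_scale_subset simp: keys_dim_part
      dest: subsetD [OF keys_add] subsetD [OF keys_diff] subsetD [OF keys_scale])

lemma kchains_subtopology: "c \<in> carrier (kchains (subtopology X A)) \<Longrightarrow> c \<in> carrier (kchains X)"
  by (auto simp: mem_kchains_iff singular_simplex_subtopology)

lemma kboundary_closed:
  assumes "c \<in> carrier (kchains X)"
  shows "kboundary c \<in> carrier (kchains X)"
  unfolding mem_kchains_iff kboundary_eq
proof (rule keys_lin_ext)
  fix x assume "x \<in> Poly_Mapping.keys c"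
  then obtain p \<sigma> where x: "x = (p, \<sigma>)" "singular_simplex p X \<sigma>"
    using assms by (auto simp: mem_kchains_iff)
  have "singular_simplex (p - 1) X (singular_face p i \<sigma>)" if "p \<noteq> 0" "i \<le> p" for i
    using singular_simplex_singular_face [OF x(2) _ that(2)] that(1) by (simp add: One_nat_def)
  then show "Poly_Mapping.keys (simplex_boundary x :: ('b, 'a) kchain) \<subseteq> {(p, \<sigma>). singular_simplex p X \<sigma>}"
    unfolding x(1) using keys_simplex_boundary [of p \<sigma>] by (fastforce split: if_splits)
qed

lemma ksubspace_relcycles: "ksubspace (kchains X) (relcycles X A)"
  by (auto simp: ksubspace_def relcycles_def kboundary_simps kchains_closed)

lemma ksubspace_relboundaries: "ksubspace (kchains X) (relboundaries X A)"
  unfolding ksubspace_def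
proof (intro conjI ballI allI subsetI)
  show "c \<in> carrier (kchains X)" if "c \<in> relboundaries X A" for c
    using that by (auto simp: relboundaries_def kchains_closed kboundary_closed dest!: kchains_subtopology)
  show "\<zero>\<^bsub>kchains X\<^esub> \<in> relboundaries X A"
    unfolding relboundaries_def
    by (simp, intro exI [of _ 0]) (simp add: kchains_closed kboundary_simps)
  show "u \<oplus>\<^bsub>kchains X\<^esub> v \<in> relboundaries X A" if uv: "u \<in> relboundaries X A" "v \<in> relboundaries X A" for u v
  proof -
    obtain d a d' a' where u: "u = kboundary d + a" "d \<in> carrier (kchains X)" "a \<in> carrier (kchains (subtopology X A))"
      and v: "v = kboundary d' + a'" "d' \<in> carrier (kchains X)" "a' \<in> carrier (kchains (subtopology X A))"
      using uv unfolding relboundaries_def by blast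
    then have "u + v = kboundary (d + d') + (a + a')" by (simp add: kboundary_simps)
    then show ?thesis
      using kchains_closed(2) [OF u(2) v(2)] kchains_closed(2) [OF u(3) v(3)]
      unfolding relboundaries_def kchains_simps by blast
  qed
  show "s \<odot>\<^bsub>kchains X\<^esub> u \<in> relboundaries X A" if uv: "u \<in> relboundaries X A" for u s
  proof -
    obtain d a where u: "u = kboundary d + a" "d \<in> carrier (kchains X)" "a \<in> carrier (kchains (subtopology X A))"
      using uv unfolding relboundaries_def by blast
    then have "scale s u = kboundary (scale s d) + scale s a" by (simp add: kboundary_simps scale_simps)
    then show ?thesis
      using kchains_closed(4) [OF u(2)] kchains_closed(4) [OF u(3)]
      unfolding relboundaries_def kchains_simps by blast
  qed
qed

lemma relboundariesI:
  "d \<in> carrier (kchains X) \<Longrightarrow> a \<in> carrier (kchains (subtopology X A)) \<Longrightarrow> kboundary d + a \<in> relboundaries X A"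
  by (auto simp: relboundaries_def)

lemma subchain_relboundary: "a \<in> carrier (kchains (subtopology X A)) \<Longrightarrow> a \<in> relboundaries X A"
  using relboundariesI [OF kchains_closed(1)] by (force simp: kboundary_simps)

lemma relboundaries_mono:
  "B \<subseteq> A \<Longrightarrow> relboundaries X B \<subseteq> relboundaries X A"
  by (fastforce simp: relboundaries_def mem_kchains_iff singular_simplex_subtopology)

lemma dim_part_relcycles: "c \<in> relcycles X A \<Longrightarrow> dim_part q c \<in> relcycles X A"
  by (cases q) (auto simp: relcycles_def kchains_closed kboundary_dim_part_0 dim_part_kboundary [symmetric])

lemma dim_part_relboundaries: "c \<in> relboundaries X A \<Longrightarrow> dim_part q c \<in> relboundaries X A"
proof -
  assume "c \<in> relboundaries X A"
  then obtain d a where "c = kboundary d + a" "d \<in> carrier (kchains X)" "a \<in> carrier (kchains (subtopology X A))"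
    unfolding relboundaries_def by blast
  then show ?thesis
    by (simp add: dim_part_add dim_part_kboundary relboundariesI kchains_closed(5))
qed

text \<open>The boundary lowers dimension by exactly one, so every component of a relative cycle is
  again a relative cycle, and the cycle is the finite sum of its components.\<close>

lemma graded_module_relcycles: "graded_module (sub_gmodule (kchains X) (relcycles X A))"
proof (intro graded_module.intro field_module.field_module_sub_gmodule field_module_kchains ksubspace_relcycles graded_module_axioms.intro)
  let ?Z = "sub_gmodule (kchains X) (relcycles X A)"
  note ss = ksubspaceD [OF ksubspace_relcycles [of X A]]
  show "u \<oplus>\<^bsub>?Z\<^esub> v \<in> homog ?Z i" if "u \<in> homog ?Z i" "v \<in> homog ?Z i" for u v i
    using that by (auto simp: ss(3) [simplified] kchains_def dest: subsetD [OF keys_add])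
  show "a \<odot>\<^bsub>?Z\<^esub> v \<in> homog ?Z i" if "v \<in> homog ?Z i" for a v i
    using that by (auto simp: ss(4) [simplified] kchains_def dest: subsetD [OF keys_scale])
  show "P c" if c: "c \<in> carrier ?Z" and P: "P \<zero>\<^bsub>?Z\<^esub>" "\<And>i v. v \<in> homog ?Z i \<Longrightarrow> P v"
    "\<And>u v. u \<in> carrier ?Z \<Longrightarrow> v \<in> carrier ?Z \<Longrightarrow> P u \<Longrightarrow> P v \<Longrightarrow> P (u \<oplus>\<^bsub>?Z\<^esub> v)" for P c
  proof -
    have c: "c \<in> relcycles X A" using c by simp
    have d: "P (dim_part q c)" for q
    proof (rule P(2) [of _ "int q"])
      show "dim_part q c \<in> homog ?Z (int q)"
        using c dim_part_relcycles [OF c, of q]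
        by (auto simp: kchains_def relcycles_def keys_dim_part)
    qed
    \<comment> \<open>The additivity assumption on P holds only for relative cycles, so the partial
      sums are shown to be such at the same time.\<close>
    have "(\<Sum>q\<in>I. dim_part q c) \<in> relcycles X A \<and> P (\<Sum>q\<in>I. dim_part q c)" if "finite I" for I
      using that
    proof induction
      case empty
      show ?case using P(1) ksubspaceD(2) [OF ksubspace_relcycles, of X A] by simp
    next
      case (insert q I)
      then show ?case
        using P(3) [of "dim_part q c" "\<Sum>q\<in>I. dim_part q c"] d
        by (simp add: ss(3) [simplified] dim_part_relcycles [OF c])
    qed
    from this [of "fst ` Poly_Mapping.keys c"] show ?thesis by (simp add: sum_dim_part)
  qed
qed simp

lemma graded_module_khomology: "graded_module (khomology X A)"
  unfolding khomology_def
  by (rule field_module.graded_module_FactModule_sub [OF field_module_kchains ksubspace_relcycles ksubspace_relboundaries graded_module_relcycles])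

lemma carrier_khomology: "carrier (khomology X A) = kclass X A ` relcycles X A"
  by (simp add: khomology_def FactModule_simps kclass_def)

lemma kclass_eqI:
  assumes "c \<in> carrier (kchains X)" "d - c \<in> relboundaries X A"
  shows "kclass X A d = kclass X A c"
  unfolding kclass_def
proof (rule field_module.coset_eqI [OF field_module_kchains ksubspace_relboundaries assms(1)])
  show "d \<in> relboundaries X A +>\<^bsub>kchains X\<^esub> c"
    using assms(2) by (auto simp: mem_coset_iff intro!: bexI [of _ "d - c"])
qed

section \<open>Push-forward of chains along maps\<close>

lemma kpush_simplex: "kpush g c = lin_ext (\<lambda>x. Poly_Mapping.single (fst x, simplex_map (fst x) g (snd x)) 1) c"
  by (simp add: kpush_def case_prod_beta')

lemma kboundary_kpush:
  fixes c :: "('k::field, 'a) kchain" and g :: "'a \<Rightarrow> 'b"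
  shows "kboundary (kpush g c) = kpush g (kboundary c)"
proof -
  have "kboundary (Poly_Mapping.single (p, simplex_map p g \<sigma>) 1) = kpush g (simplex_boundary (p, \<sigma>) :: ('k, 'a) kchain)"
    for p and \<sigma> :: "(nat \<Rightarrow> real) \<Rightarrow> 'a"
  proof (cases "p = 0")
    case False
    have "singular_face p i (simplex_map p g \<sigma>) = simplex_map (p - 1) g (singular_face p i \<sigma>)" if "i \<le> p" for i
      using False that
      by (subst singular_face_simplex_map) (auto simp: simplex_map_def singular_face_def One_nat_def fun_eq_iff)
    then show ?thesis
      using False by (simp add: kboundary_eq kpush_def simplex_boundary_def scale_simps lin_ext_sum)
  qed (simp add: kboundary_eq kpush_def simplex_boundary_def scale_simps)
  then show ?thesis
    unfolding kboundary_eq kpush_simplex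
    by (simp add: lin_ext_lin_ext kboundary_eq kpush_simplex)
qed

lemma kpush_closed:
  assumes "continuous_map X Y g" "c \<in> carrier (kchains X)"
  shows "kpush g c \<in> carrier (kchains Y)"
  unfolding mem_kchains_iff kpush_simplex
proof (rule keys_lin_ext)
  fix x assume "x \<in> Poly_Mapping.keys c"
  then have "singular_simplex (fst x) X (snd x)" using assms(2) by (auto simp: mem_kchains_iff)
  from singular_simplex_simplex_map [OF this assms(1)]
  show "Poly_Mapping.keys (Poly_Mapping.single (fst x, simplex_map (fst x) g (snd x)) 1) \<subseteq> {(p, \<sigma>). singular_simplex p Y \<sigma>}"
    by simp
qed

lemma kpush_id_on:
  assumes "c \<in> carrier (kchains X)" "\<And>x. x \<in> topspace X \<Longrightarrow> g x = x"
  shows "kpush g c = c"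
proof -
  have "Poly_Mapping.keys c \<subseteq> {(p, \<sigma>). singular_simplex p X \<sigma>}" using assms(1) by (simp add: mem_kchains_iff)
  then show ?thesis
    by (induction rule: poly_mapping_span_induct)
      (auto simp: kpush_def lin_ext_add scale_simps simplex_map_id_gen [OF _ assms(2)])
qed

section \<open>Loop homology\<close>

lemma topspace_loop_space: "topspace (loop_space X) = loops X"
proof -
  \<comment> \<open>For empty K the subbasic set is all of \<open>loops X\<close>.\<close>
  have "loops X \<in> {{\<gamma> \<in> loops X. \<gamma> ` K \<subseteq> U} | K U. compact K \<and> K \<subseteq> {0..1} \<and> openin X U}"
    by (intro CollectI exI [of _ "{}"]) auto
  then show ?thesis by (auto simp: loop_space_def)
qed

lemma const_loop_in_loops:
  assumes "x \<in> topspace X"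
  shows "const_loop x \<in> loops X"
proof -
  have "continuous_map (top_of_set {0..1}) X (const_loop x)"
    by (rule continuous_map_eq [of _ _ "\<lambda>_. x"]) (use assms in \<open>auto simp: const_loop_def\<close>)
  then show ?thesis by (simp add: loops_def const_loop_def)
qed

lemma loops_eval: "\<gamma> \<in> loops X \<Longrightarrow> \<gamma> 0 \<in> topspace X"
  by (auto simp: loops_def continuous_map_def)

text \<open>A constant loop maps a nonempty K into U exactly if its point lies in U. So the preimage
  of a subbasic set is again subbasic, with the compact set {0} in place of K, or the whole space if
  K is empty.\<close>

lemma continuous_map_const_loop_eval:
  "continuous_map (loop_space X) (subtopology (loop_space X) (const_loops X)) (\<lambda>\<gamma>. const_loop (\<gamma> 0))"
  unfolding continuous_map_in_subtopology
proof (intro conjI)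
  show "(\<lambda>\<gamma>. const_loop (\<gamma> 0)) \<in> topspace (loop_space X) \<rightarrow> const_loops X"
    by (auto simp: topspace_loop_space const_loops_def dest: loops_eval)
  let ?S = "{{\<gamma> \<in> loops X. \<gamma> ` K \<subseteq> U} | K U. compact K \<and> K \<subseteq> {0..1} \<and> openin X U}"
  have "continuous_map (loop_space X) (topology_generated_by ?S) (\<lambda>\<gamma>. const_loop (\<gamma> 0))"
  proof (rule continuous_on_generated_topo)
    show "(\<lambda>\<gamma>. const_loop (\<gamma> 0)) ` topspace (loop_space X) \<subseteq> \<Union> ?S"
      using topspace_loop_space [of X] const_loop_in_loops [OF loops_eval]
      unfolding loop_space_def topology_generated_by_topspace by blast
    fix V assume "V \<in> ?S"
    then obtain K U where V: "V = {\<gamma> \<in> loops X. \<gamma> ` K \<subseteq> U}" "K \<subseteq> {0..1}" "openin X U" by auto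
    have img: "const_loop x ` K \<subseteq> U \<longleftrightarrow> K = {} \<or> x \<in> U" for x
      using V(2) by (auto simp: const_loop_def subset_iff image_iff)
    have "(\<lambda>\<gamma>. const_loop (\<gamma> 0)) -` V \<inter> topspace (loop_space X) = {\<gamma> \<in> loops X. K = {} \<or> \<gamma> 0 \<in> U}"
      using const_loop_in_loops [OF loops_eval] unfolding V(1) topspace_loop_space
      by (auto simp only: vimage_eq mem_Collect_eq Int_iff img)
    also have "\<dots> = (if K = {} then topspace (loop_space X) else {\<gamma> \<in> loops X. \<gamma> ` {0} \<subseteq> U})"
      by (simp add: topspace_loop_space)
    finally have e: "(\<lambda>\<gamma>. const_loop (\<gamma> 0)) -` V \<inter> topspace (loop_space X) = \<dots>" .
    have "{\<gamma> \<in> loops X. \<gamma> ` {0} \<subseteq> U} \<in> ?S"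
      using V(3) by (intro CollectI exI [of _ "{0}"] exI [of _ U]) simp
    then have "openin (loop_space X) {\<gamma> \<in> loops X. \<gamma> ` {0} \<subseteq> U}"
      unfolding loop_space_def by (rule topology_generated_by_Basis)
    then show "openin (loop_space X) ((\<lambda>\<gamma>. const_loop (\<gamma> 0)) -` V \<inter> topspace (loop_space X))"
      unfolding e by simp
  qed
  then show "continuous_map (loop_space X) (loop_space X) (\<lambda>\<gamma>. const_loop (\<gamma> 0))"
    by (simp add: loop_space_def)
qed

text \<open>Evaluation at the base point retracts \<open>\<Lambda>\<close> onto \<open>\<Lambda>\<^sub>0\<close>, so subtracting the image of a relative cycle
  under the retraction makes it absolute.\<close>

lemma relcycle_homologous_cycle:
  assumes c: "c \<in> relcycles (loop_space X) (const_loops X)"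
  obtains c' where "c' \<in> relcycles (loop_space X) {}"
    "kclass (loop_space X) (const_loops X) c' = kclass (loop_space X) (const_loops X) c"
proof
  let ?r = "\<lambda>\<gamma> :: real \<Rightarrow> 'a. const_loop (\<gamma> 0)"
  let ?L0 = "subtopology (loop_space X) (const_loops X)"
  have cc: "c \<in> carrier (kchains (loop_space X))" and bc: "kboundary c \<in> carrier (kchains ?L0)"
    using c by (auto simp: relcycles_def)
  have rc: "kpush ?r c \<in> carrier (kchains ?L0)"
    by (rule kpush_closed [OF continuous_map_const_loop_eval cc])
  \<comment> \<open>The boundary of c already consists of simplices in the constant loops, which the
    retraction fixes.\<close>
  have "kpush ?r (kboundary c) = kboundary c"
    by (rule kpush_id_on [OF bc]) (auto simp: const_loops_def const_loop_def fun_eq_iff)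
  then have "kboundary (c - kpush ?r c) = 0"
    by (simp add: kboundary_simps kboundary_kpush)
  then show "c - kpush ?r c \<in> relcycles (loop_space X) {}"
    using kchains_closed(3) [OF cc kchains_subtopology [OF rc]]
    by (simp add: relcycles_def kchains_closed(1))
  have "scale (- 1) (kpush ?r c) \<in> relboundaries (loop_space X) (const_loops X)"
    by (intro subchain_relboundary kchains_closed(4) rc)
  then show "kclass (loop_space X) (const_loops X) (c - kpush ?r c) = kclass (loop_space X) (const_loops X) c"
    by (intro kclass_eqI [OF cc]) (simp add: scale_simps)
qed

section \<open>Loop homology and the point class\<close>

lemma graded_module_loop_homology: "graded_module (loop_homology X n)"
  unfolding loop_homology_def by (rule graded_module.graded_module_shift_gmodule [OF graded_module_khomology])

lemma loop_homology_simps: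
  "carrier (loop_homology X n) = kclass (loop_space X) {} ` relcycles (loop_space X) {}"
  "homog (loop_homology X n) i = kclass (loop_space X) {} ` (homog (kchains (loop_space X)) (i + int n) \<inter> relcycles (loop_space X) {})"
  "\<zero>\<^bsub>loop_homology X n\<^esub> = relboundaries (loop_space X) {}"
  "A \<oplus>\<^bsub>loop_homology X n\<^esub> B = A <+>\<^bsub>kchains (loop_space X)\<^esub> B"
  by (simp_all add: loop_homology_def shift_gmodule_def khomology_def FactModule_simps kclass_def)

lemma kclass_smult:
  assumes "c \<in> relcycles (loop_space X) {}"
  shows "a \<odot>\<^bsub>loop_homology X n\<^esub> kclass (loop_space X) {} c = kclass (loop_space X) {} (scale a c)"
  using field_module.coset_smult [OF field_module_kchains ksubspace_relboundaries ksubspaceD(1) [OF ksubspace_relcycles assms]]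
  by (simp add: loop_homology_def shift_gmodule_def khomology_def FactModule_simps kclass_def)

lemma kclass_add:
  assumes "c \<in> carrier (kchains (loop_space X))" "d \<in> carrier (kchains (loop_space X))"
  shows "kclass (loop_space X) {} c \<oplus>\<^bsub>loop_homology X n\<^esub> kclass (loop_space X) {} d = kclass (loop_space X) {} (c + d)"
  using field_module.coset_add [OF field_module_kchains ksubspace_relboundaries assms]
  by (simp add: loop_homology_simps kclass_def)

definition point_chain :: "'a \<Rightarrow> ('k::field, real \<Rightarrow> 'a) kchain" where
  "point_chain x0 = Poly_Mapping.single (0, \<lambda>_\<in>standard_simplex 0. const_loop x0) 1"

text \<open>This is why the class of a point dies relative to \<open>\<Lambda>\<^sub>0\<close>, and
  hence why the projection factors through reduced homology.\<close>

lemma point_chain_const_loops: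
  assumes "x0 \<in> topspace X"
  shows "point_chain x0 \<in> carrier (kchains (subtopology (loop_space X) (const_loops X)))"
proof -
  have c: "const_loop x0 \<in> topspace (subtopology (loop_space X) (const_loops X))"
    using assms by (simp add: topspace_loop_space const_loop_in_loops const_loops_def)
  have "continuous_map (subtopology (powertop_real UNIV) (standard_simplex 0))
      (subtopology (loop_space X) (const_loops X)) (\<lambda>_\<in>standard_simplex 0. const_loop x0)"
    by (rule continuous_map_eq [of _ _ "\<lambda>_. const_loop x0"]) (use c in \<open>simp_all add: continuous_map_const\<close>)
  then have "singular_simplex 0 (subtopology (loop_space X) (const_loops X)) (\<lambda>_\<in>standard_simplex 0. const_loop x0)"
    by (simp add: singular_simplex_def)
  then show ?thesis by (simp add: point_chain_def mem_kchains_iff)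
qed

lemma point_chain_relcycles: "x0 \<in> topspace X \<Longrightarrow> point_chain x0 \<in> relcycles (loop_space X) {}"
  using kchains_subtopology [OF point_chain_const_loops, of x0 X]
  by (auto simp: relcycles_def point_chain_def kboundary_eq simplex_boundary_def scale_simps kchains_closed)

lemma euler_span_eq:
  assumes "x0 \<in> topspace X"
  shows "(euler_span X n x0 :: ('k::field, 'a) loop_class set) = {kclass (loop_space X) {} (scale (a * of_int (euler_char X n)) (point_chain x0)) | a. True}"
proof -
  have s: "scale a (point_chain x0) \<in> relcycles (loop_space X) {}" for a :: 'k
    using ksubspaceD(4) [OF ksubspace_relcycles point_chain_relcycles [OF assms], of a] by simp
  have p: "loop_point X x0 = kclass (loop_space X) {} (point_chain x0)"
    by (simp add: loop_point_def point_chain_def)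
  show ?thesis
    unfolding euler_span_def p
    by (simp add: kclass_smult [OF point_chain_relcycles [OF assms]] kclass_smult [OF s] scale_simps)
qed

lemma (in field_module) ksubspace_line: "v \<in> carrier V \<Longrightarrow> ksubspace V {a \<odot> v | a. True}"
  unfolding ksubspace_def
  using smult_l_distr [of v] smult_smult [of v] smult_zero_left [of v]
  by (auto, metis+)

lemma ksubspace_euler_span:
  assumes "x0 \<in> topspace X"
  shows "ksubspace (loop_homology X n) (euler_span X n x0)"
proof -
  interpret graded_module "loop_homology X n" by (rule graded_module_loop_homology)
  have "loop_point X x0 \<in> carrier (loop_homology X n)"
    unfolding loop_homology_simps loop_point_def point_chain_def [symmetric]
    by (intro imageI point_chain_relcycles assms)
  then show ?thesis
    unfolding euler_span_def by (intro ksubspace_line smult_closed)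
qed

section \<open>Reduced loop homology, its projection and its unit\<close>

lemma graded_module_reduced_loop_homology: "x0 \<in> topspace X \<Longrightarrow> graded_module (reduced_loop_homology X n x0)"
  unfolding reduced_loop_homology_def
  by (intro graded_module.graded_module_FactModule graded_module_loop_homology ksubspace_euler_span)

text \<open>A chain reached through the two nested cosets differs from c by an absolute boundary and
  a multiple of the point chain. Both are relative boundaries, so the double union in
  \<open>reduced_proj\<close> has a single value.\<close>

lemma reduced_proj_reduce:
  assumes x0: "x0 \<in> topspace X" and c: "c \<in> relcycles (loop_space X) {}"
  shows "reduced_proj X (reduce X n x0 (kclass (loop_space X) {} c)) = kclass (loop_space X) (const_loops X) c"
proof -
  let ?L = "loop_space X" and ?C = "const_loops X"
  have cc: "c \<in> carrier (kchains ?L)" using c by (simp add: relcycles_def)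
  have "kclass ?L ?C d = kclass ?L ?C c"
    if d: "d \<in> A" and A: "A \<in> reduce X n x0 (kclass ?L {} c)" for d A
  proof (rule kclass_eqI [OF cc])
    obtain e where e: "e \<in> euler_span X n x0" "A = e \<oplus>\<^bsub>loop_homology X n\<^esub> kclass ?L {} c"
      using A unfolding reduce_def mem_coset_iff by blast
    then obtain a where "e = kclass ?L {} (scale a (point_chain x0))"
      by (auto simp: euler_span_eq [OF x0])
    moreover have p: "scale a (point_chain x0) \<in> carrier (kchains (subtopology ?L ?C))"
      by (intro kchains_closed point_chain_const_loops x0)
    ultimately have "A = kclass ?L {} (scale a (point_chain x0) + c)"
      using e(2) kclass_add [OF kchains_subtopology [OF p] cc] by simp
    then obtain b where b: "b \<in> relboundaries ?L {}" "d = b + (scale a (point_chain x0) + c)"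
      using d by (auto simp: kclass_def mem_coset_iff)
    have "b \<in> relboundaries ?L ?C" using b(1) relboundaries_mono [of "{}" ?C] by auto
    moreover have "scale a (point_chain x0) \<in> relboundaries ?L ?C" by (rule subchain_relboundary [OF p])
    ultimately show "d - c \<in> relboundaries ?L ?C"
      using ksubspaceD(3) [OF ksubspace_relboundaries [of ?L ?C]] b(2) by (simp add: add.assoc)
  qed
  then have "reduced_proj X (reduce X n x0 (kclass ?L {} c))
      = (\<Union>A\<in>reduce X n x0 (kclass ?L {} c). \<Union>d\<in>A. kclass ?L ?C c)"
    by (simp add: reduced_proj_def)
  \<comment> \<open>Both unions are over nonempty sets, so they return the common class.\<close>
  moreover have "kclass ?L {} c \<in> reduce X n x0 (kclass ?L {} c)"
    unfolding reduce_def
    by (rule field_module.coset_self [OF _ ksubspace_euler_span [OF x0]])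
      (use graded_module_loop_homology c in \<open>auto simp: graded_module_def loop_homology_simps\<close>)
  moreover have "c \<in> kclass ?L {} c"
    unfolding kclass_def by (rule field_module.coset_self [OF field_module_kchains ksubspace_relboundaries cc])
  ultimately show ?thesis by (auto intro!: bexI)
qed

lemma reduced_proj_surj:
  assumes x0: "x0 \<in> topspace X" and Y: "Y \<in> carrier (rel_loop_homology X n)"
  obtains A where "A \<in> carrier (reduced_loop_homology X n x0)" "reduced_proj X A = Y"
proof -
  obtain c where c: "c \<in> relcycles (loop_space X) (const_loops X)" "Y = kclass (loop_space X) (const_loops X) c"
    using Y by (auto simp: rel_loop_homology_def shift_gmodule_def carrier_khomology)
  obtain c' where c': "c' \<in> relcycles (loop_space X) {}"
    "kclass (loop_space X) (const_loops X) c' = kclass (loop_space X) (const_loops X) c"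
    by (rule relcycle_homologous_cycle [OF c(1)])
  show thesis
  proof
    show "reduce X n x0 (kclass (loop_space X) {} c') \<in> carrier (reduced_loop_homology X n x0)"
      unfolding reduced_loop_homology_def FactModule_simps loop_homology_simps reduce_def
      using c'(1) by blast
    show "reduced_proj X (reduce X n x0 (kclass (loop_space X) {} c')) = Y"
      using reduced_proj_reduce [OF x0 c'(1)] c'(2) c(2) by simp
  qed
qed

text \<open>\<^const>\<open>fundamental_cycle\<close> is a choice which might a priori fail to be a cycle.
  That it is one modulo boundaries follows if its class is known to lie in the carrier.\<close>

lemma reduced_unit_homog:
  assumes x0: "x0 \<in> topspace X"
    and u: "(reduced_unit X n \<omega> x0 :: ('k::field, 'a) reduced_loop_class) \<in> carrier (reduced_loop_homology X n x0)"
  shows "(reduced_unit X n \<omega> x0 :: ('k, 'a) reduced_loop_class) \<in> homog (reduced_loop_homology X n x0) 0"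
proof -
  let ?L = "loop_space X" and ?B = "relboundaries (loop_space X) {} :: ('k, real \<Rightarrow> 'a) kchain set"
    and ?E = "euler_span X n x0 :: ('k, 'a) loop_class set"
  let ?c = "kpush const_loop (kfundamental_cycle X n \<omega>) :: ('k, real \<Rightarrow> 'a) kchain"
  interpret graded_module "loop_homology X n :: ('k, ('k, 'a) loop_class) gmodule" by (rule graded_module_loop_homology)
  have B: "0 \<in> ?B" "\<And>b b'. b \<in> ?B \<Longrightarrow> b' \<in> ?B \<Longrightarrow> b + b' \<in> ?B"
    using ksubspaceD(2,3) [OF ksubspace_relboundaries [of ?L "{}"]] by simp_all
  have r: "(reduced_unit X n \<omega> x0 :: ('k, 'a) reduced_loop_class) = ?E +>\<^bsub>loop_homology X n\<^esub> kclass ?L {} ?c"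
    by (simp add: reduced_unit_def reduce_def loop_unit_def)
  then obtain h where h: "h \<in> carrier (loop_homology X n)" "?E +>\<^bsub>loop_homology X n\<^esub> kclass ?L {} ?c = ?E +>\<^bsub>loop_homology X n\<^esub> h"
    using u by (auto simp: reduced_loop_homology_def FactModule_simps)
  \<comment> \<open>At this point \<open>?c\<close> is not known to be a singular chain, so the
    rules for classes of chains are out of reach. Absorption of boundaries follows from
    \<open>?B\<close> being closed under addition and containing 0.\<close>
  have "?B <+>\<^bsub>kchains ?L\<^esub> kclass ?L {} ?c = kclass ?L {} ?c"
  proof
    show "?B <+>\<^bsub>kchains ?L\<^esub> kclass ?L {} ?c \<subseteq> kclass ?L {} ?c"
      using B(2) by (auto simp: set_add_def' kclass_def mem_coset_iff a_r_coset_def' add.assoc [symmetric])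
    show "kclass ?L {} ?c \<subseteq> ?B <+>\<^bsub>kchains ?L\<^esub> kclass ?L {} ?c"
      using B(1) by (force simp: set_add_def')
  qed
  \<comment> \<open>\<open>?B\<close> is the zero of loop homology and hence the element of
    \<open>?E\<close> to be added.\<close>
  then have "kclass ?L {} ?c \<in> ?E +>\<^bsub>loop_homology X n\<^esub> kclass ?L {} ?c"
    using ksubspaceD(2) [OF ksubspace_euler_span [OF x0], of n]
    unfolding mem_coset_iff loop_homology_simps by (intro bexI [of _ ?B]) auto
  then obtain e where "e \<in> ?E" "kclass ?L {} ?c = e \<oplus>\<^bsub>loop_homology X n\<^esub> h"
    unfolding h(2) mem_coset_iff by blast
  then have "kclass ?L {} ?c \<in> carrier (loop_homology X n)"
    using h(1) ksubspaceD(1) [OF ksubspace_euler_span [OF x0]] by auto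
  then obtain z where z: "z \<in> relcycles ?L {}" "kclass ?L {} ?c = kclass ?L {} z"
    by (auto simp: loop_homology_simps)
  have "?c \<in> kclass ?L {} ?c" using B(1) by (force simp: kclass_def mem_coset_iff)
  then obtain b where b: "b \<in> ?B" "?c = b + z"
    unfolding z(2) unfolding kclass_def mem_coset_iff by auto
  \<comment> \<open>The chain \<open>?c\<close> is concentrated in dimension n, but z may have other
    components. Comparing components of dimension n in \<open>?c = b + z\<close> replaces z by a
    homogeneous cycle.\<close>
  let ?z = "dim_part n z"
  have k: "Poly_Mapping.keys (kfundamental_cycle X n \<omega> :: ('k, 'a) kchain) \<subseteq> {x. fst x = n}"
    unfolding kfundamental_cycle_def Let_def
    by (rule order_trans [OF keys_sum]) (auto split: if_splits)
  have "Poly_Mapping.keys ?c \<subseteq> {x. fst x = n}"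
    unfolding kpush_simplex by (rule keys_lin_ext) (use k in auto)
  then have "?c = dim_part n b + ?z"
    using dim_part_eq_self [of ?c n] b(2) by (simp add: dim_part_add)
  then have "kclass ?L {} ?c = kclass ?L {} ?z"
    using dim_part_relboundaries [OF b(1), of n] dim_part_relcycles [OF z(1), of n]
    by (intro kclass_eqI) (auto simp: relcycles_def)
  moreover have "?z \<in> homog (kchains ?L) (int n) \<inter> relcycles ?L {}"
    using dim_part_relcycles [OF z(1), of n] z(1)
    by (auto simp: relcycles_def kchains_def keys_dim_part)
  \<comment> \<open>Dimension n is degree 0 after the shift by n.\<close>
  ultimately have "kclass ?L {} ?c \<in> homog (loop_homology X n) 0"
    unfolding loop_homology_simps by auto
  then show ?thesis
    unfolding r reduced_loop_homology_def FactModule_simps by blast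
qed

theorem proposition1p2:
  fixes X :: "'a topology" and n :: nat and \<omega> :: "'a \<Rightarrow> 'a chain set" and x0 :: 'a
    and m :: "('k::field, 'a) reduced_loop_class \<Rightarrow> ('k, 'a) reduced_loop_class
              \<Rightarrow> ('k, 'a) reduced_loop_class"
  assumes "closed_manifold X n" and "orientation X n \<omega>" and "n = 1 \<or> n \<ge> 3"
    and "x0 \<in> topspace X"
    and "reduced_loop_product X n \<omega> x0 m"
  shows
    "(\<forall>l l' S.
        reduced_loop_coproduct X n \<omega> x0 m l \<longrightarrow> reduced_loop_coproduct X n \<omega> x0 m l' \<longrightarrow>
        S \<subseteq> carrier (reduced_loop_homology X n x0) \<longrightarrow>
        alg_generated (reduced_loop_homology X n x0) m (reduced_unit X n \<omega> x0) S
          = carrier (reduced_loop_homology X n x0) \<longrightarrow>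
        l (reduced_unit X n \<omega> x0) = l' (reduced_unit X n \<omega> x0) \<longrightarrow>
        (\<forall>s\<in>S. l s = l' s) \<longrightarrow>
        (\<forall>a\<in>carrier (reduced_loop_homology X n x0). l a = l' a)) \<and>
     (\<forall>l \<nu>.
        reduced_loop_coproduct X n \<omega> x0 m l \<longrightarrow>
        coalgebra_map (reduced_loop_homology X n x0) (rel_loop_homology X n)
          (reduced_proj X) l \<nu> \<longrightarrow>
        (\<forall>a\<in>carrier (rel_loop_homology X n). \<nu> a = loop_coproduct X n \<omega> a))"
proof (intro conjI allI impI ballI)
  interpret graded_module "reduced_loop_homology X n x0 :: ('k, ('k, 'a) reduced_loop_class) gmodule"
    by (rule graded_module_reduced_loop_homology [OF assms(4)])
  interpret graded_algebra "reduced_loop_homology X n x0" m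
    by unfold_locales (use assms(5) in \<open>simp add: reduced_loop_product_def\<close>)
  fix l l' :: "('k, 'a) reduced_loop_class \<Rightarrow> ('k, ('k, 'a) reduced_loop_class) tensor"
    and S :: "('k, 'a) reduced_loop_class set" and a
  assume l: "reduced_loop_coproduct X n \<omega> x0 m l" "reduced_loop_coproduct X n \<omega> x0 m l'"
    and S: "S \<subseteq> carrier (reduced_loop_homology X n x0)"
      "alg_generated (reduced_loop_homology X n x0) m (reduced_unit X n \<omega> x0) S
          = carrier (reduced_loop_homology X n x0)"
    and eq: "l (reduced_unit X n \<omega> x0) = l' (reduced_unit X n \<omega> x0)" "\<forall>s\<in>S. l s = l' s"
    and a: "a \<in> carrier (reduced_loop_homology X n x0 :: ('k, ('k, 'a) reduced_loop_class) gmodule)"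
  \<comment> \<open>The generated subalgebra contains the unit and equals the carrier; this
    membership is what yields that the unit has degree 0.\<close>
  have "(reduced_unit X n \<omega> x0 :: ('k, 'a) reduced_loop_class) \<in> carrier (reduced_loop_homology X n x0)"
    unfolding S(2) [symmetric] by (rule alg_generated.unit)
  note unit = reduced_unit_homog [OF assms(4) this]
  have L: "klinear (reduced_loop_homology X n x0) (tpow 2 (reduced_loop_homology X n x0)) l"
    "unital_infinitesimal_relation (reduced_loop_homology X n x0) (1 - 2 * int n) m (reduced_unit X n \<omega> x0) l"
    using l(1) unfolding reduced_loop_coproduct_def by (blast intro: glinear_imp_klinear)+
  have L': "klinear (reduced_loop_homology X n x0) (tpow 2 (reduced_loop_homology X n x0)) l'"
    "unital_infinitesimal_relation (reduced_loop_homology X n x0) (1 - 2 * int n) m (reduced_unit X n \<omega> x0) l'"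
    using l(2) unfolding reduced_loop_coproduct_def by (blast intro: glinear_imp_klinear)+
  show "l a = l' a"
    by (rule infinitesimal_coproduct_unique
        [where l = l and l' = l' and u = "reduced_unit X n \<omega> x0" and S = S, OF L L' unit eq(1) S(1)]) (use eq(2) a S(2) in simp_all)
next
  fix l :: "('k, 'a) reduced_loop_class \<Rightarrow> ('k, ('k, 'a) reduced_loop_class) tensor" and \<nu> Y
  assume l: "reduced_loop_coproduct X n \<omega> x0 m l"
    and \<nu>: "coalgebra_map (reduced_loop_homology X n x0) (rel_loop_homology X n) (reduced_proj X) l \<nu>"
    and Y: "Y \<in> carrier (rel_loop_homology X n :: ('k, ('k, 'a) loop_class) gmodule)"
  obtain A where "A \<in> carrier (reduced_loop_homology X n x0)" "reduced_proj X A = Y"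
    using reduced_proj_surj [OF assms(4) Y] by metis
  \<comment> \<open>Both coproducts make the projection a coalgebra map from the same l, so at Y
    each equals the image of \<open>l A\<close> under the tensor square of the projection.\<close>
  then show "\<nu> Y = loop_coproduct X n \<omega> Y"
    using l \<nu> unfolding reduced_loop_coproduct_def coalgebra_map_def by metis
qed

end
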